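(* Let $k$ be an algebraically closed field of characteristic zero and let $\mathfrak{g}$ be a finite-dimensional Lie algebra over $k$. Let $H$ be a locally finite connected Hopf algebra over $k$ with $P(H)=\mathfrak{g}$, such that $H$ is generated by $P_2(H)$ and $H\neq U_H$. If $U_H$ is a normal Hopf subalgebra of $H$, then $\mathrm{GK.dim}(H)=\dim_k P_2(H)$.
   Context: All algebras, tensor products and linear maps are over $k$. $\mathrm{GK.dim}$ denotes Gelfand-Kirillov dimension. For a Hopf algebra $H$ with comultiplication $\Delta$ (Sweedler notation $\Delta(h)=\sum_h h_1\otimes h_2$) and antipode $S$, let $\{H_n\}_{n\ge 0}$ be the coradical filtration. $H$ is connected if $H_0=k$; a connected Hopf algebra is locally finite if every $H_n$ is finite-dimensional, equivalently if the Lie algebra of primitive elements $P(H)=\{x\in H:\Delta(x)=x\otimes 1+1\otimes x\}$ is finite-dimensional. $U_H$ denotes the Hopf subalgebra of $H$ generated by $P(H)$ (it is isomorphic to the enveloping algebra $U(P(H))$). Let $\tau(v\otimes w)=w\otimes v$ be the twist map and define $\delta:H\to H\otimes H$ by $\delta(h)=\Delta(h)-(h\otimes 1+1\otimes h)$. Then $P_2(H)=\{c\in H:\tau\circ\delta(c)=-\delta(c)\text{ and }\delta(c)\in P(H)\otimes P(H)\}$. A Hopf subalgebra $A$ of $H$ is normal if $\mathrm{ad}_l[h](a):=\sum_h h_1aS(h_2)\in A$ and $\mathrm{ad}_r[h](a):=\sum_h S(h_1)ah_2\in A$ for all $h\in H$, $a\in A$. *)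

theory Defs
  imports
    "HOL-Library.Poly_Mapping"
    "HOL-Library.Extended_Real"
    "HOL-Library.Liminf_Limsup"
    "HOL-Computational_Algebra.Polynomial"
    Complex_Main
begin

section \<open>Free vector spaces\<close>

definition free_scale :: "'k::field \<Rightarrow> ('p \<Rightarrow>\<^sub>0 'k) \<Rightarrow> ('p \<Rightarrow>\<^sub>0 'k)" where
  "free_scale c u = Poly_Mapping.map ((*) c) u"

text \<open>The linear extension of a map \<^term>\<open>f\<close> on the basis to the free vector space;
  \<^term>\<open>s\<close> is the scalar multiplication of the target.\<close>

definition lin_ext :: "('k::field \<Rightarrow> 'w \<Rightarrow> 'w) \<Rightarrow> ('p \<Rightarrow> 'w) \<Rightarrow> ('p \<Rightarrow>\<^sub>0 'k) \<Rightarrow> 'w::ab_group_add" where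
  "lin_ext s f u = (\<Sum>p\<in>Poly_Mapping.keys u. s (Poly_Mapping.lookup u p) (f p))"

lemma lookup_free_scale [simp]:
  "Poly_Mapping.lookup (free_scale c u) p = c * Poly_Mapping.lookup u p"
  by (simp add: free_scale_def map.rep_eq when_def)

lemma vector_space_free: "vector_space free_scale"
  by unfold_locales (auto intro!: poly_mapping_eqI simp: lookup_add algebra_simps)

interpretation free: vector_space free_scale
  by (rule vector_space_free)

context vector_space
begin

lemma lin_ext_superset:
  assumes "finite A" "Poly_Mapping.keys u \<subseteq> A"
  shows "lin_ext scale f u = (\<Sum>p\<in>A. scale (Poly_Mapping.lookup u p) (f p))"
  unfolding lin_ext_def
  by (rule sum.mono_neutral_left) (use assms in \<open>auto simp: in_keys_iff\<close>)

lemma linear_lin_ext: "Vector_Spaces.linear free_scale scale (lin_ext scale f)"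
proof unfold_locales
  fix u v :: "'c \<Rightarrow>\<^sub>0 'a" and c
  let ?A = "Poly_Mapping.keys u \<union> Poly_Mapping.keys v"
  have *: "finite ?A" "Poly_Mapping.keys (u + v) \<subseteq> ?A"
    using Poly_Mapping.keys_add[of u v] by auto
  show "lin_ext scale f (u + v) = lin_ext scale f u + lin_ext scale f v"
    by (simp add: lin_ext_superset[OF *] lin_ext_superset[of ?A u] lin_ext_superset[of ?A v]
        lookup_add scale_left_distrib sum.distrib)
  have "Poly_Mapping.keys (free_scale c u) \<subseteq> Poly_Mapping.keys u"
    by (auto simp: in_keys_iff)
  then show "lin_ext scale f (free_scale c u) = scale c (lin_ext scale f u)"
    by (subst lin_ext_superset[of "Poly_Mapping.keys u"])
      (auto simp: lin_ext_def scale_sum_right)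
qed

lemma lin_ext_single [simp]: "lin_ext scale f (Poly_Mapping.single p c) = scale c (f p)"
  by (cases "c = 0") (auto simp: lin_ext_def)

end


section \<open>Dimension\<close>

locale k_vector_space = vector_space scale
  for scale :: "'a::field \<Rightarrow> 'b::ab_group_add \<Rightarrow> 'b"
begin

definition fin_dim :: "'b set \<Rightarrow> bool" where
  "fin_dim V \<longleftrightarrow> (\<exists>B. finite B \<and> span B = V)"

text \<open>The library's \<^const>\<open>dim\<close> is \<open>0\<close> on spaces of infinite dimension.\<close>

definition vdim :: "'b set \<Rightarrow> ereal" where
  "vdim V = (if fin_dim V then ereal (real (dim V)) else \<infinity>)"

end


section \<open>Lie algebras\<close>

text \<open>A Lie algebra whose underlying space is a subspace \<open>L\<close> of the ambient type.\<close>

locale lie_algebra = k_vector_space scale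
  for scale :: "'k::field \<Rightarrow> 'h::ab_group_add \<Rightarrow> 'h" +
  fixes L :: "'h set" and br :: "'h \<Rightarrow> 'h \<Rightarrow> 'h"
  assumes subspace_L: "subspace L"
    and br_closed: "x \<in> L \<Longrightarrow> y \<in> L \<Longrightarrow> br x y \<in> L"
    and br_add_left: "x \<in> L \<Longrightarrow> y \<in> L \<Longrightarrow> z \<in> L \<Longrightarrow> br (x + y) z = br x z + br y z"
    and br_add_right: "x \<in> L \<Longrightarrow> y \<in> L \<Longrightarrow> z \<in> L \<Longrightarrow> br x (y + z) = br x y + br x z"
    and br_scale_left: "x \<in> L \<Longrightarrow> y \<in> L \<Longrightarrow> br (scale c x) y = scale c (br x y)"
    and br_scale_right: "x \<in> L \<Longrightarrow> y \<in> L \<Longrightarrow> br x (scale c y) = scale c (br x y)"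
    and br_self: "x \<in> L \<Longrightarrow> br x x = 0"
    and jacobi: "x \<in> L \<Longrightarrow> y \<in> L \<Longrightarrow> z \<in> L \<Longrightarrow>
      br x (br y z) + br y (br z x) + br z (br x y) = 0"


section \<open>Algebras and their Gelfand-Kirillov dimension\<close>

locale k_algebra = k_vector_space scale
  for scale :: "'k::field \<Rightarrow> 'h::ring_1 \<Rightarrow> 'h" +
  assumes scale_mult_left: "scale c x * y = scale c (x * y)"
    and scale_mult_right: "x * scale c y = scale c (x * y)"
begin

definition subalgebra :: "'h set \<Rightarrow> bool" where
  "subalgebra A \<longleftrightarrow> subspace A \<and> 1 \<in> A \<and> (\<forall>x\<in>A. \<forall>y\<in>A. x * y \<in> A)"

definition generated_subalgebra :: "'h set \<Rightarrow> 'h set" where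
  "generated_subalgebra X = \<Inter>{A. subalgebra A \<and> X \<subseteq> A}"

text \<open>The space \<open>k + V + V\<^sup>2 + \<dots> + V\<^sup>n\<close>.\<close>

definition pow_sum :: "'h set \<Rightarrow> nat \<Rightarrow> 'h set" where
  "pow_sum V n = span {prod_list xs |xs. set xs \<subseteq> V \<and> length xs \<le> n}"

definition GK_dim :: ereal where
  "GK_dim = (SUP V\<in>{V. fin_dim V}. limsup (\<lambda>n. ereal (log (real n) (real (dim (pow_sum V n))))))"

end


section \<open>The tensor square of a vector space\<close>

text \<open>An element of \<open>H \<otimes> H\<close> is a coset of the free vector space on \<open>H \<times> H\<close> modulo the span
  of the bilinear relations. A threefold product \<open>H \<otimes> H \<otimes> H\<close> is formed in the same way.\<close>

type_synonym ('k, 'h) tensor2 = "(('h \<times> 'h) \<Rightarrow>\<^sub>0 'k) set"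
type_synonym ('k, 'h) tensor3 = "(('h \<times> 'h \<times> 'h) \<Rightarrow>\<^sub>0 'k) set"

abbreviation gen :: "'p \<Rightarrow> ('p \<Rightarrow>\<^sub>0 'k::field)" where
  "gen p \<equiv> Poly_Mapping.single p 1"

context k_vector_space
begin

definition bilinear_rels :: "(('b \<times> 'b) \<Rightarrow>\<^sub>0 'a) set" where
  "bilinear_rels =
     {gen (x + x', y) - gen (x, y) - gen (x', y) |x x' y. True} \<union>
     {gen (x, y + y') - gen (x, y) - gen (x, y') |x y y'. True} \<union>
     {gen (scale c x, y) - free_scale c (gen (x, y)) |c x y. True} \<union>
     {gen (x, scale c y) - free_scale c (gen (x, y)) |c x y. True}"

definition trilinear_rels :: "(('b \<times> 'b \<times> 'b) \<Rightarrow>\<^sub>0 'a) set" where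
  "trilinear_rels =
     {gen (x + x', y, z) - gen (x, y, z) - gen (x', y, z) |x x' y z. True} \<union>
     {gen (x, y + y', z) - gen (x, y, z) - gen (x, y', z) |x y y' z. True} \<union>
     {gen (x, y, z + z') - gen (x, y, z) - gen (x, y, z') |x y z z'. True} \<union>
     {gen (scale c x, y, z) - free_scale c (gen (x, y, z)) |c x y z. True} \<union>
     {gen (x, scale c y, z) - free_scale c (gen (x, y, z)) |c x y z. True} \<union>
     {gen (x, y, scale c z) - free_scale c (gen (x, y, z)) |c x y z. True}"

definition tensor_class :: "(('b \<times> 'b) \<Rightarrow>\<^sub>0 'a) \<Rightarrow> ('a, 'b) tensor2" where
  "tensor_class u = {v. v - u \<in> free.span bilinear_rels}"

definition tensor3_class :: "(('b \<times> 'b \<times> 'b) \<Rightarrow>\<^sub>0 'a) \<Rightarrow> ('a, 'b) tensor3" where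
  "tensor3_class u = {v. v - u \<in> free.span trilinear_rels}"

definition tensors :: "('a, 'b) tensor2 set" where
  "tensors = range tensor_class"

definition rep :: "('a, 'b) tensor2 \<Rightarrow> (('b \<times> 'b) \<Rightarrow>\<^sub>0 'a)" where
  "rep X = (SOME u. u \<in> X)"

definition pure_tensor :: "'b \<Rightarrow> 'b \<Rightarrow> ('a, 'b) tensor2" where
  "pure_tensor x y = tensor_class (gen (x, y))"

definition tensor_add :: "('a, 'b) tensor2 \<Rightarrow> ('a, 'b) tensor2 \<Rightarrow> ('a, 'b) tensor2" where
  "tensor_add X Y = tensor_class (rep X + rep Y)"

definition tensor_uminus :: "('a, 'b) tensor2 \<Rightarrow> ('a, 'b) tensor2" where
  "tensor_uminus X = tensor_class (- rep X)"

definition tensor_scale :: "'a \<Rightarrow> ('a, 'b) tensor2 \<Rightarrow> ('a, 'b) tensor2" where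
  "tensor_scale c X = tensor_class (free_scale c (rep X))"

text \<open>The flip \<open>x \<otimes> y \<mapsto> y \<otimes> x\<close>.\<close>

definition tensor_twist :: "('a, 'b) tensor2 \<Rightarrow> ('a, 'b) tensor2" where
  "tensor_twist X = tensor_class (lin_ext free_scale (\<lambda>(x, y). gen (y, x)) (rep X))"

text \<open>The linear map \<open>x \<otimes> y \<mapsto> f x y\<close> induced by a bilinear \<open>f\<close>; it serves to write sums in
  Sweedler notation: \<open>\<Sum> f h\<^sub>1 h\<^sub>2\<close> is \<open>tensor_lift f (\<Delta> h)\<close>.\<close>

definition tensor_lift :: "('b \<Rightarrow> 'b \<Rightarrow> 'b) \<Rightarrow> ('a, 'b) tensor2 \<Rightarrow> 'b" where
  "tensor_lift f X = lin_ext scale (\<lambda>(x, y). f x y) (rep X)"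

text \<open>The subspace \<open>A \<otimes> B\<close> of \<open>H \<otimes> H\<close> for subspaces \<open>A\<close> and \<open>B\<close> of \<open>H\<close>.\<close>

definition tensor_sub :: "'b set \<Rightarrow> 'b set \<Rightarrow> ('a, 'b) tensor2 set" where
  "tensor_sub A B = {tensor_class u |u. Poly_Mapping.keys u \<subseteq> A \<times> B}"

lemma tensor_class_eq_iff: "tensor_class u = tensor_class v \<longleftrightarrow> u - v \<in> free.span bilinear_rels"
proof
  assume "tensor_class u = tensor_class v"
  moreover have "u \<in> tensor_class u"
    by (simp add: tensor_class_def free.span_zero)
  ultimately show "u - v \<in> free.span bilinear_rels"
    by (simp add: tensor_class_def)
next
  assume *: "u - v \<in> free.span bilinear_rels"
  have "w - u \<in> free.span bilinear_rels \<longleftrightarrow> w - v \<in> free.span bilinear_rels" for w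
    using free.span_add[OF _ *, of "w - u"] free.span_diff[OF _ *, of "w - v"] by auto
  then show "tensor_class u = tensor_class v"
    by (auto simp: tensor_class_def)
qed

lemma rep_tensor_class: "rep (tensor_class u) - u \<in> free.span bilinear_rels"
proof -
  have "u \<in> tensor_class u"
    by (simp add: tensor_class_def free.span_zero)
  then have "rep (tensor_class u) \<in> tensor_class u"
    unfolding rep_def by (rule someI)
  then show ?thesis
    by (simp add: tensor_class_def)
qed

lemma tensor_add_class:
  "tensor_add (tensor_class u) (tensor_class v) = tensor_class (u + v)"
  unfolding tensor_add_def tensor_class_eq_iff
  using free.span_add[OF rep_tensor_class rep_tensor_class, of u v]
  by (simp add: algebra_simps)

lemma tensor_uminus_class: "tensor_uminus (tensor_class u) = tensor_class (- u)"
  unfolding tensor_uminus_def tensor_class_eq_iff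
  using free.span_neg[OF rep_tensor_class, of u] by (simp add: algebra_simps)

lemma tensor_scale_class: "tensor_scale c (tensor_class u) = tensor_class (free_scale c u)"
  unfolding tensor_scale_def tensor_class_eq_iff
  using free.span_scale[OF rep_tensor_class, of c u] by (simp add: free.scale_right_diff_distrib)

lemma pure_tensor_bilinear:
  "pure_tensor (x + x') y = tensor_add (pure_tensor x y) (pure_tensor x' y)"
  "pure_tensor x (y + y') = tensor_add (pure_tensor x y) (pure_tensor x y')"
  "pure_tensor (scale c x) y = tensor_scale c (pure_tensor x y)"
  "pure_tensor x (scale c y) = tensor_scale c (pure_tensor x y)"
  unfolding pure_tensor_def tensor_add_class tensor_scale_class tensor_class_eq_iff
  by (rule free.span_base; force simp: bilinear_rels_def diff_diff_eq)+

text \<open>A linear map on the free vector space which respects the bilinear relations up to a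
  subspace \<open>N\<close> respects tensors up to \<open>N\<close>.\<close>

lemma lin_ext_respects:
  assumes "vector_space s" "module.subspace s N"
    and addl: "\<And>x x' y. f (x + x', y) - f (x, y) - f (x', y) \<in> N"
    and addr: "\<And>x y y'. f (x, y + y') - f (x, y) - f (x, y') \<in> N"
    and scl: "\<And>c x y. f (scale c x, y) - s c (f (x, y)) \<in> N"
    and scr: "\<And>c x y. f (x, scale c y) - s c (f (x, y)) \<in> N"
    and w: "w \<in> free.span bilinear_rels"
  shows "lin_ext s f w \<in> N"
proof -
  interpret t: vector_space s by fact
  interpret l: Vector_Spaces.linear free_scale s "lin_ext s f"
    by (rule t.linear_lin_ext)
  have sub: "free.subspace {w. lin_ext s f w \<in> N}"
    by (rule l.subspace_vimage[unfolded vimage_def]) (rule assms(2))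
  have "bilinear_rels \<subseteq> {w. lin_ext s f w \<in> N}"
    using addl addr scl scr by (auto simp: bilinear_rels_def l.diff l.scale)
  with sub w show ?thesis
    using free.span_minimal by blast
qed

lemma tensor_lift_class:
  assumes "\<And>y. Vector_Spaces.linear scale scale (\<lambda>x. f x y)" "\<And>x. Vector_Spaces.linear scale scale (f x)"
  shows "tensor_lift f (tensor_class u) = lin_ext scale (\<lambda>(x, y). f x y) u"
proof -
  interpret l: Vector_Spaces.linear free_scale scale "lin_ext scale (\<lambda>(x, y). f x y)"
    by (rule linear_lin_ext)
  have "lin_ext scale (\<lambda>(x, y). f x y) (rep (tensor_class u) - u) \<in> {0}"
    by (rule lin_ext_respects[OF vector_space_axioms _ _ _ _ _ rep_tensor_class])
      (use assms in \<open>auto simp: linear_iff_module_hom module_hom_iff\<close>)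
  then show ?thesis
    by (simp add: tensor_lift_def l.diff)
qed

lemma tensor_lift_pure:
  assumes "\<And>y. Vector_Spaces.linear scale scale (\<lambda>x. f x y)" "\<And>x. Vector_Spaces.linear scale scale (f x)"
  shows "tensor_lift f (pure_tensor x y) = f x y"
  by (simp add: pure_tensor_def tensor_lift_class[OF assms])

lemma tensor_twist_pure: "tensor_twist (pure_tensor x y) = pure_tensor y x"
proof -
  let ?f = "\<lambda>(x, y). gen (y, x) :: ('b \<times> 'b) \<Rightarrow>\<^sub>0 'a"
  interpret l: Vector_Spaces.linear free_scale free_scale "lin_ext free_scale ?f"
    by (rule free.linear_lin_ext)
  have "lin_ext free_scale ?f (rep (tensor_class (gen (x, y))) - gen (x, y))
      \<in> free.span bilinear_rels"
    by (rule lin_ext_respects[OF vector_space_free free.subspace_span _ _ _ _ rep_tensor_class];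
        rule free.span_base; force simp: bilinear_rels_def)
  then show ?thesis
    unfolding tensor_twist_def pure_tensor_def tensor_class_eq_iff
    by (simp add: l.diff)
qed

end

context k_algebra
begin

text \<open>The product \<open>(x \<otimes> y) (x' \<otimes> y') = x x' \<otimes> y y'\<close>.\<close>

definition tensor_mult :: "('k, 'h) tensor2 \<Rightarrow> ('k, 'h) tensor2 \<Rightarrow> ('k, 'h) tensor2" where
  "tensor_mult X Y = tensor_class
     (lin_ext free_scale (\<lambda>(x, y).
        lin_ext free_scale (\<lambda>(x', y'). gen (x * x', y * y')) (rep Y)) (rep X))"

end


section \<open>Hopf algebras\<close>

locale hopf_algebra = k_algebra scale
  for scale :: "'k::field \<Rightarrow> 'h::ring_1 \<Rightarrow> 'h" +
  fixes \<Delta> :: "'h \<Rightarrow> ('k, 'h) tensor2"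
    and \<epsilon> :: "'h \<Rightarrow> 'k"
    and S :: "'h \<Rightarrow> 'h"
  assumes comult_tensor: "\<Delta> h \<in> tensors"
    and comult_add: "\<Delta> (g + h) = tensor_add (\<Delta> g) (\<Delta> h)"
    and comult_scale: "\<Delta> (scale c h) = tensor_scale c (\<Delta> h)"
    and coassoc: \<comment> \<open>\<open>(\<Delta> \<otimes> id) \<circ> \<Delta> = (id \<otimes> \<Delta>) \<circ> \<Delta>\<close>\<close>
      "tensor3_class (lin_ext free_scale (\<lambda>(a, b).
         lin_ext free_scale (\<lambda>(x, y). gen (x, y, b)) (rep (\<Delta> a))) (rep (\<Delta> h))) =
       tensor3_class (lin_ext free_scale (\<lambda>(a, b).
         lin_ext free_scale (\<lambda>(x, y). gen (a, x, y)) (rep (\<Delta> b))) (rep (\<Delta> h)))"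
    and counit_linear: "Vector_Spaces.linear scale (*) \<epsilon>"
    and counit_left: "tensor_lift (\<lambda>x y. scale (\<epsilon> x) y) (\<Delta> h) = h"
    and counit_right: "tensor_lift (\<lambda>x y. scale (\<epsilon> y) x) (\<Delta> h) = h"
    and comult_mult: "\<Delta> (g * h) = tensor_mult (\<Delta> g) (\<Delta> h)"
    and comult_one: "\<Delta> 1 = pure_tensor 1 1"
    and counit_mult: "\<epsilon> (g * h) = \<epsilon> g * \<epsilon> h"
    and counit_one: "\<epsilon> 1 = 1"
    and antipode_linear: "Vector_Spaces.linear scale scale S"
    and antipode_left: "tensor_lift (\<lambda>x y. S x * y) (\<Delta> h) = scale (\<epsilon> h) 1"
    and antipode_right: "tensor_lift (\<lambda>x y. x * S y) (\<Delta> h) = scale (\<epsilon> h) 1"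
begin

definition subcoalgebra :: "'h set \<Rightarrow> bool" where
  "subcoalgebra C \<longleftrightarrow> subspace C \<and> \<Delta> ` C \<subseteq> tensor_sub C C"

definition simple_subcoalgebra :: "'h set \<Rightarrow> bool" where
  "simple_subcoalgebra C \<longleftrightarrow> subcoalgebra C \<and> C \<noteq> {0} \<and>
     (\<forall>D. subcoalgebra D \<and> D \<subseteq> C \<longrightarrow> D = {0} \<or> D = C)"

definition coradical :: "'h set" where
  "coradical = span (\<Union>{C. simple_subcoalgebra C})"

text \<open>\<open>H\<^sub>n\<^sub>+\<^sub>1\<close> is the preimage of \<open>H \<otimes> H\<^sub>n + H\<^sub>0 \<otimes> H\<close> under \<open>\<Delta>\<close>.\<close>

primrec coradical_filtration :: "nat \<Rightarrow> 'h set" where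
  "coradical_filtration 0 = coradical"
| "coradical_filtration (Suc n) =
     {h. \<exists>X\<in>tensor_sub UNIV (coradical_filtration n). \<exists>Y\<in>tensor_sub coradical UNIV.
           \<Delta> h = tensor_add X Y}"

definition connected :: bool where
  "connected \<longleftrightarrow> coradical_filtration 0 = range (\<lambda>c. scale c 1)"

definition locally_finite :: bool where
  "locally_finite \<longleftrightarrow> (\<forall>n. fin_dim (coradical_filtration n))"

definition primitives :: "'h set" where
  "primitives = {x. \<Delta> x = tensor_add (pure_tensor x 1) (pure_tensor 1 x)}"

definition \<delta> :: "'h \<Rightarrow> ('k, 'h) tensor2" where
  "\<delta> h = tensor_add (\<Delta> h) (tensor_uminus (tensor_add (pure_tensor h 1) (pure_tensor 1 h)))"

definition P2 :: "'h set" where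
  "P2 = {c. tensor_twist (\<delta> c) = tensor_uminus (\<delta> c) \<and> \<delta> c \<in> tensor_sub primitives primitives}"

definition hopf_subalgebra :: "'h set \<Rightarrow> bool" where
  "hopf_subalgebra A \<longleftrightarrow> subalgebra A \<and> \<Delta> ` A \<subseteq> tensor_sub A A \<and> S ` A \<subseteq> A"

definition U_H :: "'h set" where
  "U_H = \<Inter>{A. hopf_subalgebra A \<and> primitives \<subseteq> A}"

definition ad_left :: "'h \<Rightarrow> 'h \<Rightarrow> 'h" where
  "ad_left h a = tensor_lift (\<lambda>x y. x * a * S y) (\<Delta> h)"

definition ad_right :: "'h \<Rightarrow> 'h \<Rightarrow> 'h" where
  "ad_right h a = tensor_lift (\<lambda>x y. S x * a * y) (\<Delta> h)"

definition normal_hopf_subalgebra :: "'h set \<Rightarrow> bool" where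
  "normal_hopf_subalgebra A \<longleftrightarrow> hopf_subalgebra A \<and>
     (\<forall>h. \<forall>a\<in>A. ad_left h a \<in> A \<and> ad_right h a \<in> A)"

end

end

theory Submission
  imports Defs "HOL-Library.FuncSet" "HOL-Real_Asymp.Real_Asymp"
begin

text \<open>Write \<open>\<gg> = P(H)\<close>. For \<open>c \<in> P\<^sub>2(H)\<close> and \<open>x \<in> \<gg>\<close> the commutator \<open>[c, x]\<close> lies in \<open>P\<^sub>2(H)\<close>, and in \<open>U\<^sub>H\<close> by
  normality; as \<open>U\<^sub>H\<close> is cocommutative, \<open>[c, x] \<in> \<gg>\<close>, so that \<open>\<delta>(c)\<close> is \<open>\<gg>\<close>-invariant. Invariance yields
  \<open>[c, c'] \<in> P\<^sub>2(H) + \<gg>\<^sup>3\<close> for \<open>c, c' \<in> P\<^sub>2(H)\<close>. Give the elements of \<open>\<gg>\<close> weight 1 and those of a complement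
  of \<open>\<gg>\<close> in \<open>P\<^sub>2(H)\<close> weight 2. Commutators drop the weight, hence the ordered monomials in a basis of
  \<open>P\<^sub>2(H)\<close> span \<open>H\<close> compatibly with the weight filtration.

  They are also independent: for a functional \<open>\<phi>\<close> with \<open>\<phi>(1) = 0\<close> the map \<open>h \<mapsto> \<Sum> \<phi>(h\<^sub>1) h\<^sub>2\<close> acts on the
  associated graded algebra as a derivation of degree \<open>-1\<close>. Functionals dual to a basis of \<open>\<gg>\<close> give
  the partial derivatives by the generators of weight 1, and since \<open>\<delta>\<close> is injective on the complement with
  antisymmetric values, combinations of commutators of these derivations give the partial derivatives by
  the generators of weight 2. Counting monomials gives the growth of \<open>H\<close>.\<close>

section \<open>Growth of algebras with ordered monomials\<close>

text \<open>Weight 2 for the complement is dictated by the cubic terms: \<open>[c, c']\<close> may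
  involve weight 3, which is still below 2 + 2, while \<open>\<delta>(c)\<close> has weight 1 in
  each factor, so a contraction in one factor removes exactly one unit. No basis of \<open>H\<close>
  is known beforehand, so independence needs operators that detect the leading monomials. The
  contraction dual to a primitive generator is only an approximate partial derivative: it may send a
  generator of weight 2 to a nonzero primitive element. The operators thus form a triangular system,
  and the generators of weight 2 have to be numbered before the primitive ones. Characteristic zero
  enters three times: symmetric and antisymmetric parts are separated by 2, the cubic correction is
  a third of a product since the three factors of a totally symmetric tensor contribute equally, and
  differentiating a power produces its exponent. The tensor square of the statement is a set of
  cosets without ring structure on its type; computing with \<open>\<Delta>\<close> multiplicatively
  is made possible by an embedding in a ring.\<close>

lemma bilinear_in_subspace:
  assumes a: "a \<in> module.span s1 A" and b: "b \<in> module.span s2 B"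
    and left: "\<And>y. Vector_Spaces.linear s1 s3 (\<lambda>x. f x y)"
    and right: "\<And>x. Vector_Spaces.linear s2 s3 (f x)"
    and V: "module.subspace s3 V" and AB: "\<And>x y. x \<in> A \<Longrightarrow> y \<in> B \<Longrightarrow> f x y \<in> V"
  shows "f a b \<in> V"
proof -
  interpret l: Vector_Spaces.linear s1 s3 "\<lambda>x. f x y" for y by (rule left)
  interpret r: Vector_Spaces.linear s2 s3 "f x" for x by (rule right)
  have 1: "f x b \<in> V" if "x \<in> A" for x
  proof -
    have "r.vs1.span B \<subseteq> {y. f x y \<in> V}"
      by (rule r.vs1.span_minimal) (use AB that r.subspace_vimage[OF V] in \<open>auto simp: vimage_def\<close>)
    with b show ?thesis by auto
  qed
  have "l.vs1.span A \<subseteq> {x. f x b \<in> V}"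
    by (rule l.vs1.span_minimal) (use 1 l.subspace_vimage[OF V] in \<open>auto simp: vimage_def\<close>)
  with a show ?thesis by auto
qed

context k_algebra
begin

lemma linear_mult_left: "Vector_Spaces.linear scale scale (\<lambda>x. x * b)"
  by (simp add: Vector_Spaces.linear_iff vector_space_axioms distrib_right scale_mult_left)

lemma linear_mult_right: "Vector_Spaces.linear scale scale (\<lambda>x. b * x)"
  by (simp add: Vector_Spaces.linear_iff vector_space_axioms distrib_left scale_mult_right)

lemma span_mult:
  assumes "a \<in> span A" "b \<in> span B" "\<And>x y. x \<in> A \<Longrightarrow> y \<in> B \<Longrightarrow> x * y \<in> V" "subspace V"
  shows "a * b \<in> V"
  by (rule bilinear_in_subspace[OF assms(1,2) linear_mult_left linear_mult_right]) (use assms in auto)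

text \<open>The finite \<open>B\<close> is essential: \<open>dim\<close> is 0 on spaces of infinite
  dimension, where no such bound holds.\<close>

lemma independent_card_le_dim_fin:
  assumes "V \<subseteq> span B" "finite B" "independent A" "A \<subseteq> V"
  shows "finite A" "card A \<le> dim V"
proof -
  obtain C where C: "C \<subseteq> V" "independent C" "V \<subseteq> span C" "card C = dim V"
    using basis_exists by blast
  have fC: "finite C"
    using independent_span_bound[OF assms(2) C(2)] C(1) assms(1) by auto
  show "finite A" "card A \<le> dim V"
    using independent_span_bound[OF fC assms(3)] assms(4) C(3,4) by auto
qed

end

lemma linear_commutator:
  assumes "Vector_Spaces.linear s s f" "Vector_Spaces.linear s s g"
  shows "Vector_Spaces.linear s s (\<lambda>h. f (g h) - g (f h))"
proof -
  interpret f: Vector_Spaces.linear s s f by fact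
  interpret g: Vector_Spaces.linear s s g by fact
  show ?thesis
    by (simp add: Vector_Spaces.linear_iff f.vs1.vector_space_axioms f.add f.scale g.add g.scale algebra_simps
        f.vs1.scale_right_diff_distrib)
qed

section \<open>Filtration by weight and derivations of the associated graded algebra\<close>

locale weighted_generators = k_algebra scale
  for scale :: "'k::field \<Rightarrow> 'h::ring_1 \<Rightarrow> 'h" +
  fixes m :: nat and y :: "nat \<Rightarrow> 'h" and w :: "nat \<Rightarrow> nat"
  assumes w_pos: "v < m \<Longrightarrow> 0 < w v"
begin

definition filt :: "int \<Rightarrow> 'h set" where
  "filt n = span {prod_list (map y us) |us. set us \<subseteq> {..<m} \<and> int (sum_list (map w us)) \<le> n}"

lemma subspace_filt [simp]: "subspace (filt n)"
  by (simp add: filt_def)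

lemmas filt_closed = subspace_0[OF subspace_filt] subspace_add[OF subspace_filt]
  subspace_diff[OF subspace_filt] subspace_scale[OF subspace_filt] subspace_neg[OF subspace_filt]
  subspace_sum[OF subspace_filt]

lemma filt_word: "set us \<subseteq> {..<m} \<Longrightarrow> int (sum_list (map w us)) \<le> n \<Longrightarrow> prod_list (map y us) \<in> filt n"
  unfolding filt_def by (rule span_base) auto

lemma filt_mono: "a \<in> filt p \<Longrightarrow> p \<le> q \<Longrightarrow> a \<in> filt q"
  unfolding filt_def by (erule subsetD[OF span_mono, rotated]) force

lemma filt_neg: "n < 0 \<Longrightarrow> filt n = {0}"
proof -
  assume "n < 0"
  then have "\<not> int (sum_list (map w us)) \<le> n" for us
    using of_nat_0_le_iff[of "sum_list (map w us)", where ?'a = int] by linarith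
  then show ?thesis by (simp add: filt_def)
qed

lemma filt_one: "0 \<le> n \<Longrightarrow> 1 \<in> filt n"
  using filt_word[of "[]"] by simp

lemma filt_gen: "v < m \<Longrightarrow> y v \<in> filt (int (w v))"
  using filt_word[of "[v]"] by simp

lemma filt_mult:
  assumes "a \<in> filt p" "b \<in> filt q" shows "a * b \<in> filt (p + q)"
proof (rule span_mult[OF assms[unfolded filt_def] _ subspace_filt])
  fix x z
  assume "x \<in> {prod_list (map y us) |us. set us \<subseteq> {..<m} \<and> int (sum_list (map w us)) \<le> p}"
    and "z \<in> {prod_list (map y us) |us. set us \<subseteq> {..<m} \<and> int (sum_list (map w us)) \<le> q}"
  then obtain us vs where "x = prod_list (map y us)" "set us \<subseteq> {..<m}" "int (sum_list (map w us)) \<le> p"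
    "z = prod_list (map y vs)" "set vs \<subseteq> {..<m}" "int (sum_list (map w vs)) \<le> q" by blast
  then show "x * z \<in> filt (p + q)"
    using filt_word[of "us @ vs" "p + q"] by auto
qed

lemma filt_mult_le: "a \<in> filt p \<Longrightarrow> b \<in> filt q \<Longrightarrow> p + q \<le> n \<Longrightarrow> a * b \<in> filt n"
  by (rule filt_mono[OF filt_mult])

text \<open>The maps which induce a derivation of degree \<open>-d\<close> on the associated graded algebra.\<close>

definition graded_derivation :: "int \<Rightarrow> ('h \<Rightarrow> 'h) \<Rightarrow> bool" where
  "graded_derivation d E \<longleftrightarrow> Vector_Spaces.linear scale scale E \<and>
     (\<forall>n. \<forall>a\<in>filt n. E a \<in> filt (n - d)) \<and>
     (\<forall>p q. \<forall>a\<in>filt p. \<forall>b\<in>filt q. E (a * b) - (E a * b + a * E b) \<in> filt (p + q - d - 1))"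

text \<open>Lowering an argument and lowering an error cost the same, so all six uses of the product
  rule have errors in one level; the mixed products \<open>D a * E b\<close> and
  \<open>E a * D b\<close> cancel.\<close>

lemma graded_derivation_commutator:
  assumes D: "graded_derivation d D" and E: "graded_derivation e E"
  shows "graded_derivation (d + e) (\<lambda>h. D (E h) - E (D h))"
proof -
  interpret D: Vector_Spaces.linear scale scale D using D by (simp add: graded_derivation_def)
  interpret E: Vector_Spaces.linear scale scale E using E by (simp add: graded_derivation_def)
  have lowD: "a \<in> filt n \<Longrightarrow> D a \<in> filt (n - d)" for a n using D by (auto simp: graded_derivation_def)
  have lowE: "a \<in> filt n \<Longrightarrow> E a \<in> filt (n - e)" for a n using E by (auto simp: graded_derivation_def)
  have prodD: "a \<in> filt p \<Longrightarrow> b \<in> filt q \<Longrightarrow> D (a * b) - (D a * b + a * D b) \<in> filt (p + q - d - 1)"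
    for a b p q using D by (auto simp: graded_derivation_def)
  have prodE: "a \<in> filt p \<Longrightarrow> b \<in> filt q \<Longrightarrow> E (a * b) - (E a * b + a * E b) \<in> filt (p + q - e - 1)"
    for a b p q using E by (auto simp: graded_derivation_def)
  have low: "D (E a) - E (D a) \<in> filt (n - (d + e))" if "a \<in> filt n" for a n
    using lowD[OF lowE[OF that]] lowE[OF lowD[OF that]] by (auto intro!: filt_closed simp: algebra_simps)
  have "D (E (a * b)) - E (D (a * b)) - ((D (E a) - E (D a)) * b + a * (D (E b) - E (D b)))
      \<in> filt (p + q - (d + e) - 1)" if a: "a \<in> filt p" and b: "b \<in> filt q" for a b p q
  proof -
    let ?n = "p + q - (d + e) - 1"
    have "D (E (a * b) - (E a * b + a * E b)) \<in> filt ?n"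
      using lowD[OF prodE[OF a b]] by (simp add: algebra_simps)
    moreover have "E (D (a * b) - (D a * b + a * D b)) \<in> filt ?n"
      using lowE[OF prodD[OF a b]] by (simp add: algebra_simps)
    moreover have "D (E a * b) - (D (E a) * b + E a * D b) \<in> filt ?n"
      using prodD[OF lowE[OF a] b] by (simp add: algebra_simps)
    moreover have "D (a * E b) - (D a * E b + a * D (E b)) \<in> filt ?n"
      using prodD[OF a lowE[OF b]] by (simp add: algebra_simps)
    moreover have "E (D a * b) - (E (D a) * b + D a * E b) \<in> filt ?n"
      using prodE[OF lowD[OF a] b] by (simp add: algebra_simps)
    moreover have "E (a * D b) - (E a * D b + a * E (D b)) \<in> filt ?n"
      using prodE[OF a lowD[OF b]] by (simp add: algebra_simps)
    ultimately have "D (E (a * b) - (E a * b + a * E b)) - E (D (a * b) - (D a * b + a * D b))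
      + (D (E a * b) - (D (E a) * b + E a * D b)) + (D (a * E b) - (D a * E b + a * D (E b)))
      - (E (D a * b) - (E (D a) * b + D a * E b)) - (E (a * D b) - (E a * D b + a * E (D b))) \<in> filt ?n"
      by - (assumption | rule filt_closed(2) | rule filt_closed(3))+
    then show ?thesis
      by (simp add: D.diff E.diff D.add E.add algebra_simps)
  qed
  with low show ?thesis
    unfolding graded_derivation_def
    using linear_commutator[OF D.linear_axioms E.linear_axioms] by blast
qed

lemma graded_derivation_sum:
  assumes "\<And>i. i \<in> I \<Longrightarrow> graded_derivation d (D i)"
  shows "graded_derivation d (\<lambda>h. \<Sum>i\<in>I. scale (c i) (D i h))"
proof -
  have lin: "Vector_Spaces.linear scale scale (D i)" if "i \<in> I" for i
    using assms[OF that] by (simp add: graded_derivation_def)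
  have "Vector_Spaces.linear scale scale (\<lambda>h. \<Sum>i\<in>I. scale (c i) (D i h))"
    using lin by (auto simp: Vector_Spaces.linear_iff vector_space_axioms scale_right_distrib sum.distrib
        scale_sum_right mult.commute intro!: sum.cong)
  moreover have "(\<Sum>i\<in>I. scale (c i) (D i a)) \<in> filt (n - d)" if "a \<in> filt n" for a n
    using assms that by (auto simp: graded_derivation_def intro!: filt_closed)
  moreover have "(\<Sum>i\<in>I. scale (c i) (D i (a * b))) - ((\<Sum>i\<in>I. scale (c i) (D i a)) * b
      + a * (\<Sum>i\<in>I. scale (c i) (D i b))) \<in> filt (p + q - d - 1)"
    if "a \<in> filt p" "b \<in> filt q" for a b p q
  proof -
    have "(\<Sum>i\<in>I. scale (c i) (D i (a * b))) - ((\<Sum>i\<in>I. scale (c i) (D i a)) * b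
      + a * (\<Sum>i\<in>I. scale (c i) (D i b)))
      = (\<Sum>i\<in>I. scale (c i) (D i (a * b) - (D i a * b + a * D i b)))"
      by (simp add: sum_distrib_left sum_distrib_right scale_mult_left scale_mult_right
          scale_right_distrib scale_right_diff_distrib sum.distrib sum_subtractf)
    also have "\<dots> \<in> filt (p + q - d - 1)"
      using assms that by (auto simp: graded_derivation_def intro!: filt_closed(4,6))
    finally show ?thesis .
  qed
  ultimately show ?thesis by (simp add: graded_derivation_def)
qed

section \<open>Ordered monomials span\<close>

definition ordered_monomial :: "(nat \<Rightarrow> nat) \<Rightarrow> 'h" where
  "ordered_monomial \<alpha> = prod_list (map (\<lambda>v. y v ^ \<alpha> v) [0..<m])"

text \<open>Extensional functions, so that an exponent vector is determined by its values below
  \<open>m\<close> and boxes of exponents are finite. The empty monomial is 0 below \<open>m\<close>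
  and \<open>undefined\<close> elsewhere.\<close>

definition exponents :: "(nat \<Rightarrow> nat) set" where
  "exponents = ({..<m} \<rightarrow>\<^sub>E UNIV)"

definition weight :: "(nat \<Rightarrow> nat) \<Rightarrow> nat" where
  "weight \<alpha> = (\<Sum>v<m. \<alpha> v * w v)"

lemma filt_power: "v < m \<Longrightarrow> y v ^ k \<in> filt (int (k * w v))"
proof (induction k)
  case (Suc k)
  then have "y v * y v ^ k \<in> filt (int (w v) + int (k * w v))"
    by (intro filt_mult filt_gen)
  then show ?case by (simp add: algebra_simps)
qed (simp add: filt_one)

lemma filt_prod_powers:
  "set us \<subseteq> {..<m} \<Longrightarrow>
    prod_list (map (\<lambda>v. y v ^ \<alpha> v) us) \<in> filt (int (\<Sum>v\<leftarrow>us. \<alpha> v * w v))"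
proof (induction us)
  case (Cons u us)
  then show ?case using filt_mult[OF filt_power[of u "\<alpha> u"] Cons.IH] by simp
qed (simp add: filt_one)

lemma weight_sum_list: "weight \<alpha> = (\<Sum>v\<leftarrow>[0..<m]. \<alpha> v * w v)"
  by (simp add: weight_def interv_sum_list_conv_sum_set_nat atLeast0LessThan)

lemma filt_ordered_monomial: "ordered_monomial \<alpha> \<in> filt (int (weight \<alpha>))"
  unfolding ordered_monomial_def weight_sum_list by (rule filt_prod_powers) auto

lemma upt_split: "v < m \<Longrightarrow> [0..<m] = [0..<v] @ v # [Suc v..<m]"
  by (metis less_imp_le_nat upt_add_eq_append upt_conv_Cons zero_le le_add_diff_inverse)

lemma weight_update:
  assumes "v < m" shows "weight (\<alpha>(v := \<alpha> v + 1)) = weight \<alpha> + w v"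
  unfolding weight_def using assms by (simp add: sum.remove[of "{..<m}" v])

text \<open>The Leibniz rule \<open>[y u, y v * P] = [y u, y v] * P + y v * [y u, P]\<close> carries
  the drop of one unit from generators to words.\<close>

lemma filt_commutator:
  assumes gens: "\<And>u v. u < m \<Longrightarrow> v < m \<Longrightarrow> y u * y v - y v * y u \<in> filt (int (w u) + int (w v) - 1)"
    and u: "u < m" and a: "a \<in> filt p"
  shows "y u * a - a * y u \<in> filt (int (w u) + p - 1)"
proof -
  have word: "y u * prod_list (map y vs) - prod_list (map y vs) * y u
      \<in> filt (int (w u) + int (sum_list (map w vs)) - 1)" if "set vs \<subseteq> {..<m}" for vs
    using that
  proof (induction vs)
    case Nil
    show ?case by (simp add: filt_closed)
  next
    case (Cons v vs)
    let ?P = "prod_list (map y vs)" and ?s = "int (sum_list (map w vs))"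
    have "(y u * y v - y v * y u) * ?P \<in> filt (int (w u) + int (w v) - 1 + ?s)"
      using Cons.prems u by (intro filt_mult gens filt_word) auto
    moreover have "y v * (y u * ?P - ?P * y u) \<in> filt (int (w v) + (int (w u) + ?s - 1))"
      using Cons by (intro filt_mult filt_gen) auto
    ultimately have "(y u * y v - y v * y u) * ?P + y v * (y u * ?P - ?P * y u)
      \<in> filt (int (w u) + int (w v) + ?s - 1)"
      by (intro filt_closed; simp add: algebra_simps)
    then show ?case by (simp add: algebra_simps)
  qed
  have lin: "Vector_Spaces.linear scale scale (\<lambda>a. y u * a - a * y u)"
    by (simp add: Vector_Spaces.linear_iff vector_space_axioms algebra_simps scale_mult_left scale_mult_right
        scale_right_diff_distrib)
  interpret l: Vector_Spaces.linear scale scale "\<lambda>a. y u * a - a * y u" by (rule lin)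
  have "filt p \<subseteq> {a. y u * a - a * y u \<in> filt (int (w u) + p - 1)}"
    unfolding filt_def[of p]
  proof (rule span_minimal)
    show "subspace {a. y u * a - a * y u \<in> filt (int (w u) + p - 1)}"
      using l.subspace_vimage[OF subspace_filt] by (simp add: vimage_def)
  qed (auto intro: filt_mono[OF word])
  with a show ?thesis by auto
qed

text \<open>Sorting by induction on the weight: the tail of a word is lighter, hence already a
  combination of ordered monomials, and moving the first letter to its place costs a commutator of
  weight below \<open>n\<close>, which the induction hypothesis covers.\<close>

lemma filt_subset_span_monomials:
  assumes gens: "\<And>u v. u < m \<Longrightarrow> v < m \<Longrightarrow> y u * y v - y v * y u \<in> filt (int (w u) + int (w v) - 1)"
  shows "filt (int n) \<subseteq> span {ordered_monomial \<alpha> |\<alpha>. \<alpha> \<in> exponents \<and> weight \<alpha> \<le> n}"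
    (is "_ \<subseteq> ?G n")
proof (induction n rule: less_induct)
  case (less n)
  have ext: "v < m \<Longrightarrow> \<alpha> \<in> exponents \<Longrightarrow> \<alpha>(v := k) \<in> exponents" for v \<alpha> k
    by (auto simp: exponents_def PiE_def extensional_def)
  have below: "filt j \<subseteq> ?G n" if "j < int n" for j
  proof (cases "j < 0")
    case False
    then have "filt j \<subseteq> ?G (nat j)" using less[of "nat j"] that by simp
    also have "\<dots> \<subseteq> ?G n" by (rule span_mono) (use that in force)
    finally show ?thesis .
  qed (simp add: filt_neg span_zero)
  have "prod_list (map y us) \<in> ?G n" if us: "set us \<subseteq> {..<m}" "sum_list (map w us) \<le> n" for us
  proof (cases us)
    case Nil
    have "prod_list (map (\<lambda>v. y v ^ (if v < m then 0 else undefined)) us) = 1" if "set us \<subseteq> {..<m}" for us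
      using that by (induction us) auto
    then have "ordered_monomial (\<lambda>v. if v < m then 0 else undefined) = 1"
      unfolding ordered_monomial_def by (simp add: subset_eq)
    moreover have "weight (\<lambda>v. if v < m then 0 else undefined) = 0" by (simp add: weight_def)
    moreover have "(\<lambda>v. if v < m then 0 else undefined) \<in> exponents" by (simp add: exponents_def PiE_iff extensional_def)
    ultimately show ?thesis using Nil by (intro span_base) force
  next
    case (Cons v vs)
    then have v: "v < m" "0 < w v" using us w_pos by auto
    define k where "k = n - w v"
    have k: "k < n" "k + w v = n" using Cons us v by (auto simp: k_def)
    have "prod_list (map y vs) \<in> filt (int k)"
      using us Cons k by (intro filt_word) auto
    then have "prod_list (map y vs) \<in> ?G k" using less k by blast
    moreover have "?G k \<subseteq> {a. y v * a \<in> ?G n}"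
    proof (rule span_minimal)
      interpret l: Vector_Spaces.linear scale scale "\<lambda>a. y v * a" by (rule linear_mult_right)
      show "subspace {a. y v * a \<in> ?G n}"
        using l.subspace_vimage[OF subspace_span] by (simp add: vimage_def)
      have "y v * ordered_monomial \<alpha> \<in> ?G n" if \<alpha>: "\<alpha> \<in> exponents" "weight \<alpha> \<le> k" for \<alpha>
      proof -
        \<comment> \<open>The monomial is cut at index \<open>v\<close>:
          \<open>y v * A * B = (y v * A - A * y v) * B + A * y v * B\<close>, and the last term is
          the ordered monomial with one more \<open>y v\<close>.\<close>
        let ?f = "\<lambda>v. y v ^ \<alpha> v"
        define A where "A = prod_list (map ?f [0..<v])"
        define B where "B = prod_list (map ?f (v # [Suc v..<m]))"
        define \<beta> where "\<beta> = \<alpha>(v := \<alpha> v + 1)"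
        have M: "ordered_monomial \<alpha> = A * B"
          unfolding ordered_monomial_def upt_split[OF v(1)] A_def B_def by simp
        have M': "ordered_monomial \<beta> = A * (y v * B)"
        proof -
          have "map (\<lambda>u. y u ^ \<beta> u) [0..<v] = map ?f [0..<v]"
            "map (\<lambda>u. y u ^ \<beta> u) [Suc v..<m] = map ?f [Suc v..<m]"
            and \<beta>v: "\<beta> v = Suc (\<alpha> v)"
            by (auto simp: \<beta>_def)
          then show ?thesis
            unfolding ordered_monomial_def upt_split[OF v(1)] A_def B_def
            using \<beta>v by (simp add: mult.assoc del: map_eq_conv)
        qed
        let ?s = "\<lambda>us. int (\<Sum>v\<leftarrow>us. \<alpha> v * w v)"
        have A: "A \<in> filt (?s [0..<v])"
          unfolding A_def using v by (intro filt_prod_powers) auto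
        have B: "B \<in> filt (?s (v # [Suc v..<m]))"
          unfolding B_def using v by (intro filt_prod_powers) auto
        have wt: "?s [0..<v] + ?s (v # [Suc v..<m]) = int (weight \<alpha>)"
          unfolding weight_sum_list upt_split[OF v(1)] by simp
        have "(y v * A - A * y v) * B \<in> filt (int (w v) + ?s [0..<v] - 1 + ?s (v # [Suc v..<m]))"
          by (rule filt_mult[OF filt_commutator[OF gens v(1) A] B])
        also have "int (w v) + ?s [0..<v] - 1 + ?s (v # [Suc v..<m]) = int (w v + weight \<alpha>) - 1"
          using wt by simp
        finally have "(y v * A - A * y v) * B \<in> filt (int (w v + weight \<alpha>) - 1)" .
        then have "(y v * A - A * y v) * B \<in> ?G n"
          using below[of "int (w v + weight \<alpha>) - 1"] \<alpha>(2) k by auto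
        moreover have "ordered_monomial \<beta> \<in> ?G n"
          using \<alpha> k weight_update[OF v(1), of \<alpha>] ext[OF v(1) \<alpha>(1)]
          by (intro span_base) (auto simp: \<beta>_def)
        ultimately have "(y v * A - A * y v) * B + ordered_monomial \<beta> \<in> ?G n" by (rule span_add)
        then show ?thesis by (simp add: M M' algebra_simps)
      qed
      then show "{ordered_monomial \<alpha> |\<alpha>. \<alpha> \<in> exponents \<and> weight \<alpha> \<le> k} \<subseteq> {a. y v * a \<in> ?G n}" by auto
    qed
    ultimately show ?thesis using Cons by auto
  qed
  then show ?case unfolding filt_def[of "int n"] by (intro span_minimal) auto
qed

lemma exponents_weight_le:
  assumes "\<alpha> \<in> exponents" "weight \<alpha> \<le> n" shows "\<alpha> \<in> {..<m} \<rightarrow>\<^sub>E {..n}"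
proof -
  have "\<alpha> v \<le> n" if "v < m" for v
  proof -
    have "\<alpha> v \<le> \<alpha> v * w v" using w_pos[OF that] by simp
    also have "\<dots> \<le> weight \<alpha>" unfolding weight_def using that by (intro member_le_sum) auto
    finally show ?thesis using assms by simp
  qed
  with assms show ?thesis by (auto simp: exponents_def PiE_def Pi_def)
qed

text \<open>The box of all exponents up to \<open>n\<close> overcounts, but only the order of growth
  matters.\<close>

lemma filt_finite_dim:
  assumes gens: "\<And>u v. u < m \<Longrightarrow> v < m \<Longrightarrow> y u * y v - y v * y u \<in> filt (int (w u) + int (w v) - 1)"
  obtains B where "finite B" "card B \<le> (n + 1) ^ m" "filt (int n) \<subseteq> span B"
proof
  let ?B = "ordered_monomial ` ({..<m} \<rightarrow>\<^sub>E {..n})"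
  show "finite ?B" by (intro finite_imageI finite_PiE) auto
  have "card ?B \<le> card ({..<m} \<rightarrow>\<^sub>E {..n})" by (intro card_image_le finite_PiE) auto
  then show "card ?B \<le> (n + 1) ^ m" by (simp add: card_PiE)
  have "{ordered_monomial \<alpha> |\<alpha>. \<alpha> \<in> exponents \<and> weight \<alpha> \<le> n} \<subseteq> ?B"
    using exponents_weight_le by blast
  then show "filt (int n) \<subseteq> span ?B"
    using filt_subset_span_monomials[OF gens, of n] span_mono by blast
qed

end

section \<open>Independence of the ordered monomials\<close>

locale triangular_generators = weighted_generators scale m y w
  for scale :: "'k::field_char_0 \<Rightarrow> 'h::ring_1 \<Rightarrow> 'h" and m y w +
  fixes E :: "nat \<Rightarrow> 'h \<Rightarrow> 'h"
  assumes commutator: "u < m \<Longrightarrow> v < m \<Longrightarrow> y u * y v - y v * y u \<in> filt (int (w u) + int (w v) - 1)"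
    and generate: "generated_subalgebra (y ` {..<m}) = UNIV"
    and derivation: "v < m \<Longrightarrow> graded_derivation (int (w v)) (E v)"
    and E_diagonal: "v < m \<Longrightarrow> E v (y v) = 1"
    and E_above: "v < u \<Longrightarrow> u < m \<Longrightarrow> E v (y u) = 0"
begin

lemma linear_E: "v < m \<Longrightarrow> Vector_Spaces.linear scale scale (E v)"
  using derivation by (simp add: graded_derivation_def)

lemma E_filt: "v < m \<Longrightarrow> a \<in> filt p \<Longrightarrow> E v a \<in> filt (p - int (w v))"
  using derivation by (auto simp: graded_derivation_def)

lemma E_mult:
  "v < m \<Longrightarrow> a \<in> filt p \<Longrightarrow> b \<in> filt q \<Longrightarrow>
    E v (a * b) - (E v a * b + a * E v b) \<in> filt (p + q - int (w v) - 1)"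
  using derivation by (auto simp: graded_derivation_def)

text \<open>Forced by the degree: the value lies in a negative level of the filtration.\<close>

lemma E_one: "v < m \<Longrightarrow> E v 1 = 0"
  using E_filt[OF _ filt_one[of 0], of v] w_pos[of v] filt_neg[of "- int (w v)"] by simp

text \<open>Elements on which \<open>E v\<close> loses more than its degree are closed under
  products; the generators after \<open>v\<close> are of this kind.\<close>

lemma E_mult_low:
  assumes "v < m" "a \<in> filt p" "b \<in> filt q"
    and "E v a \<in> filt (p - int (w v) - 1)" "E v b \<in> filt (q - int (w v) - 1)"
  shows "E v (a * b) \<in> filt (p + q - int (w v) - 1)"
proof -
  have "E v a * b \<in> filt (p + q - int (w v) - 1)" "a * E v b \<in> filt (p + q - int (w v) - 1)"
    using filt_mult_le[OF assms(4,3), of "p + q - int (w v) - 1"] filt_mult_le[OF assms(2,5), of "p + q - int (w v) - 1"] by auto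
  from filt_closed(2)[OF E_mult[OF assms(1-3)] filt_closed(2)[OF this]] show ?thesis by simp
qed

lemma E_power_above: "v < u \<Longrightarrow> u < m \<Longrightarrow> E v (y u ^ k) \<in> filt (int (k * w u) - int (w v) - 1)"
proof (induction k)
  case 0
  then show ?case by (simp add: E_one filt_closed)
next
  case (Suc k)
  then have "E v (y u * y u ^ k) \<in> filt (int (w u) + int (k * w u) - int (w v) - 1)"
    by (intro E_mult_low filt_gen filt_power) (auto simp: E_above filt_closed)
  then show ?case by (simp add: algebra_simps)
qed

lemma E_prod_above:
  "v < m \<Longrightarrow> set us \<subseteq> {v<..<m} \<Longrightarrow>
    E v (prod_list (map (\<lambda>u. y u ^ \<alpha> u) us)) \<in> filt (int (\<Sum>u\<leftarrow>us. \<alpha> u * w u) - int (w v) - 1)"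
proof (induction us)
  case Nil
  then show ?case by (simp add: E_one filt_closed)
next
  case (Cons u us)
  then have "E v (y u ^ \<alpha> u * prod_list (map (\<lambda>u. y u ^ \<alpha> u) us))
    \<in> filt (int (\<alpha> u * w u) + int (\<Sum>u\<leftarrow>us. \<alpha> u * w u) - int (w v) - 1)"
    by (intro E_mult_low filt_power filt_prod_powers E_power_above) auto
  then show ?case by simp
qed

text \<open>Modulo lower weight this is the derivative of a power times a factor that
  \<open>E v\<close> treats as a constant. At \<open>k = 0\<close> the truncated exponent is
  harmless because of the factor \<open>of_nat 0\<close>.\<close>

lemma E_power_mult:
  assumes v: "v < m" and b: "b \<in> filt q" "E v b \<in> filt (q - int (w v) - 1)"
  shows "E v (y v ^ k * b) - scale (of_nat k) (y v ^ (k - 1) * b)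
    \<in> filt (int (k * w v) + q - int (w v) - 1)"
proof (induction k)
  case 0
  show ?case using b by simp
next
  case (Suc k)
  let ?Z = "y v ^ k * b" and ?n = "int (Suc k * w v) + q - int (w v) - 1"
  have Z: "?Z \<in> filt (int (k * w v) + q)" by (intro filt_mult filt_power v b)
  have "E v (y v * ?Z) - (?Z + y v * E v ?Z) \<in> filt ?n"
    using E_mult[OF v filt_gen[OF v] Z] by (simp add: E_diagonal v algebra_simps)
  moreover have "y v * (E v ?Z - scale (of_nat k) (y v ^ (k - 1) * b)) \<in> filt ?n"
    using filt_mult[OF filt_gen[OF v] Suc] by (simp add: algebra_simps)
  ultimately have "E v (y v * ?Z) - (?Z + y v * E v ?Z) + y v * (E v ?Z - scale (of_nat k) (y v ^ (k - 1) * b))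
    \<in> filt ?n" by (rule filt_closed)
  moreover have "y v * scale (of_nat k) (y v ^ (k - 1) * b) = scale (of_nat k) ?Z"
    by (cases k) (simp_all add: scale_mult_right mult.assoc)
  ultimately have "E v (y v * ?Z) - (?Z + scale (of_nat k) ?Z) \<in> filt ?n"
    by (simp add: algebra_simps)
  then show ?case by (simp add: scale_left_distrib mult.assoc)
qed

text \<open>Without generators before \<open>v\<close> the monomial is a power of \<open>y v\<close>
  times a tail in later generators, which \<open>E v\<close> ignores up to lower weight. The
  assumption \<open>zero\<close> is there because \<open>E v\<close> is not controlled on earlier
  generators.\<close>

lemma E_monomial:
  assumes v: "v < m" and zero: "\<And>u. u < v \<Longrightarrow> \<alpha> u = 0"
  shows "E v (ordered_monomial \<alpha>) - scale (of_nat (\<alpha> v)) (ordered_monomial (\<alpha>(v := \<alpha> v - 1)))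
    \<in> filt (int (weight \<alpha>) - int (w v) - 1)"
proof -
  let ?B = "prod_list (map (\<lambda>u. y u ^ \<alpha> u) [Suc v..<m])"
  have M: "ordered_monomial \<beta> = y v ^ \<beta> v * ?B"
    if "\<And>u. u < v \<Longrightarrow> \<beta> u = 0" "\<And>u. v < u \<Longrightarrow> \<beta> u = \<alpha> u" for \<beta>
  proof -
    have 1: "prod_list (map (\<lambda>u. y u ^ \<beta> u) us) = 1" if "set us \<subseteq> {..<v}" for us
      using that \<open>\<And>u. u < v \<Longrightarrow> \<beta> u = 0\<close> by (induction us) auto
    have "map (\<lambda>u. y u ^ \<beta> u) [Suc v..<m] = map (\<lambda>u. y u ^ \<alpha> u) [Suc v..<m]"
      using that by auto
    then show ?thesis
      unfolding ordered_monomial_def upt_split[OF v] using 1[of "[0..<v]"]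
      by (simp add: subset_eq del: map_eq_conv)
  qed
  have B: "?B \<in> filt (int (\<Sum>u\<leftarrow>[Suc v..<m]. \<alpha> u * w u))"
    "E v ?B \<in> filt (int (\<Sum>u\<leftarrow>[Suc v..<m]. \<alpha> u * w u) - int (w v) - 1)"
    using v by (intro filt_prod_powers E_prod_above; auto)+
  have "(\<Sum>u\<leftarrow>us. \<alpha> u * w u) = 0" if "set us \<subseteq> {..<v}" for us
    using that zero by (induction us) auto
  from this[of "[0..<v]"]
  have "int (\<alpha> v * w v) + int (\<Sum>u\<leftarrow>[Suc v..<m]. \<alpha> u * w u) = int (weight \<alpha>)"
    unfolding weight_sum_list upt_split[OF v] by (simp add: subset_eq)
  then show ?thesis
    using E_power_mult[OF v B, of "\<alpha> v"] zero by (subst (1 2) M) auto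
qed

text \<open>The operator belonging to the least index that occurs removes one generator of that index
  from each leading monomial containing it.\<close>

lemma homogeneous_monomials_independent:
  assumes "finite A" "A \<subseteq> exponents" "\<And>\<alpha>. \<alpha> \<in> A \<Longrightarrow> weight \<alpha> = n"
    and "(\<Sum>\<alpha>\<in>A. scale (c \<alpha>) (ordered_monomial \<alpha>)) \<in> filt (int n - 1)"
  shows "\<forall>\<alpha>\<in>A. c \<alpha> = 0"
  using assms
proof (induction n arbitrary: A c rule: less_induct)
  case (less n A c)
  define A' where "A' = {\<alpha>\<in>A. c \<alpha> \<noteq> 0}"
  have A': "finite A'" "A' \<subseteq> exponents" "\<And>\<alpha>. \<alpha> \<in> A' \<Longrightarrow> weight \<alpha> = n" "\<And>\<alpha>. \<alpha> \<in> A' \<Longrightarrow> c \<alpha> \<noteq> 0"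
    using less.prems by (auto simp: A'_def)
  have sum: "(\<Sum>\<alpha>\<in>A'. scale (c \<alpha>) (ordered_monomial \<alpha>)) \<in> filt (int n - 1)"
  proof -
    have "(\<Sum>\<alpha>\<in>A'. scale (c \<alpha>) (ordered_monomial \<alpha>)) = (\<Sum>\<alpha>\<in>A. scale (c \<alpha>) (ordered_monomial \<alpha>))"
      using less.prems(1) by (intro sum.mono_neutral_left) (auto simp: A'_def)
    with less.prems(4) show ?thesis by simp
  qed
  have "A' = {}"
  proof (rule ccontr)
    assume "A' \<noteq> {}"
    show False
    proof (cases "\<exists>v<m. \<exists>\<alpha>\<in>A'. 0 < \<alpha> v")
      \<comment> \<open>Only the empty monomial can remain. Its weight is 0, and a multiple of 1
        lying in level -1 is 0.\<close>
      case False
      have only: "\<alpha> = (\<lambda>v. if v < m then 0 else undefined)" if "\<alpha> \<in> A'" for \<alpha>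
      proof
        fix v
        show "\<alpha> v = (if v < m then 0 else undefined)"
          using False that A'(2) by (auto simp: exponents_def PiE_def extensional_def)
      qed
      with \<open>A' \<noteq> {}\<close> obtain \<alpha> where \<alpha>: "A' = {\<alpha>}" by blast
      with only have zero: "\<alpha> v = 0" if "v < m" for v using that by auto
      have "prod_list (map (\<lambda>v. y v ^ \<alpha> v) us) = 1" if "set us \<subseteq> {..<m}" for us
        using that zero by (induction us) auto
      then have "ordered_monomial \<alpha> = 1" unfolding ordered_monomial_def by (simp add: subset_eq)
      moreover have "n = 0" using A'(3)[of \<alpha>] \<alpha> zero by (simp add: weight_def)
      ultimately have "scale (c \<alpha>) 1 = 0"
        using sum \<alpha> filt_neg[of "-1"] by simp
      then show False using A'(4)[of \<alpha>] \<alpha> by simp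
    next
      case True
      define v where "v = (LEAST v. v < m \<and> (\<exists>\<alpha>\<in>A'. 0 < \<alpha> v))"
      have "v < m \<and> (\<exists>\<alpha>\<in>A'. 0 < \<alpha> v)"
        unfolding v_def by (rule LeastI_ex) (use True in auto)
      then have v: "v < m" "\<exists>\<alpha>\<in>A'. 0 < \<alpha> v" by auto
      have zero: "\<alpha> u = 0" if "\<alpha> \<in> A'" "u < v" for \<alpha> u
        using not_less_Least[of u "\<lambda>v. v < m \<and> (\<exists>\<alpha>\<in>A'. 0 < \<alpha> v)"] that v(1)
        unfolding v_def[symmetric] by auto
      interpret E: Vector_Spaces.linear scale scale "E v" by (rule linear_E[OF v(1)])
      let ?d = "\<lambda>\<alpha>::nat \<Rightarrow> nat. \<alpha>(v := \<alpha> v - 1)"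
      let ?u = "\<lambda>\<beta>::nat \<Rightarrow> nat. \<beta>(v := \<beta> v + 1)"
      define A'' where "A'' = {\<alpha>\<in>A'. 0 < \<alpha> v}"
      define C where "C = ?d ` A''"
      \<comment> \<open>Monomials without \<open>y v\<close> disappear through their exponent 0; on
        the others, removing one \<open>y v\<close> is injective, so no two terms merge.\<close>
      have ud: "?u (?d \<alpha>) = \<alpha>" if "\<alpha> \<in> A''" for \<alpha> using that by (auto simp: A''_def)
      then have inj: "inj_on ?d A''" by (intro inj_on_inverseI[where g = ?u])
      obtain \<alpha>0 where \<alpha>0: "\<alpha>0 \<in> A''" using v(2) by (auto simp: A''_def)
      have wt: "weight (?d \<alpha>) + w v = n" if "\<alpha> \<in> A''" for \<alpha>
        using weight_update[OF v(1), of "?d \<alpha>"] ud[OF that] that A'(3)[of \<alpha>] by (simp add: A''_def)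
      have k: "n - w v < n" "int (n - w v) = int n - int (w v)"
        using wt[OF \<alpha>0] w_pos[OF v(1)] by auto
      define c' where "c' \<beta> = c (?u \<beta>) * of_nat (?u \<beta> v)" for \<beta>
      have "(\<Sum>\<alpha>\<in>A'. scale (c \<alpha>) (E v (ordered_monomial \<alpha>))) \<in> filt (int n - int (w v) - 1)"
        using E_filt[OF v(1) sum] by (simp add: E.sum E.scale algebra_simps)
      moreover have "(\<Sum>\<alpha>\<in>A'. scale (c \<alpha>) (E v (ordered_monomial \<alpha>) - scale (of_nat (\<alpha> v)) (ordered_monomial (?d \<alpha>))))
          \<in> filt (int n - int (w v) - 1)"
      proof (intro filt_closed(4,6))
        fix \<alpha> assume "\<alpha> \<in> A'"
        then show "E v (ordered_monomial \<alpha>) - scale (of_nat (\<alpha> v)) (ordered_monomial (?d \<alpha>))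
          \<in> filt (int n - int (w v) - 1)"
          using E_monomial[OF v(1), of \<alpha>] zero[of \<alpha>] A'(3)[of \<alpha>] by simp
      qed
      ultimately have "(\<Sum>\<alpha>\<in>A'. scale (c \<alpha>) (E v (ordered_monomial \<alpha>)))
          - (\<Sum>\<alpha>\<in>A'. scale (c \<alpha>) (E v (ordered_monomial \<alpha>) - scale (of_nat (\<alpha> v)) (ordered_monomial (?d \<alpha>))))
          \<in> filt (int n - int (w v) - 1)" by (rule filt_closed)
      also have "(\<Sum>\<alpha>\<in>A'. scale (c \<alpha>) (E v (ordered_monomial \<alpha>)))
          - (\<Sum>\<alpha>\<in>A'. scale (c \<alpha>) (E v (ordered_monomial \<alpha>) - scale (of_nat (\<alpha> v)) (ordered_monomial (?d \<alpha>))))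
          = (\<Sum>\<alpha>\<in>A'. scale (c \<alpha> * of_nat (\<alpha> v)) (ordered_monomial (?d \<alpha>)))"
        by (simp add: scale_right_diff_distrib sum_subtractf)
      also have "\<dots> = (\<Sum>\<alpha>\<in>A''. scale (c \<alpha> * of_nat (\<alpha> v)) (ordered_monomial (?d \<alpha>)))"
        using A'(1) by (intro sum.mono_neutral_right) (auto simp: A''_def)
      also have "\<dots> = (\<Sum>\<beta>\<in>C. scale (c' \<beta>) (ordered_monomial \<beta>))"
        unfolding C_def sum.reindex[OF inj] using ud by (intro sum.cong) (auto simp: c'_def A''_def)
      finally have "(\<Sum>\<beta>\<in>C. scale (c' \<beta>) (ordered_monomial \<beta>)) \<in> filt (int (n - w v) - 1)"
        unfolding k(2) .
      moreover have "finite C" using A'(1) by (simp add: C_def A''_def)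
      moreover have "C \<subseteq> exponents"
        using A'(2) v(1) by (auto simp: C_def A''_def exponents_def PiE_def extensional_def)
      moreover have "weight \<beta> = n - w v" if "\<beta> \<in> C" for \<beta>
      proof -
        from that obtain \<alpha> where "\<alpha> \<in> A''" "\<beta> = ?d \<alpha>" unfolding C_def by blast
        with wt[of \<alpha>] show ?thesis by simp
      qed
      ultimately have "\<forall>\<beta>\<in>C. c' \<beta> = 0" using less.IH[OF k(1)] by blast
      then have "c' (?d \<alpha>0) = 0" using \<alpha>0 by (auto simp: C_def)
      then have "c \<alpha>0 * of_nat (\<alpha>0 v) = 0" unfolding c'_def ud[OF \<alpha>0] .
      \<comment> \<open>Characteristic zero: the positive exponent is nonzero in the field.\<close>
      then show False using A'(4)[of \<alpha>0] \<alpha>0 by (auto simp: A''_def)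
    qed
  qed
  then show ?case by (auto simp: A'_def)
qed

text \<open>Among the nonzero terms those of greatest weight equal minus the rest, which lies one
  level lower; this is the hypothesis of the homogeneous case.\<close>

lemma monomials_independent:
  assumes "finite A" "A \<subseteq> exponents"
    and "(\<Sum>\<alpha>\<in>A. scale (c \<alpha>) (ordered_monomial \<alpha>)) = 0" and "\<alpha> \<in> A"
  shows "c \<alpha> = 0"
proof (rule ccontr)
  assume "c \<alpha> \<noteq> 0"
  define A' where "A' = {\<alpha>\<in>A. c \<alpha> \<noteq> 0}"
  define n where "n = Max (weight ` A')"
  have A': "finite A'" "A' \<noteq> {}" using assms \<open>c \<alpha> \<noteq> 0\<close> by (auto simp: A'_def)
  then have "n \<in> weight ` A'" unfolding n_def by (intro Max_in) auto
  then obtain \<beta> where \<beta>: "\<beta> \<in> A" "c \<beta> \<noteq> 0" "weight \<beta> = n" by (auto simp: A'_def)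
  have le: "weight \<gamma> \<le> n" if "\<gamma> \<in> A" "c \<gamma> \<noteq> 0" for \<gamma>
    using A' that by (auto simp: n_def A'_def)
  define T where "T = {\<alpha>\<in>A. weight \<alpha> = n}"
  let ?t = "\<lambda>\<alpha>. scale (c \<alpha>) (ordered_monomial \<alpha>)"
  have "(\<Sum>\<alpha>\<in>A. ?t \<alpha>) = (\<Sum>\<alpha>\<in>T. ?t \<alpha>) + (\<Sum>\<alpha>\<in>A - T. ?t \<alpha>)"
    using assms(1) by (subst sum.subset_diff[of T]) (auto simp: T_def)
  moreover have "(\<Sum>\<alpha>\<in>A - T. ?t \<alpha>) \<in> filt (int n - 1)"
  proof (rule filt_closed(6))
    fix \<gamma> assume "\<gamma> \<in> A - T"
    then show "?t \<gamma> \<in> filt (int n - 1)"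
      using le[of \<gamma>] by (cases "c \<gamma> = 0")
        (auto simp: T_def filt_closed intro!: filt_closed(4) filt_mono[OF filt_ordered_monomial])
  qed
  ultimately have "(\<Sum>\<alpha>\<in>T. ?t \<alpha>) \<in> filt (int n - 1)"
    using filt_closed(5)[of "\<Sum>\<alpha>\<in>A - T. ?t \<alpha>" "int n - 1"] assms(3) by (simp add: add_eq_0_iff2)
  then have "\<forall>\<alpha>\<in>T. c \<alpha> = 0"
    using assms by (intro homogeneous_monomials_independent[where n = n]) (auto simp: T_def)
  with \<beta> show False by (auto simp: T_def)
qed

lemma independent_monomials:
  assumes "finite A" "A \<subseteq> exponents"
  shows "inj_on ordered_monomial A" "independent (ordered_monomial ` A)"
proof -
  show inj: "inj_on ordered_monomial A"
  proof (rule inj_onI, rule ccontr)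
    fix \<alpha> \<beta> assume "\<alpha> \<in> A" "\<beta> \<in> A" "ordered_monomial \<alpha> = ordered_monomial \<beta>" "\<alpha> \<noteq> \<beta>"
    \<comment> \<open>Equal monomials with different exponents satisfy the relation with
      coefficients 1 and -1.\<close>
    then have "(if \<alpha> = \<alpha> then 1 else - 1 :: 'k) = 0"
      using monomials_independent[of "{\<alpha>, \<beta>}" "\<lambda>\<gamma>. if \<gamma> = \<alpha> then 1 else - 1" \<alpha>] assms by auto
    then show False by simp
  qed
  show "independent (ordered_monomial ` A)"
  proof (rule independent_if_scalars_zero)
    fix f a
    assume "(\<Sum>x\<in>ordered_monomial ` A. scale (f x) x) = 0" "a \<in> ordered_monomial ` A"
    then show "f a = 0"
      using monomials_independent[OF assms, of "f \<circ> ordered_monomial"] by (auto simp: sum.reindex[OF inj])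
  qed (use assms in simp)
qed

section \<open>Growth of the powers of a finite-dimensional space\<close>

lemma pow_sum_word: "set xs \<subseteq> V \<Longrightarrow> length xs \<le> n \<Longrightarrow> prod_list xs \<in> pow_sum V n"
  unfolding pow_sum_def by (rule span_base) blast

lemma pow_sum_mult:
  assumes "a \<in> pow_sum V i" "b \<in> pow_sum V j" shows "a * b \<in> pow_sum V (i + j)"
proof (rule span_mult[OF assms[unfolded pow_sum_def]])
  fix x z
  assume "x \<in> {prod_list xs |xs. set xs \<subseteq> V \<and> length xs \<le> i}"
    and "z \<in> {prod_list xs |xs. set xs \<subseteq> V \<and> length xs \<le> j}"
  then obtain xs zs where "x = prod_list xs" "set xs \<subseteq> V" "length xs \<le> i"
    "z = prod_list zs" "set zs \<subseteq> V" "length zs \<le> j" by blast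
  then show "x * z \<in> pow_sum V (i + j)"
    using pow_sum_word[of "xs @ zs" V "i + j"] by auto
qed (simp add: pow_sum_def)

lemma pow_sum_mono: "a \<in> pow_sum V i \<Longrightarrow> i \<le> j \<Longrightarrow> a \<in> pow_sum V j"
  unfolding pow_sum_def by (erule subsetD[OF span_mono, rotated]) force

lemma monomial_pow_sum:
  assumes "y ` {..<m} \<subseteq> V"
  shows "ordered_monomial \<alpha> \<in> pow_sum V (\<Sum>v<m. \<alpha> v)"
proof -
  have one: "1 \<in> pow_sum V 0" using pow_sum_word[of "[]"] by simp
  have gen: "y v \<in> pow_sum V 1" if "v < m" for v
    using pow_sum_word[of "[y v]" V 1] that assms by auto
  have pow: "y v ^ k \<in> pow_sum V k" if "v < m" for v k
  proof (induction k)
    case (Suc k)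
    show ?case using pow_sum_mult[OF gen[OF that] Suc] by simp
  qed (use one in simp)
  have "prod_list (map (\<lambda>v. y v ^ \<alpha> v) us) \<in> pow_sum V (sum_list (map \<alpha> us))" if "set us \<subseteq> {..<m}" for us
    using that
  proof (induction us)
    case (Cons u us)
    then show ?case using pow_sum_mult[OF pow[of u "\<alpha> u"] Cons.IH] by simp
  qed (use one in simp)
  from this[of "[0..<m]"] show ?thesis
    by (simp add: ordered_monomial_def interv_sum_list_conv_sum_set_nat atLeast0LessThan subset_eq)
qed

lemma pow_sum_filt:
  assumes "V \<subseteq> filt (int N)" shows "pow_sum V n \<subseteq> filt (int (N * n))"
proof -
  have word: "prod_list xs \<in> filt (int (N * length xs))" if "set xs \<subseteq> V" for xs
    using that
  proof (induction xs)
    case (Cons x xs)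
    then have "x * prod_list xs \<in> filt (int N + int (N * length xs))"
      using assms by (intro filt_mult) auto
    then show ?case by (simp add: algebra_simps)
  qed (simp add: filt_one)
  then show ?thesis
    unfolding pow_sum_def
  proof (intro span_minimal subsetI)
    fix a assume "a \<in> {prod_list xs |xs. set xs \<subseteq> V \<and> length xs \<le> n}"
    then obtain xs where "a = prod_list xs" "set xs \<subseteq> V" "length xs \<le> n" by blast
    moreover from this have "N * length xs \<le> N * n" by simp
    ultimately show "a \<in> filt (int (N * n))"
      using filt_mono[OF word[of xs], of "int (N * n)"] by (simp del: of_nat_mult)
  qed simp
qed

lemma in_some_filt: "\<exists>n. a \<in> filt (int n)"
proof -
  have "subalgebra {a. \<exists>n. a \<in> filt (int n)}"
    unfolding subalgebra_def
  proof (intro conjI ballI subspaceI)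
    have "1 \<in> filt (int 0)" by (rule filt_one) simp
    then show "0 \<in> {a. \<exists>n. a \<in> filt (int n)}" "1 \<in> {a. \<exists>n. a \<in> filt (int n)}"
      using filt_closed(1) by blast+
    fix a b assume "a \<in> {a. \<exists>n. a \<in> filt (int n)}" "b \<in> {a. \<exists>n. a \<in> filt (int n)}"
    then obtain i j where ij: "a \<in> filt (int i)" "b \<in> filt (int j)" by blast
    have "a \<in> filt (int (i + j))" "b \<in> filt (int (i + j))"
      using ij by (auto intro: filt_mono)
    then have "a + b \<in> filt (int (i + j))" by (rule filt_closed)
    then show "a + b \<in> {a. \<exists>n. a \<in> filt (int n)}" by blast
    have "a * b \<in> filt (int (i + j))" using filt_mult[OF ij] by simp
    then show "a * b \<in> {a. \<exists>n. a \<in> filt (int n)}" by blast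
  next
    fix c a assume "a \<in> {a. \<exists>n. a \<in> filt (int n)}"
    then show "scale c a \<in> {a. \<exists>n. a \<in> filt (int n)}" using filt_closed(4) by blast
  qed
  moreover have "y ` {..<m} \<subseteq> {a. \<exists>n. a \<in> filt (int n)}" using filt_gen by blast
  ultimately have "generated_subalgebra (y ` {..<m}) \<subseteq> {a. \<exists>n. a \<in> filt (int n)}"
    unfolding generated_subalgebra_def by blast
  then show ?thesis using generate by blast
qed

lemma fin_dim_filt:
  assumes "fin_dim V" shows "\<exists>N. V \<subseteq> filt (int N)"
proof -
  from assms obtain B where B: "finite B" "span B = V" by (auto simp: fin_dim_def)
  have "\<exists>N. B \<subseteq> filt (int N)"
    using B(1)
  proof induction
    case (insert b B)
    then obtain N M where "B \<subseteq> filt (int N)" "b \<in> filt (int M)" using in_some_filt by blast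
    then have "insert b B \<subseteq> filt (int (max N M))" by (auto intro: filt_mono)
    then show ?case by blast
  qed simp
  then obtain N where "B \<subseteq> filt (int N)" by blast
  then have "span B \<subseteq> filt (int N)" by (rule span_minimal) simp
  with B have "V \<subseteq> filt (int N)" by simp
  then show ?thesis by blast
qed

lemma dim_pow_sum_upper:
  assumes "V \<subseteq> filt (int N)" shows "dim (pow_sum V n) \<le> (N * n + 1) ^ m"
proof -
  obtain B where "finite B" "card B \<le> (N * n + 1) ^ m" "filt (int (N * n)) \<subseteq> span B"
    using filt_finite_dim[OF commutator, of "N * n"] by blast
  then show ?thesis
    using dim_le_card[OF order_trans[OF pow_sum_filt[OF assms]], of n B] le_trans by blast
qed

text \<open>Exponents up to \<open>n div m\<close> keep the number of factors within
  \<open>n\<close>. For \<open>m = 0\<close> the quotient is 0 and the bound is 1.\<close>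

lemma dim_pow_sum_lower:
  assumes "V \<subseteq> filt (int N)" "y ` {..<m} \<subseteq> V"
  shows "(n div m + 1) ^ m \<le> dim (pow_sum V n)"
proof -
  let ?A = "{..<m} \<rightarrow>\<^sub>E {..n div m}"
  obtain B where B: "finite B" "filt (int (N * n)) \<subseteq> span B"
    using filt_finite_dim[OF commutator, of "N * n"] by blast
  have A: "finite ?A" "?A \<subseteq> exponents"
    unfolding exponents_def by (intro finite_PiE; simp) (rule PiE_mono, simp)
  have "ordered_monomial \<alpha> \<in> pow_sum V n" if "\<alpha> \<in> ?A" for \<alpha>
  proof (rule pow_sum_mono[OF monomial_pow_sum[OF assms(2)]])
    have "(\<Sum>v<m. \<alpha> v) \<le> (\<Sum>v<m. n div m)" by (rule sum_mono) (use that in auto)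
    also have "\<dots> = m * (n div m)" by simp
    also have "\<dots> \<le> n" by simp
    finally show "(\<Sum>v<m. \<alpha> v) \<le> n" .
  qed
  then have "card (ordered_monomial ` ?A) \<le> dim (pow_sum V n)"
    by (intro independent_card_le_dim_fin(2)[OF order_trans[OF pow_sum_filt[OF assms(1)] B(2)] B(1) independent_monomials(2)[OF A]])
      blast
  then show ?thesis
    by (simp add: card_image[OF independent_monomials(1)[OF A]] card_PiE)
qed

text \<open>The dimensions lie between \<open>(n div m + 1) ^ m\<close> and
  \<open>(N * n + 1) ^ m\<close>, and constant factors vanish under the logarithm to base
  \<open>n\<close>.\<close>

theorem GK_dim_eq: "GK_dim = ereal (real m)"
proof (rule antisym)
  show "GK_dim \<le> ereal (real m)"
    unfolding GK_dim_def
  proof (rule SUP_least)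
    fix V assume "V \<in> {V. fin_dim V}"
    then obtain N where N: "V \<subseteq> filt (int N)" using fin_dim_filt by blast
    \<comment> \<open>The logarithm to base \<open>n\<close> of
      \<open>((N + 1) * n) ^ m\<close>.\<close>
    let ?f = "\<lambda>n. real m * (1 + ln (real N + 1) / ln (real n))"
    have "log (real n) (real (dim (pow_sum V n))) \<le> ?f n" if n: "2 \<le> n" for n
    proof (cases "dim (pow_sum V n) = 0")
      case False
      have "real (dim (pow_sum V n)) \<le> real ((N * n + 1) ^ m)"
        using dim_pow_sum_upper[OF N, of n] of_nat_le_iff by blast
      also have "\<dots> = (real N * real n + 1) ^ m" by (simp add: add.commute)
      also have "\<dots> \<le> ((real N + 1) * real n) ^ m"
        using n by (intro power_mono) (auto simp: algebra_simps)
      finally have "ln (real (dim (pow_sum V n))) \<le> ln (((real N + 1) * real n) ^ m)"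
        using False by simp
      also have "\<dots> = real m * (ln (real N + 1) + ln (real n))"
        using n by (simp add: ln_realpow ln_mult)
      finally show ?thesis
        using n by (simp add: log_def field_simps)
    qed (use n in \<open>simp add: log_def\<close>)
    then have "\<forall>\<^sub>F n in sequentially. ereal (log (real n) (real (dim (pow_sum V n)))) \<le> ereal (?f n)"
      by (intro eventually_sequentiallyI[of 2]) auto
    then have "limsup (\<lambda>n. ereal (log (real n) (real (dim (pow_sum V n))))) \<le> limsup (\<lambda>n. ereal (?f n))"
      by (rule Limsup_mono)
    also have "?f \<longlonglongrightarrow> real m" by real_asymp
    then have "limsup (\<lambda>n. ereal (?f n)) = ereal (real m)"
      by (intro lim_imp_Limsup) auto
    finally show "limsup (\<lambda>n. ereal (log (real n) (real (dim (pow_sum V n))))) \<le> ereal (real m)" .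
  qed
  let ?V = "span (y ` {..<m})"
  have V: "fin_dim ?V" "y ` {..<m} \<subseteq> ?V" by (auto simp: fin_dim_def span_base)
  obtain N where N: "?V \<subseteq> filt (int N)" using fin_dim_filt V by blast
  \<comment> \<open>The logarithm to base \<open>n\<close> of \<open>(n / m) ^ m\<close>, which
    bounds the box from below since \<open>n \<le> (n div m + 1) * m\<close>.\<close>
  let ?g = "\<lambda>n. real m * (1 - ln (real m) / ln (real n))"
  have "?g n \<le> log (real n) (real (dim (pow_sum ?V n)))" if n: "2 \<le> n" for n
  proof (cases "m = 0")
    case True
    have "1 \<le> dim (pow_sum ?V n)" using dim_pow_sum_lower[OF N V(2), of n] True by simp
    then show ?thesis using n True by (simp add: log_def)
  next
    case False
    have "n \<le> (n div m + 1) * m"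
      using False dividend_less_times_div[of m n] by (simp add: algebra_simps)
    then have "real n \<le> real (n div m + 1) * real m"
      by (metis of_nat_le_iff of_nat_mult)
    then have "real n / real m \<le> real (n div m + 1)"
      using False by (simp add: divide_le_eq)
    then have "(real n / real m) ^ m \<le> real ((n div m + 1) ^ m)"
      by (simp add: power_mono del: of_nat_Suc of_nat_add)
    also have "\<dots> \<le> real (dim (pow_sum ?V n))"
      using dim_pow_sum_lower[OF N V(2), of n] of_nat_le_iff by blast
    finally have le: "(real n / real m) ^ m \<le> real (dim (pow_sum ?V n))" .
    have pos: "0 < (real n / real m) ^ m" using False n by simp
    have "ln ((real n / real m) ^ m) \<le> ln (real (dim (pow_sum ?V n)))"
      using le by (rule ln_le_cancel_iff[OF pos less_le_trans[OF pos le], THEN iffD2])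
    moreover have "ln ((real n / real m) ^ m) = real m * (ln (real n) - ln (real m))"
      using False n by (simp add: ln_realpow ln_div)
    ultimately have "real m * (ln (real n) - ln (real m)) / ln (real n) \<le> log (real n) (real (dim (pow_sum ?V n)))"
      unfolding log_def using n by (intro divide_right_mono) auto
    then show ?thesis
      using n by (simp add: right_diff_distrib diff_divide_distrib)
  qed
  then have "\<forall>\<^sub>F n in sequentially. ereal (?g n) \<le> ereal (log (real n) (real (dim (pow_sum ?V n))))"
    by (intro eventually_sequentiallyI[of 2]) auto
  then have "limsup (\<lambda>n. ereal (?g n)) \<le> limsup (\<lambda>n. ereal (log (real n) (real (dim (pow_sum ?V n)))))"
    by (rule Limsup_mono)
  moreover have "?g \<longlonglongrightarrow> real m" by real_asymp
  then have "limsup (\<lambda>n. ereal (?g n)) = ereal (real m)"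
    by (intro lim_imp_Limsup) auto
  ultimately show "ereal (real m) \<le> GK_dim"
    unfolding GK_dim_def using V(1) by (intro SUP_upper2[of ?V]) auto
qed

end

section \<open>The tensor square as a ring\<close>

text \<open>\<open>H \<otimes> H\<close> is embedded into a ring type: the coset of \<open>u\<close> acts on the free vector space by
  \<open>w \<mapsto> \<pi>(u w)\<close>, where \<open>\<pi>\<close> is a linear projection whose kernel is the span of the bilinear relations.
  The embedding is multiplicative but does not preserve the unit: \<open>1 \<otimes> 1\<close> becomes \<open>\<pi>\<close>.\<close>

typedef (overloaded) ('p, 'k::field) endo =
  "{f. Vector_Spaces.linear free_scale free_scale (f :: ('p \<Rightarrow>\<^sub>0 'k) \<Rightarrow> ('p \<Rightarrow>\<^sub>0 'k))}"
  by (rule exI[of _ "\<lambda>x. x"]) (simp add: Vector_Spaces.linear_iff vector_space_free)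

setup_lifting type_definition_endo

instantiation endo :: (type, field) ring_1
begin

lift_definition zero_endo :: "('p, 'k::field) endo" is "\<lambda>_. 0"
  by (simp add: Vector_Spaces.linear_iff vector_space_free)

lift_definition one_endo :: "('p, 'k::field) endo" is "\<lambda>w. w"
  by (simp add: Vector_Spaces.linear_iff vector_space_free)

lift_definition plus_endo :: "('p, 'k::field) endo \<Rightarrow> ('p, 'k) endo \<Rightarrow> ('p, 'k) endo" is
  "\<lambda>f g w. f w + g w"
  by (simp add: Vector_Spaces.linear_iff vector_space_free free.scale_right_distrib)

lift_definition minus_endo :: "('p, 'k::field) endo \<Rightarrow> ('p, 'k) endo \<Rightarrow> ('p, 'k) endo" is
  "\<lambda>f g w. f w - g w"
  by (simp add: Vector_Spaces.linear_iff vector_space_free free.scale_right_diff_distrib)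

lift_definition uminus_endo :: "('p, 'k::field) endo \<Rightarrow> ('p, 'k) endo" is "\<lambda>f w. - f w"
  by (simp add: Vector_Spaces.linear_iff vector_space_free)

lift_definition times_endo :: "('p, 'k::field) endo \<Rightarrow> ('p, 'k) endo \<Rightarrow> ('p, 'k) endo" is
  "\<lambda>f g w. f (g w)"
  by (simp add: Vector_Spaces.linear_iff vector_space_free)

instance
proof
  have "(\<lambda>_. 0) \<noteq> (\<lambda>w :: 'a \<Rightarrow>\<^sub>0 'b. w)"
  proof
    assume "(\<lambda>_. 0) = (\<lambda>w :: 'a \<Rightarrow>\<^sub>0 'b. w)"
    from fun_cong[OF this, of "gen undefined"] show False by (metis lookup_single_eq lookup_zero zero_neq_one)
  qed
  then show "(0 :: ('a, 'b) endo) \<noteq> 1" by transfer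
qed (transfer; auto simp: fun_eq_iff Vector_Spaces.linear_iff)+

end

lift_definition endo_scale :: "'k::field \<Rightarrow> ('p, 'k) endo \<Rightarrow> ('p, 'k) endo" is
  "\<lambda>c f w. free_scale c (f w)"
  by (simp add: Vector_Spaces.linear_iff vector_space_free free.scale_right_distrib mult.commute)

interpretation endo: k_algebra endo_scale
  by unfold_locales
    (transfer; auto simp: fun_eq_iff Vector_Spaces.linear_iff free.scale_right_distrib free.scale_left_distrib)+


lemma lin_ext_gen: "lin_ext free_scale gen u = u"
  by (rule poly_mapping_eqI)
    (auto simp: lin_ext_def lookup_sum lookup_single when_def in_keys_iff sum.delta if_distrib cong: if_cong)

lemma span_gen_keys: "u \<in> free.span (gen ` Poly_Mapping.keys u)"
proof -
  have "lin_ext free_scale gen u \<in> free.span (gen ` Poly_Mapping.keys u)"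
    unfolding lin_ext_def by (intro free.span_sum free.span_scale free.span_base) auto
  then show ?thesis by (simp add: lin_ext_gen)
qed

lemma span_gen: "u \<in> free.span (range gen)"
  using span_gen_keys free.span_mono[of "gen ` Poly_Mapping.keys u" "range gen"] by blast

lemma linear_eq_on_gen:
  assumes "Vector_Spaces.linear free_scale s f" "Vector_Spaces.linear free_scale s g"
    and "\<And>p. f (gen p) = g (gen p)"
  shows "f u = g u"
proof -
  interpret f: Vector_Spaces.linear free_scale s f by fact
  interpret vector_space_pair free_scale s by unfold_locales
  show ?thesis using linear_eq_on[OF assms(1,2) span_gen[of u]] assms(3) by auto
qed

context vector_space
begin

lemma linear_lin_ext_param:
  assumes "vector_space s" "\<And>p. Vector_Spaces.linear s scale (f p)"
  shows "Vector_Spaces.linear s scale (\<lambda>v. lin_ext scale (\<lambda>p. f p v) u)"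
  using assms
  by (auto simp: Vector_Spaces.linear_iff lin_ext_def scale_right_distrib sum.distrib scale_sum_right
      mult.commute intro!: sum.cong)

end

section \<open>Multiplication modulo the bilinear relations\<close>

context k_algebra
begin

text \<open>This is \<open>tensor_mult\<close> on representatives; it is bilinear and associative on
  the free space already, before the quotient.\<close>

definition fmult :: "('h \<times> 'h \<Rightarrow>\<^sub>0 'k) \<Rightarrow> ('h \<times> 'h \<Rightarrow>\<^sub>0 'k) \<Rightarrow> ('h \<times> 'h \<Rightarrow>\<^sub>0 'k)" where
  "fmult u v = lin_ext free_scale (\<lambda>(x, y). lin_ext free_scale (\<lambda>(x', y'). gen (x * x', y * y')) v) u"

lemma linear_fmult_left: "Vector_Spaces.linear free_scale free_scale (\<lambda>u. fmult u v)"
  unfolding fmult_def by (rule free.linear_lin_ext)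

lemma linear_fmult_right: "Vector_Spaces.linear free_scale free_scale (fmult u)"
  unfolding fmult_def
  by (rule free.linear_lin_ext_param) (auto simp: vector_space_free intro: free.linear_lin_ext)

lemma fmult_gen: "fmult (gen (x, y)) (gen (x', y')) = gen (x * x', y * y')"
  by (simp add: fmult_def)

lemma fmult_assoc: "fmult (fmult u v) w = fmult u (fmult v w)"
proof -
  note lin = linear_fmult_left linear_fmult_right
  have comp: "Vector_Spaces.linear free_scale free_scale (\<lambda>u. f (g u))"
    if "Vector_Spaces.linear free_scale free_scale f" "Vector_Spaces.linear free_scale free_scale g"
    for f g :: "('h \<times> 'h \<Rightarrow>\<^sub>0 'k) \<Rightarrow> ('h \<times> 'h \<Rightarrow>\<^sub>0 'k)"
    using that by (simp add: Vector_Spaces.linear_iff)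
  have 1: "fmult (fmult (gen p) (gen q)) (gen r) = fmult (gen p) (fmult (gen q) (gen r))" for p q r
    by (cases p; cases q; cases r) (simp add: fmult_gen mult.assoc)
  have 2: "fmult (fmult (gen p) (gen q)) w = fmult (gen p) (fmult (gen q) w)" for p q
    by (rule linear_eq_on_gen[OF lin(2) comp[OF lin(2) lin(2)] 1])
  have 3: "fmult (fmult (gen p) v) w = fmult (gen p) (fmult v w)" for p
    by (rule linear_eq_on_gen[OF comp[OF lin(1)[of w] lin(2)[of "gen p"]] comp[OF lin(2)[of "gen p"] lin(1)[of w]] 2])
  show ?thesis
    by (rule linear_eq_on_gen[OF comp[OF lin(1)[of w] lin(1)[of v]] lin(1)[of "fmult v w"] 3])
qed

abbreviation "rels \<equiv> free.span bilinear_rels"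

text \<open>A relation times a basis element is a relation of the same kind. With the mirror
  statement, the span of the relations is a two-sided ideal.\<close>

lemma rels_fmult_left:
  assumes "n \<in> rels" shows "fmult n w \<in> rels"
proof (rule bilinear_in_subspace[OF assms span_gen linear_fmult_left linear_fmult_right])
  interpret l: Vector_Spaces.linear free_scale free_scale "\<lambda>u. fmult u v" for v by (rule linear_fmult_left)
  fix r q :: "'h \<times> 'h \<Rightarrow>\<^sub>0 'k" assume r: "r \<in> bilinear_rels" and q: "q \<in> range gen"
  then obtain a b where q: "q = gen (a, b)" by auto
  from r have "fmult r q \<in> bilinear_rels"
    unfolding bilinear_rels_def q
    by (elim UnE) (force simp: l.diff l.scale fmult_gen distrib_right scale_mult_left)+
  then show "fmult r q \<in> rels" by (rule free.span_base)
qed simp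

lemma rels_fmult_right:
  assumes "n \<in> rels" shows "fmult w n \<in> rels"
proof (rule bilinear_in_subspace[OF span_gen assms linear_fmult_left linear_fmult_right])
  interpret l: Vector_Spaces.linear free_scale free_scale "fmult v" for v by (rule linear_fmult_right)
  fix q r :: "'h \<times> 'h \<Rightarrow>\<^sub>0 'k" assume r: "r \<in> bilinear_rels" and q: "q \<in> range gen"
  then obtain a b where q: "q = gen (a, b)" by auto
  from r have "fmult q r \<in> bilinear_rels"
    unfolding bilinear_rels_def q
    by (elim UnE) (force simp: l.diff l.scale fmult_gen distrib_left scale_mult_right)+
  then show "fmult q r \<in> rels" by (rule free.span_base)
qed simp

definition proj :: "('h \<times> 'h \<Rightarrow>\<^sub>0 'k) \<Rightarrow> ('h \<times> 'h \<Rightarrow>\<^sub>0 'k)" where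
  "proj = (SOME f. Vector_Spaces.linear free_scale free_scale f \<and>
     (\<forall>u\<in>rels. f u = 0) \<and> (\<forall>u. u - f u \<in> rels))"

text \<open>A basis of the span of the relations is extended to the free space; the projection kills
  the former vectors and fixes the added ones.\<close>

lemma proj: "Vector_Spaces.linear free_scale free_scale proj \<and> (\<forall>u\<in>rels. proj u = 0) \<and> (\<forall>u. u - proj u \<in> rels)"
  unfolding proj_def
proof (rule someI_ex[where P = "\<lambda>f. Vector_Spaces.linear free_scale free_scale f \<and> (\<forall>u\<in>rels. f u = 0) \<and> (\<forall>u. u - f u \<in> rels)"])
  interpret p: vector_space_pair free_scale free_scale by unfold_locales
  obtain B where B: "B \<subseteq> rels" "free.independent B" "rels \<subseteq> free.span B"
    by (rule free.basis_exists[of rels]) blast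
  obtain C where C: "B \<subseteq> C" "free.independent C" "UNIV \<subseteq> free.span C"
    using free.maximal_independent_subset_extend[OF subset_UNIV B(2)] by auto
  define f where "f = p.construct C (\<lambda>c. if c \<in> B then 0 else c)"
  have lin: "Vector_Spaces.linear free_scale free_scale f"
    unfolding f_def by (rule p.linear_construct[OF C(2)])
  interpret f: Vector_Spaces.linear free_scale free_scale f by (rule lin)
  have basis: "f c = (if c \<in> B then 0 else c)" if "c \<in> C" for c
    unfolding f_def by (rule p.construct_basis[OF C(2) that])
  have "f u = 0" if "u \<in> rels" for u
    by (rule f.eq_0_on_span[of B]) (use that B C basis in auto)
  moreover have "u - f u \<in> rels" for u
  proof -
    have lin': "Vector_Spaces.linear free_scale free_scale (\<lambda>u. u - f u)"
      by (simp add: Vector_Spaces.linear_iff vector_space_free f.add f.scale free.scale_right_diff_distrib)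
    interpret g: Vector_Spaces.linear free_scale free_scale "\<lambda>u. u - f u" by (rule lin')
    have "free.span C \<subseteq> {u. u - f u \<in> rels}"
    proof (rule free.span_minimal)
      show "free.subspace {u. u - f u \<in> rels}"
        using g.subspace_vimage[OF free.subspace_span] by (simp add: vimage_def)
      show "C \<subseteq> {u. u - f u \<in> rels}"
      proof
        fix c assume "c \<in> C"
        show "c \<in> {u. u - f u \<in> rels}"
        proof (cases "c \<in> B")
          case True
          have "c \<in> rels" by (rule subsetD[OF B(1) True])
          then show ?thesis using basis[OF \<open>c \<in> C\<close>] True by simp
        next
          case False
          then show ?thesis using basis[OF \<open>c \<in> C\<close>] free.span_zero by simp
        qed
      qed
    qed
    with C(3) show ?thesis by auto
  qed
  ultimately show "\<exists>f. Vector_Spaces.linear free_scale free_scale f \<and> (\<forall>u\<in>rels. f u = 0) \<and> (\<forall>u. u - f u \<in> rels)"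
    using lin by blast
qed

lemma linear_proj: "Vector_Spaces.linear free_scale free_scale proj"
  using proj by blast

lemma diff_proj: "u - proj u \<in> rels"
  using proj by blast

lemma proj_eq_iff: "proj u = proj v \<longleftrightarrow> u - v \<in> rels"
proof -
  interpret p: Vector_Spaces.linear free_scale free_scale proj by (rule linear_proj)
  have "proj (u - v) = 0 \<longleftrightarrow> u - v \<in> rels"
    using proj diff_proj[of "u - v"] by (metis diff_zero)
  then show ?thesis by (simp add: p.diff)
qed

definition tens :: "('h \<times> 'h \<Rightarrow>\<^sub>0 'k) \<Rightarrow> ('h \<times> 'h, 'k) endo" where
  "tens u = Abs_endo (\<lambda>w. proj (fmult u w))"

lemma Rep_tens: "Rep_endo (tens u) w = proj (fmult u w)"
proof -
  have "Vector_Spaces.linear free_scale free_scale (\<lambda>w. proj (fmult u w))"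
    using linear_proj linear_fmult_right[of u] by (simp add: Vector_Spaces.linear_iff)
  then show ?thesis by (simp add: tens_def Abs_endo_inverse)
qed

lemma linear_tens: "Vector_Spaces.linear free_scale endo_scale tens"
proof -
  interpret p: Vector_Spaces.linear free_scale free_scale proj by (rule linear_proj)
  interpret l: Vector_Spaces.linear free_scale free_scale "\<lambda>u. fmult u v" for v by (rule linear_fmult_left)
  show ?thesis
    by (auto simp: Vector_Spaces.linear_iff vector_space_free endo.vector_space_axioms Rep_endo_inject[symmetric]
        fun_eq_iff Rep_tens l.add p.add l.scale p.scale plus_endo.rep_eq endo_scale.rep_eq)
qed

lemma fmult_one: "fmult u (gen (1, 1)) = u"
  by (rule linear_eq_on_gen[OF linear_fmult_left, of "\<lambda>u. u"])
    (auto simp: Vector_Spaces.linear_iff vector_space_free fmult_gen)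

text \<open>The embedding is faithful because \<open>gen (1, 1)\<close> is a right unit for
  \<open>fmult\<close>: the value there determines the coset.\<close>

lemma tens_eq_iff: "tens u = tens v \<longleftrightarrow> u - v \<in> rels"
proof
  assume "tens u = tens v"
  then have "Rep_endo (tens u) (gen (1, 1)) = Rep_endo (tens v) (gen (1, 1))" by simp
  then show "u - v \<in> rels" by (simp add: Rep_tens fmult_one proj_eq_iff)
next
  interpret l: Vector_Spaces.linear free_scale free_scale "\<lambda>u. fmult u v" for v by (rule linear_fmult_left)
  assume "u - v \<in> rels"
  then have "proj (fmult u w) = proj (fmult v w)" for w
    using rels_fmult_left[of "u - v" w] by (simp add: proj_eq_iff l.diff)
  then show "tens u = tens v" by (simp add: tens_def)
qed

text \<open>The inner projection changes its argument by a relation, and multiples of relations are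
  killed by the outer one.\<close>

lemma tens_mult: "tens u * tens v = tens (fmult u v)"
proof -
  interpret r: Vector_Spaces.linear free_scale free_scale "fmult z" for z by (rule linear_fmult_right)
  have key: "proj (fmult u (proj (fmult v w))) = proj (fmult u (fmult v w))" for w
    using rels_fmult_right[OF free.span_neg[OF diff_proj], of u "fmult v w"]
    by (simp add: proj_eq_iff r.diff)
  have "Rep_endo (tens u * tens v) w = Rep_endo (tens (fmult u v)) w" for w
    using key[of w] by (simp add: times_endo.rep_eq Rep_tens fmult_assoc)
  then show ?thesis
    by (intro Rep_endo_inject[THEN iffD1] ext)
qed

section \<open>Pure tensors and the maps induced by bilinear maps\<close>

definition tn :: "'h \<Rightarrow> 'h \<Rightarrow> ('h \<times> 'h, 'k) endo" where
  "tn x y = tens (gen (x, y))"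

lemma tn_mult: "tn a b * tn c d = tn (a * c) (b * d)"
  by (simp add: tn_def tens_mult fmult_gen)

lemma linear_tn: "Vector_Spaces.linear scale endo_scale (\<lambda>x. tn x y)" "Vector_Spaces.linear scale endo_scale (tn x)"
proof -
  interpret t: Vector_Spaces.linear free_scale endo_scale tens by (rule linear_tens)
  have "tn (x + x') y = tn x y + tn x' y" "tn y (x + x') = tn y x + tn y x'"
    "tn (scale c x) y = endo_scale c (tn x y)" "tn y (scale c x) = endo_scale c (tn y x)" for x x' y c
    unfolding tn_def t.add[symmetric] t.scale[symmetric] tens_eq_iff
    by (rule free.span_base; force simp: bilinear_rels_def diff_diff_eq)+
  then show "Vector_Spaces.linear scale endo_scale (\<lambda>x. tn x y)" "Vector_Spaces.linear scale endo_scale (tn x)"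
    by (auto simp: Vector_Spaces.linear_iff vector_space_axioms endo.vector_space_axioms)
qed

sublocale tnl: Vector_Spaces.linear scale endo_scale "\<lambda>x. tn x y" for y
  by (rule linear_tn)

sublocale tnr: Vector_Spaces.linear scale endo_scale "tn x" for x
  by (rule linear_tn)

definition tensor_span :: "'h set \<Rightarrow> 'h set \<Rightarrow> ('h \<times> 'h, 'k) endo set" where
  "tensor_span A B = endo.span {tn a b |a b. a \<in> A \<and> b \<in> B}"

lemma tens_in_tensor_span:
  assumes "Poly_Mapping.keys u \<subseteq> A \<times> B" shows "tens u \<in> tensor_span A B"
proof -
  interpret t: Vector_Spaces.linear free_scale endo_scale tens by (rule linear_tens)
  have "tens u \<in> endo.span (tens ` gen ` Poly_Mapping.keys u)"
    using span_gen_keys[of u] by (auto simp: t.span_image)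
  moreover have "tens ` gen ` Poly_Mapping.keys u \<subseteq> {tn a b |a b. a \<in> A \<and> b \<in> B}"
    using assms by (auto simp: tn_def)
  ultimately show ?thesis unfolding tensor_span_def using endo.span_mono by blast
qed

lemma tensor_span_eq: "tensor_span A B = {tens u |u. Poly_Mapping.keys u \<subseteq> A \<times> B}"
proof
  interpret t: Vector_Spaces.linear free_scale endo_scale tens by (rule linear_tens)
  have sub: "free.subspace {u :: 'h \<times> 'h \<Rightarrow>\<^sub>0 'k. Poly_Mapping.keys u \<subseteq> A \<times> B}"
  proof (rule free.subspaceI)
    fix u v :: "'h \<times> 'h \<Rightarrow>\<^sub>0 'k" and c
    assume u: "u \<in> {u. Poly_Mapping.keys u \<subseteq> A \<times> B}"
    have "Poly_Mapping.keys (free_scale c u) \<subseteq> Poly_Mapping.keys u" by (auto simp: in_keys_iff)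
    with u show "free_scale c u \<in> {u. Poly_Mapping.keys u \<subseteq> A \<times> B}" by auto
    assume "v \<in> {u. Poly_Mapping.keys u \<subseteq> A \<times> B}"
    with u show "u + v \<in> {u. Poly_Mapping.keys u \<subseteq> A \<times> B}"
      using Poly_Mapping.keys_add[of u v] by auto
  qed simp
  have "endo.subspace (tens ` {u. Poly_Mapping.keys u \<subseteq> A \<times> B})"
    by (rule t.subspace_image[OF sub])
  moreover have "{tn a b |a b. a \<in> A \<and> b \<in> B} \<subseteq> tens ` {u. Poly_Mapping.keys u \<subseteq> A \<times> B}"
    by (force simp: tn_def)
  ultimately show "tensor_span A B \<subseteq> {tens u |u. Poly_Mapping.keys u \<subseteq> A \<times> B}"
    unfolding tensor_span_def by (intro order_trans[OF endo.span_minimal]) auto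
qed (use tens_in_tensor_span in auto)

text \<open>Evaluation at \<open>gen (1, 1)\<close> turns the operator \<open>tens u\<close> back
  into the representative \<open>proj u\<close>. The map is linear for every \<open>f\<close>;
  bilinearity of \<open>f\<close> makes the value at \<open>tens u\<close> computable from any
  representative.\<close>

definition lift :: "('k \<Rightarrow> 'w \<Rightarrow> 'w) \<Rightarrow> ('h \<Rightarrow> 'h \<Rightarrow> 'w) \<Rightarrow> ('h \<times> 'h, 'k) endo \<Rightarrow> 'w::ab_group_add" where
  "lift s f r = lin_ext s (\<lambda>(x, y). f x y) (Rep_endo r (gen (1, 1)))"

lemma linear_lift: "vector_space s \<Longrightarrow> Vector_Spaces.linear endo_scale s (lift s f)"
proof -
  assume s: "vector_space s"
  interpret s: vector_space s by fact
  interpret l: Vector_Spaces.linear free_scale s "lin_ext s (\<lambda>(x, y). f x y)" by (rule s.linear_lin_ext)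
  show ?thesis
    by (simp add: Vector_Spaces.linear_iff s endo.vector_space_axioms lift_def plus_endo.rep_eq
        endo_scale.rep_eq l.add l.scale)
qed

lemma lift_tens:
  assumes "\<And>y. Vector_Spaces.linear scale s (\<lambda>x. f x y)" "\<And>x. Vector_Spaces.linear scale s (f x)"
  shows "lift s f (tens u) = lin_ext s (\<lambda>(x, y). f x y) u"
proof -
  interpret f: Vector_Spaces.linear scale s "f x" for x by (rule assms)
  interpret l: Vector_Spaces.linear free_scale s "lin_ext s (\<lambda>(x, y). f x y)" by (rule f.vs2.linear_lin_ext)
  have "lin_ext s (\<lambda>(x, y). f x y) (u - proj u) \<in> {0}"
    by (rule lin_ext_respects[OF f.vs2.vector_space_axioms _ _ _ _ _ diff_proj])
      (use assms in \<open>auto simp: linear_iff_module_hom module_hom_iff\<close>)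
  then show ?thesis by (simp add: lift_def Rep_tens fmult_one l.diff)
qed

lemma lift_tn:
  assumes "\<And>y. Vector_Spaces.linear scale s (\<lambda>x. f x y)" "\<And>x. Vector_Spaces.linear scale s (f x)"
  shows "lift s f (tn x y) = f x y"
proof -
  interpret f: Vector_Spaces.linear scale s "f x" for x by (rule assms)
  show ?thesis by (simp add: tn_def lift_tens[OF assms] f.vs2.lin_ext_single)
qed

section \<open>Comparison with the cosets\<close>

definition emb :: "('k, 'h) tensor2 \<Rightarrow> ('h \<times> 'h, 'k) endo" where
  "emb X = tens (rep X)"

lemma emb_class: "emb (tensor_class u) = tens u"
  unfolding emb_def tens_eq_iff by (rule rep_tensor_class)

lemma emb_pure: "emb (pure_tensor x y) = tn x y"
  by (simp add: pure_tensor_def emb_class tn_def)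

lemma emb_add: "emb (tensor_add X Y) = emb X + emb Y"
proof -
  interpret t: Vector_Spaces.linear free_scale endo_scale tens by (rule linear_tens)
  show ?thesis by (simp add: tensor_add_def emb_class t.add) (simp add: emb_def)
qed

lemma emb_uminus: "emb (tensor_uminus X) = - emb X"
proof -
  interpret t: Vector_Spaces.linear free_scale endo_scale tens by (rule linear_tens)
  show ?thesis by (simp add: tensor_uminus_def emb_class t.neg) (simp add: emb_def)
qed

lemma emb_scale: "emb (tensor_scale c X) = endo_scale c (emb X)"
proof -
  interpret t: Vector_Spaces.linear free_scale endo_scale tens by (rule linear_tens)
  show ?thesis by (simp add: tensor_scale_def emb_class t.scale) (simp add: emb_def)
qed

lemma emb_mult: "emb (tensor_mult X Y) = emb X * emb Y"
  by (simp add: tensor_mult_def emb_class tens_mult fmult_def[symmetric]) (simp add: emb_def tens_mult)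

lemma emb_tensor_sub: "X \<in> tensor_sub A B \<Longrightarrow> emb X \<in> tensor_span A B"
  unfolding tensor_sub_def tensor_span_eq by (auto simp: emb_class)

text \<open>The type \<open>tensor2\<close> contains arbitrary sets, and \<open>emb\<close> sees
  only one chosen representative; hence the restriction to cosets.\<close>

lemma emb_eq_iff: "X \<in> tensors \<Longrightarrow> Y \<in> tensors \<Longrightarrow> emb X = emb Y \<longleftrightarrow> X = Y"
  unfolding tensors_def by (elim imageE) (simp add: emb_class tens_eq_iff tensor_class_eq_iff)

lemma tensors_closed [simp]:
  "tensor_class u \<in> tensors" "pure_tensor x y \<in> tensors" "tensor_add X Y \<in> tensors"
  "tensor_uminus X \<in> tensors" "tensor_twist X \<in> tensors"
  by (simp_all add: tensors_def pure_tensor_def tensor_add_def tensor_uminus_def tensor_twist_def)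

lemma tensor_sub_iff: "X \<in> tensors \<Longrightarrow> X \<in> tensor_sub A B \<longleftrightarrow> emb X \<in> tensor_span A B"
  unfolding tensor_sub_def tensor_span_eq tensors_def
  by (auto simp: emb_class tens_eq_iff tensor_class_eq_iff)

lemma tensor_lift_emb:
  assumes "\<And>y. Vector_Spaces.linear scale scale (\<lambda>x. f x y)" "\<And>x. Vector_Spaces.linear scale scale (f x)"
  shows "tensor_lift f X = lift scale f (emb X)"
  by (simp add: tensor_lift_def emb_def lift_tens[OF assms])

definition tw :: "('h \<times> 'h, 'k) endo \<Rightarrow> ('h \<times> 'h, 'k) endo" where
  "tw = lift endo_scale (\<lambda>x y. tn y x)"

lemma linear_tw: "Vector_Spaces.linear endo_scale endo_scale tw"
  unfolding tw_def by (rule linear_lift) (rule endo.vector_space_axioms)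

lemma tw_tn: "tw (tn x y) = tn y x"
  unfolding tw_def by (rule lift_tn) (rule linear_tn)+

lemma emb_twist: "emb (tensor_twist X) = tw (emb X)"
proof -
  interpret t: Vector_Spaces.linear free_scale endo_scale tens by (rule linear_tens)
  have "tens (lin_ext free_scale (\<lambda>(x, y). gen (y, x)) u) = lin_ext endo_scale (\<lambda>(x, y). tn y x) u" for u
    by (simp add: lin_ext_def t.sum t.scale tn_def case_prod_unfold)
  then show ?thesis
    by (simp add: tensor_twist_def emb_class tw_def) (simp add: emb_def lift_tens linear_tn)
qed

end

section \<open>Commutators of anti-cocommutative elements\<close>

lemma linear_span_in_subspace:
  assumes "Vector_Spaces.linear s1 s2 f" "r \<in> module.span s1 A"
    and "module.subspace s2 V" "\<And>a. a \<in> A \<Longrightarrow> f a \<in> V"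
  shows "f r \<in> V"
proof -
  interpret l: Vector_Spaces.linear s1 s2 f by fact
  have "l.vs1.span A \<subseteq> {x. f x \<in> V}"
    by (rule l.vs1.span_minimal) (use assms(4) l.subspace_vimage[OF assms(3)] in \<open>auto simp: vimage_def\<close>)
  with assms(2) show ?thesis by auto
qed

context k_algebra
begin

lemma subspace_tensor_span [simp]: "endo.subspace (tensor_span A B)"
  by (simp add: tensor_span_def)

lemma tn_tensor_span: "a \<in> A \<Longrightarrow> b \<in> B \<Longrightarrow> tn a b \<in> tensor_span A B"
  unfolding tensor_span_def by (rule endo.span_base) blast

lemma tensor_span_mono: "r \<in> tensor_span A B \<Longrightarrow> A \<subseteq> A' \<Longrightarrow> B \<subseteq> B' \<Longrightarrow> r \<in> tensor_span A' B'"
  unfolding tensor_span_def by (erule subsetD[OF endo.span_mono, rotated]) blast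

lemma tensor_span_linear:
  assumes "Vector_Spaces.linear endo_scale s f" "r \<in> tensor_span A B" "module.subspace s V"
    and "\<And>a b. a \<in> A \<Longrightarrow> b \<in> B \<Longrightarrow> f (tn a b) \<in> V"
  shows "f r \<in> V"
  by (rule linear_span_in_subspace[OF assms(1) assms(2)[unfolded tensor_span_def] assms(3)])
    (use assms(4) in blast)

lemma tensor_span_mult:
  assumes "r \<in> tensor_span A B" "s \<in> tensor_span A' B'"
    and "\<And>a b a' b'. a \<in> A \<Longrightarrow> b \<in> B \<Longrightarrow> a' \<in> A' \<Longrightarrow> b' \<in> B' \<Longrightarrow> tn (a * a') (b * b') \<in> V"
    and "endo.subspace V"
  shows "r * s \<in> V"
  by (rule endo.span_mult[OF assms(1,2)[unfolded tensor_span_def] _ assms(4)])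
    (use assms(3) in \<open>auto simp: tn_mult\<close>)

lemma tensor_span_sum:
  assumes "subspace A" "r \<in> tensor_span A B"
  obtains n :: nat and a b where "\<And>i. i < n \<Longrightarrow> a i \<in> A" "\<And>i. i < n \<Longrightarrow> b i \<in> B"
    "r = (\<Sum>i<n. tn (a i) (b i))"
proof -
  have "\<exists>n (a :: nat \<Rightarrow> 'h) b. (\<forall>i<n. a i \<in> A \<and> b i \<in> B) \<and> r = (\<Sum>i<n. tn (a i) (b i))"
    using assms(2) unfolding tensor_span_def
  proof (induction rule: endo.span_induct_alt)
    case base
    show ?case by (rule exI[of _ 0]) simp
  next
    case (step c x y)
    from step(1) obtain a0 b0 where x: "x = tn a0 b0" "a0 \<in> A" "b0 \<in> B" by blast
    from step(2) obtain n :: nat and a b where y: "\<forall>i<n. a i \<in> A \<and> b i \<in> B" "y = (\<Sum>i<n. tn (a i) (b i))" by blast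
    let ?a = "a(n := scale c a0)" and ?b = "b(n := b0)"
    have "(\<Sum>i<Suc n. tn (?a i) (?b i)) = (\<Sum>i<n. tn (a i) (b i)) + tn (scale c a0) b0"
    proof -
      have "(\<Sum>i<n. tn (?a i) (?b i)) = (\<Sum>i<n. tn (a i) (b i))" by (rule sum.cong) auto
      then show ?thesis by simp
    qed
    then have "endo_scale c x + y = (\<Sum>i<Suc n. tn (?a i) (?b i))"
      using x y by (simp add: tnl.scale)
    moreover have "\<forall>i<Suc n. ?a i \<in> A \<and> ?b i \<in> B"
      using x y subspace_scale[OF assms(1)] by (auto simp: less_Suc_eq)
    ultimately show ?case by blast
  qed
  then show ?thesis using that by blast
qed

text \<open>A bilinear expression factors through \<open>lift\<close>, so an identity between sums
  of pure tensors may be substituted in it. Tensor identities are used below in this form.\<close>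

lemma lift_sum_eq:
  assumes "\<And>y. Vector_Spaces.linear scale s (\<lambda>x. f x y)" "\<And>x. Vector_Spaces.linear scale s (f x)"
    and "(\<Sum>i\<in>I. tn (a i) (b i)) = (\<Sum>i\<in>I. tn (a' i) (b' i))"
  shows "(\<Sum>i\<in>I. f (a i) (b i)) = (\<Sum>i\<in>I. f (a' i) (b' i))"
proof -
  interpret f: Vector_Spaces.linear scale s "f x" for x by (rule assms)
  interpret l: Vector_Spaces.linear endo_scale s "lift s f" by (rule linear_lift) unfold_locales
  from assms(3) have "lift s f (\<Sum>i\<in>I. tn (a i) (b i)) = lift s f (\<Sum>i\<in>I. tn (a' i) (b' i))" by simp
  then show ?thesis by (simp add: l.sum lift_tn[OF assms(1,2)])
qed

text \<open>Since \<open>tw\<close> reads an operator only through its value at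
  \<open>gen (1, 1)\<close>, the comparison is made on pure tensors and confined to their
  span.\<close>

lemma tw_mult:
  assumes "r \<in> tensor_span UNIV UNIV" "s \<in> tensor_span UNIV UNIV"
  shows "tw (r * s) = tw r * tw s"
proof -
  interpret t: Vector_Spaces.linear endo_scale endo_scale tw by (rule linear_tw)
  have "tw (r * s) - tw r * tw s \<in> {0}"
    by (rule bilinear_in_subspace[OF assms[unfolded tensor_span_def], where ?s3.0 = endo_scale and f = "\<lambda>r s. tw (r * s) - tw r * tw s"])
      (auto simp: Vector_Spaces.linear_iff endo.vector_space_axioms t.add t.scale distrib_left distrib_right
        endo.scale_mult_left endo.scale_mult_right endo.scale_right_diff_distrib tn_mult tw_tn)
  then show ?thesis by simp
qed

lemma generated_subalgebra_closed:
  "subalgebra (generated_subalgebra A)" "A \<subseteq> generated_subalgebra A"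
  unfolding generated_subalgebra_def subalgebra_def by (auto intro: subspace_Inter)

lemma generated_subalgebra_least: "subalgebra B \<Longrightarrow> A \<subseteq> B \<Longrightarrow> generated_subalgebra A \<subseteq> B"
  unfolding generated_subalgebra_def by blast

definition pr :: "'h \<Rightarrow> ('h \<times> 'h, 'k) endo" where
  "pr h = tn h 1 + tn 1 h"

lemma linear_pr: "Vector_Spaces.linear scale endo_scale pr"
  by (simp add: Vector_Spaces.linear_iff vector_space_axioms endo.vector_space_axioms pr_def
      tnl.add tnr.add tnl.scale tnr.scale endo.scale_right_distrib)

lemma pr_commutator: "pr a * pr b - pr b * pr a = pr (a * b - b * a)"
  by (simp add: pr_def distrib_left distrib_right tn_mult tnl.diff tnr.diff)

lemma pr_tensor_span [simp]: "pr a \<in> tensor_span UNIV UNIV"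
  unfolding pr_def by (intro endo.subspace_add subspace_tensor_span tn_tensor_span) auto

lemma tw_pr: "tw (pr a) = pr a"
proof -
  interpret t: Vector_Spaces.linear endo_scale endo_scale tw by (rule linear_tw)
  show ?thesis by (simp add: pr_def t.add tw_tn)
qed

lemma linear_commutator_pr: "Vector_Spaces.linear endo_scale endo_scale (\<lambda>r. r * pr z - pr z * r)"
  by (simp add: Vector_Spaces.linear_iff endo.vector_space_axioms distrib_left distrib_right
      endo.scale_mult_left endo.scale_mult_right endo.scale_right_diff_distrib)

lemma tn_commutator_pr: "tn a b * pr z - pr z * tn a b = tn (a * z - z * a) b + tn a (b * z - z * b)"
  by (simp add: pr_def distrib_left distrib_right tn_mult tnl.diff tnr.diff)

lemma commutator_pr_tensor_span:
  assumes "r \<in> tensor_span A A" "\<And>a. a \<in> A \<Longrightarrow> a * z - z * a \<in> A"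
  shows "r * pr z - pr z * r \<in> tensor_span A A"
  by (rule tensor_span_linear[OF linear_commutator_pr assms(1) subspace_tensor_span])
    (auto simp: tn_commutator_pr intro!: endo.subspace_add subspace_tensor_span tn_tensor_span assms(2))

lemma tw_commutator_pr:
  assumes "r \<in> tensor_span UNIV UNIV"
  shows "tw (r * pr z - pr z * r) = tw r * pr z - pr z * tw r"
proof -
  interpret t: Vector_Spaces.linear endo_scale endo_scale tw by (rule linear_tw)
  show ?thesis by (simp add: t.diff tw_mult assms tw_pr)
qed

end

section \<open>The reduced comultiplication, primitive elements and \<open>P2\<close>\<close>

context hopf_algebra
begin

text \<open>In the ring of endomorphisms \<open>tn x y\<close>, \<open>tw\<close>, \<open>cm\<close> and \<open>dl\<close> stand for \<open>x \<otimes> y\<close>, \<open>\<tau>\<close>, \<open>\<Delta>\<close> and \<open>\<delta>\<close>.\<close>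

definition cm :: "'h \<Rightarrow> ('h \<times> 'h, 'k) endo" where
  "cm h = emb (\<Delta> h)"

definition dl :: "'h \<Rightarrow> ('h \<times> 'h, 'k) endo" where
  "dl h = cm h - pr h"

lemma linear_cm: "Vector_Spaces.linear scale endo_scale cm"
  by (simp add: Vector_Spaces.linear_iff vector_space_axioms endo.vector_space_axioms cm_def
      comult_add comult_scale emb_add emb_scale)

sublocale cm: Vector_Spaces.linear scale endo_scale cm by (rule linear_cm)

lemma linear_dl: "Vector_Spaces.linear scale endo_scale dl"
proof -
  interpret p: Vector_Spaces.linear scale endo_scale pr by (rule linear_pr)
  show ?thesis
    by (simp add: Vector_Spaces.linear_iff vector_space_axioms endo.vector_space_axioms dl_def
      cm.add cm.scale p.add p.scale endo.scale_right_diff_distrib)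
qed

sublocale dl: Vector_Spaces.linear scale endo_scale dl by (rule linear_dl)

lemma cm_mult: "cm (g * h) = cm g * cm h"
  by (simp add: cm_def comult_mult emb_mult)

lemma cm_one: "cm 1 = tn 1 1"
  by (simp add: cm_def comult_one emb_pure)

lemma cm_eq: "cm h = pr h + dl h"
  by (simp add: dl_def)

lemma cm_tensor_span [simp]: "cm h \<in> tensor_span UNIV UNIV"
  unfolding cm_def by (rule emb_tensor_sub) (use comult_tensor in \<open>auto simp: tensors_def tensor_sub_def\<close>)

lemma primitives_iff: "x \<in> primitives \<longleftrightarrow> dl x = 0"
proof -
  have "x \<in> primitives \<longleftrightarrow> emb (\<Delta> x) = emb (tensor_add (pure_tensor x 1) (pure_tensor 1 x))"
    unfolding primitives_def by (simp add: emb_eq_iff comult_tensor)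
  then show ?thesis by (simp add: emb_add emb_pure dl_def cm_def pr_def)
qed

lemma cm_primitive: "x \<in> primitives \<Longrightarrow> cm x = pr x"
  by (simp add: primitives_iff dl_def)

lemma emb_delta: "emb (\<delta> h) = dl h"
  by (simp add: \<delta>_def emb_add emb_uminus emb_pure dl_def cm_def pr_def)

lemma P2_iff: "c \<in> P2 \<longleftrightarrow> tw (dl c) = - dl c \<and> dl c \<in> tensor_span primitives primitives"
proof -
  have "\<delta> c \<in> tensors" by (simp add: \<delta>_def)
  then have "\<delta> c \<in> tensor_sub primitives primitives \<longleftrightarrow> dl c \<in> tensor_span primitives primitives"
    using tensor_sub_iff emb_delta by simp
  moreover have "tensor_twist (\<delta> c) = tensor_uminus (\<delta> c) \<longleftrightarrow> tw (dl c) = - dl c"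
    using emb_eq_iff[of "tensor_twist (\<delta> c)" "tensor_uminus (\<delta> c)"] by (simp add: emb_twist emb_uminus emb_delta)
  ultimately show ?thesis by (simp add: P2_def)
qed

lemma subspace_primitives: "subspace primitives"
  using dl.subspace_kernel by (simp add: primitives_iff[abs_def, symmetric] Collect_mem_eq)

lemma subspace_P2: "subspace P2"
proof -
  interpret t: Vector_Spaces.linear endo_scale endo_scale tw by (rule linear_tw)
  show ?thesis
    by (rule subspaceI)
      (auto simp: P2_iff dl.add dl.scale t.add t.scale endo.subspace_0 endo.subspace_add endo.subspace_scale)
qed

lemma primitives_P2: "primitives \<subseteq> P2"
proof -
  interpret t: Vector_Spaces.linear endo_scale endo_scale tw by (rule linear_tw)
  show ?thesis by (auto simp: P2_iff primitives_iff endo.subspace_0)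
qed

lemma dl_P2: "c \<in> P2 \<Longrightarrow> dl c \<in> tensor_span UNIV UNIV"
  unfolding P2_iff using tensor_span_mono by blast

lemma linear_S: "Vector_Spaces.linear scale scale S"
  by (rule antipode_linear)

sublocale S: Vector_Spaces.linear scale scale S by (rule linear_S)

sublocale counit: Vector_Spaces.linear scale "(*)" \<epsilon> by (rule counit_linear)

lemma bilinear_counit:
  assumes "Vector_Spaces.linear scale (*) \<phi>"
  shows "Vector_Spaces.linear scale scale (\<lambda>x. scale (\<phi> x) y)" "Vector_Spaces.linear scale scale (\<lambda>y. scale (\<phi> x) y)"
  using assms by (auto simp: Vector_Spaces.linear_iff vector_space_axioms scale_left_distrib scale_right_distrib mult.commute)

lemma lift_functional_tn:
  assumes "Vector_Spaces.linear scale (*) \<phi>"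
  shows "lift scale (\<lambda>x y. scale (\<phi> x) y) (tn a b) = scale (\<phi> a) b"
  by (rule lift_tn[where f = "\<lambda>x y. scale (\<phi> x) y"]) (rule bilinear_counit[OF assms])+

lemma bilinear_antipode:
  "Vector_Spaces.linear scale scale (\<lambda>x. S x * y)" "Vector_Spaces.linear scale scale (\<lambda>y. S x * y)"
  "Vector_Spaces.linear scale scale (\<lambda>x. x * a * S y)" "Vector_Spaces.linear scale scale (\<lambda>y. x * a * S y)"
  "Vector_Spaces.linear scale scale (\<lambda>x. x * S y)" "Vector_Spaces.linear scale scale (\<lambda>y. x * S y)"
  by (simp_all add: Vector_Spaces.linear_iff vector_space_axioms S.add S.scale distrib_left distrib_right
      scale_mult_left scale_mult_right)

lemma counit_lift: "lift scale (\<lambda>x y. scale (\<epsilon> x) y) (cm h) = h"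
  using counit_left[of h] tensor_lift_emb[where f = "\<lambda>x y. scale (\<epsilon> x) y", OF bilinear_counit[OF counit_linear]]
  by (simp add: cm_def)

lemma antipode_lift_left: "lift scale (\<lambda>x y. S x * y) (cm h) = scale (\<epsilon> h) 1"
  using antipode_left[of h] by (simp add: tensor_lift_emb[OF bilinear_antipode(1,2)] cm_def)

lemma antipode_lift_right: "lift scale (\<lambda>x y. x * S y) (cm h) = scale (\<epsilon> h) 1"
  using antipode_right[of h] by (simp add: tensor_lift_emb[OF bilinear_antipode(5,6)] cm_def)

lemma counit_primitive:
  assumes "x \<in> primitives" shows "\<epsilon> x = 0"
proof -
  interpret l: Vector_Spaces.linear endo_scale scale "lift scale (\<lambda>x y. scale (\<epsilon> x) y)"
    by (rule linear_lift) (rule vector_space_axioms)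
  have "x = lift scale (\<lambda>x y. scale (\<epsilon> x) y) (pr x)"
    using counit_lift[of x] cm_primitive[OF assms] by simp
  also have "\<dots> = scale (\<epsilon> x) 1 + x"
    by (simp add: pr_def l.add lift_functional_tn counit_linear counit_one)
  finally show ?thesis by simp
qed

lemma S_one: "S 1 = 1"
  using antipode_lift_left[of 1] by (simp add: cm_one lift_tn[OF bilinear_antipode(1,2)] counit_one)

text \<open>Multiplicativity of \<open>cm = pr + dl\<close> is expanded; the part involving only
  \<open>pr\<close> is absorbed because \<open>pr\<close> respects commutators.\<close>

lemma dl_commutator:
  "dl (a * b - b * a) = (dl a * pr b - pr b * dl a) - (dl b * pr a - pr a * dl b) + (dl a * dl b - dl b * dl a)"
proof -
  have "dl (a * b - b * a) = cm a * cm b - cm b * cm a - (pr a * pr b - pr b * pr a)"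
    by (simp add: dl_def cm.diff cm_mult pr_commutator)
  then show ?thesis by (simp add: cm_eq algebra_simps)
qed

lemma primitives_commutator: "x \<in> primitives \<Longrightarrow> y \<in> primitives \<Longrightarrow> x * y - y * x \<in> primitives"
  by (simp add: primitives_iff dl_commutator)

text \<open>As \<open>dl x = 0\<close>, only the adjoint action of \<open>x\<close> on
  \<open>dl c\<close> survives; it preserves tensors of primitive elements and commutes with the
  twist.\<close>

lemma P2_commutator_primitive:
  assumes c: "c \<in> P2" and x: "x \<in> primitives"
  shows "c * x - x * c \<in> P2" "dl (c * x - x * c) = dl c * pr x - pr x * dl c"
proof -
  show eq: "dl (c * x - x * c) = dl c * pr x - pr x * dl c"
    using x by (simp add: dl_commutator primitives_iff)
  show "c * x - x * c \<in> P2"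
    using c x commutator_pr_tensor_span[of "dl c" primitives x] primitives_commutator tw_commutator_pr[OF dl_P2[OF c], of x]
    by (auto simp: P2_iff eq)
qed

section \<open>The subalgebra generated by the primitive elements\<close>

lemma word_comult:
  assumes "set xs \<subseteq> primitives"
  shows "cm (prod_list xs) - tn (prod_list xs) 1 \<in>
    tensor_span {prod_list zs |zs. set zs \<subseteq> primitives \<and> length zs < length xs} (generated_subalgebra primitives)"
  using assms
proof (induction xs)
  case Nil
  show ?case by (simp add: cm_one endo.subspace_0)
next
  case (Cons x xs)
  let ?W = "\<lambda>n. {prod_list zs |zs. set zs \<subseteq> primitives \<and> length zs < n}"
  let ?B = "generated_subalgebra primitives"
  let ?P = "prod_list xs" and ?n = "length xs"
  have x: "x \<in> primitives" and xs: "set xs \<subseteq> primitives" using Cons.prems by auto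
  have B: "subalgebra ?B" "x \<in> ?B" using generated_subalgebra_closed[of primitives] x by auto
  define r where "r = cm ?P - tn ?P 1"
  have r: "r \<in> tensor_span (?W ?n) ?B" unfolding r_def by (rule Cons.IH[OF xs])
  have "cm (x * ?P) - tn (x * ?P) 1 = tn ?P x + (tn x 1 * r + tn 1 x * r)"
    by (simp add: cm_mult cm_primitive[OF x] pr_def r_def algebra_simps tn_mult)
  moreover have "tn ?P x \<in> tensor_span (?W (Suc ?n)) ?B"
    using xs B by (intro tn_tensor_span) auto
  moreover have "tn x 1 * r \<in> tensor_span (?W (Suc ?n)) ?B"
  proof (rule tensor_span_linear[OF endo.linear_mult_right r subspace_tensor_span])
    fix a b assume "a \<in> ?W ?n" "b \<in> ?B"
    then obtain zs where "a = prod_list zs" "set zs \<subseteq> primitives" "length zs < ?n" by blast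
    then have "x * a = prod_list (x # zs) \<and> set (x # zs) \<subseteq> primitives \<and> length (x # zs) < Suc ?n"
      using x by simp
    then have "x * a \<in> ?W (Suc ?n)" by blast
    with \<open>b \<in> ?B\<close> show "tn x 1 * tn a b \<in> tensor_span (?W (Suc ?n)) ?B"
      by (simp add: tn_mult tn_tensor_span)
  qed
  moreover have "tn 1 x * r \<in> tensor_span (?W (Suc ?n)) ?B"
  proof (rule tensor_span_linear[OF endo.linear_mult_right r subspace_tensor_span])
    fix a b assume "a \<in> ?W ?n" "b \<in> ?B"
    then have "a \<in> ?W (Suc ?n)" "x * b \<in> ?B" using B unfolding subalgebra_def by force+
    then show "tn 1 x * tn a b \<in> tensor_span (?W (Suc ?n)) ?B"
      by (simp add: tn_mult tn_tensor_span)
  qed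
  ultimately show ?case
    by (simp add: endo.subspace_add)
qed

text \<open>The antipode axiom is solved for the term with left factor the whole word. By
  \<open>word_comult\<close> the other left factors are shorter words, so this is a recursion on the
  length and does not use that \<open>S\<close> reverses products.\<close>

lemma antipode_word:
  "set xs \<subseteq> primitives \<Longrightarrow> S (prod_list xs) \<in> generated_subalgebra primitives"
proof (induction "length xs" arbitrary: xs rule: less_induct)
  case (less xs)
  let ?W = "{prod_list zs |zs. set zs \<subseteq> primitives \<and> length zs < length xs}"
  let ?B = "generated_subalgebra primitives"
  let ?P = "prod_list xs"
  let ?f = "\<lambda>x y. S x * y"
  have B: "subalgebra ?B" "subspace ?B" using generated_subalgebra_closed(1) by (auto simp: subalgebra_def)
  have lin: "Vector_Spaces.linear endo_scale scale (lift scale ?f)"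
    by (rule linear_lift) (rule vector_space_axioms)
  interpret l: Vector_Spaces.linear endo_scale scale "lift scale ?f" by (rule lin)
  have "lift scale ?f (cm ?P - tn ?P 1) \<in> ?B"
  proof (rule tensor_span_linear[OF lin word_comult[OF less.prems] B(2)])
    fix a b assume "a \<in> ?W" "b \<in> ?B"
    then show "lift scale ?f (tn a b) \<in> ?B"
      using less.hyps B(1) by (auto simp: lift_tn[OF bilinear_antipode(1,2)] subalgebra_def)
  qed
  then have diff: "scale (\<epsilon> ?P) 1 - S ?P \<in> ?B"
    by (simp add: l.diff antipode_lift_left lift_tn[OF bilinear_antipode(1,2)])
  have "scale (\<epsilon> ?P) 1 \<in> ?B"
    using B by (auto simp: subalgebra_def subspace_scale)
  from subspace_diff[OF B(2) this diff] have "scale (\<epsilon> ?P) 1 - (scale (\<epsilon> ?P) 1 - S ?P) \<in> ?B" .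
  then show ?case by simp
qed

lemma generated_subalgebra_words:
  "generated_subalgebra A \<subseteq> span {prod_list xs |xs. set xs \<subseteq> A}"
proof (rule generated_subalgebra_least)
  let ?W = "{prod_list xs |xs. set xs \<subseteq> A}"
  have word: "prod_list xs \<in> span ?W" if "set xs \<subseteq> A" for xs
    using that by (intro span_base) blast
  show "subalgebra (span ?W)"
    unfolding subalgebra_def
  proof (intro conjI ballI)
    show "1 \<in> span ?W" using word[of "[]"] by simp
    fix x y assume "x \<in> span ?W" "y \<in> span ?W"
    then show "x * y \<in> span ?W"
    proof (rule span_mult)
      fix a b assume "a \<in> ?W" "b \<in> ?W"
      then obtain xs ys where "a = prod_list xs" "set xs \<subseteq> A" "b = prod_list ys" "set ys \<subseteq> A" by blast
      then show "a * b \<in> span ?W" using word[of "xs @ ys"] by simp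
    qed simp
  qed simp
  show "A \<subseteq> span ?W"
  proof
    fix a assume "a \<in> A"
    then show "a \<in> span ?W" using word[of "[a]"] by simp
  qed
qed

text \<open>This makes the generated algebra one of the sets intersected in \<open>U_H\<close>, so
  that cocommutativity of \<open>U_H\<close> need only be checked on primitive elements.\<close>

lemma hopf_subalgebra_generated: "hopf_subalgebra (generated_subalgebra primitives)"
proof -
  let ?B = "generated_subalgebra primitives"
  have B: "subalgebra ?B" "subspace ?B" "primitives \<subseteq> ?B" "1 \<in> ?B"
    using generated_subalgebra_closed[of primitives] by (auto simp: subalgebra_def)
  have "subalgebra {h. cm h \<in> tensor_span ?B ?B}"
    unfolding subalgebra_def
  proof (intro conjI ballI subspaceI; unfold mem_Collect_eq)
    show "cm 1 \<in> tensor_span ?B ?B" using B by (simp add: cm_one tn_tensor_span)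
    fix g h assume "cm g \<in> tensor_span ?B ?B" "cm h \<in> tensor_span ?B ?B"
    then show "cm (g * h) \<in> tensor_span ?B ?B"
      unfolding cm_mult by (rule tensor_span_mult) (use B(1) in \<open>auto intro: tn_tensor_span simp: subalgebra_def\<close>)
  qed (simp_all add: cm.add cm.scale endo.subspace_0 endo.subspace_add endo.subspace_scale)
  moreover have "primitives \<subseteq> {h. cm h \<in> tensor_span ?B ?B}"
    using B by (auto simp: cm_primitive pr_def intro!: endo.subspace_add tn_tensor_span)
  ultimately have "?B \<subseteq> {h. cm h \<in> tensor_span ?B ?B}" by (rule generated_subalgebra_least)
  then have "\<Delta> ` ?B \<subseteq> tensor_sub ?B ?B"
    by (auto simp: tensor_sub_iff comult_tensor cm_def)
  moreover have "S h \<in> ?B" if "h \<in> ?B" for h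
    by (rule linear_span_in_subspace[OF linear_S subsetD[OF generated_subalgebra_words that] B(2)])
      (use antipode_word in blast)
  ultimately show ?thesis using B by (auto simp: hopf_subalgebra_def)
qed

lemma U_H_subset: "U_H \<subseteq> generated_subalgebra primitives"
  unfolding U_H_def using hopf_subalgebra_generated generated_subalgebra_closed(2) by blast

lemma cocommutative_generated:
  assumes "h \<in> generated_subalgebra primitives" shows "tw (cm h) = cm h"
proof -
  interpret t: Vector_Spaces.linear endo_scale endo_scale tw by (rule linear_tw)
  have "subalgebra {h. tw (cm h) = cm h}"
    unfolding subalgebra_def
    by (auto intro!: subspaceI simp: cm.add cm.scale t.add t.scale cm_one tw_tn cm_mult tw_mult)
  moreover have "primitives \<subseteq> {h. tw (cm h) = cm h}" by (auto simp: cm_primitive tw_pr)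
  ultimately show ?thesis using generated_subalgebra_least assms by blast
qed

end

section \<open>Consequences of normality\<close>

locale normal_hopf_algebra = hopf_algebra scale \<Delta> \<epsilon> S
  for scale :: "'k::field_char_0 \<Rightarrow> 'h::ring_1 \<Rightarrow> 'h" and \<Delta> \<epsilon> S +
  assumes normal: "normal_hopf_subalgebra U_H"
begin

lemma endo_double_eq_0: "r + r = 0 \<Longrightarrow> r = (0 :: ('h \<times> 'h, 'k) endo)"
proof -
  assume "r + r = 0"
  then have "endo_scale (1 + 1) r = 0" by (simp only: endo.scale_left_distrib endo.scale_one)
  then show ?thesis by simp
qed

text \<open>Here \<open>dl c\<close> is symmetric by cocommutativity and antisymmetric by the
  definition of \<open>P2\<close>, so twice it is 0.\<close>

lemma U_H_P2:
  assumes "c \<in> U_H" "c \<in> P2" shows "c \<in> primitives"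
proof -
  interpret t: Vector_Spaces.linear endo_scale endo_scale tw by (rule linear_tw)
  have "tw (dl c) = dl c"
    using cocommutative_generated[of c] assms(1) U_H_subset by (auto simp: dl_def t.diff tw_pr)
  with assms(2) have "dl c + dl c = 0" by (simp add: P2_iff eq_neg_iff_add_eq_0)
  from endo_double_eq_0[OF this] show ?thesis by (simp add: primitives_iff)
qed

lemma U_H: "subalgebra U_H" "subspace U_H" "S ` U_H \<subseteq> U_H" "primitives \<subseteq> U_H"
  using normal unfolding normal_hopf_subalgebra_def hopf_subalgebra_def subalgebra_def
  by (auto simp: U_H_def)

text \<open>The antipode axiom gives \<open>S c\<close> as \<open>- c\<close> plus terms in
  \<open>U_H\<close>. Hence \<open>ad_left c x\<close>, which lies in \<open>U_H\<close> by
  normality, differs from the commutator only by products of elements of \<open>U_H\<close>.\<close>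

lemma P2_primitive_commutator:
  assumes c: "c \<in> P2" and x: "x \<in> primitives"
  shows "c * x - x * c \<in> primitives"
proof (rule U_H_P2)
  let ?f = "\<lambda>a b. a * x * S b" and ?g = "\<lambda>a b. a * S b"
  have mult: "a * b \<in> U_H" if "a \<in> U_H" "b \<in> U_H" for a b using U_H(1) that by (auto simp: subalgebra_def)
  have prim: "a \<in> U_H" "S a \<in> U_H" if "a \<in> primitives" for a using U_H that by auto
  have linf: "Vector_Spaces.linear endo_scale scale (lift scale ?f)"
    and ling: "Vector_Spaces.linear endo_scale scale (lift scale ?g)"
    by (rule linear_lift, rule vector_space_axioms)+
  interpret f: Vector_Spaces.linear endo_scale scale "lift scale ?f" by (rule linf)
  interpret g: Vector_Spaces.linear endo_scale scale "lift scale ?g" by (rule ling)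
  have dlc: "dl c \<in> tensor_span primitives primitives" using c by (simp add: P2_iff)
  have F: "lift scale ?f (dl c) \<in> U_H"
    by (rule tensor_span_linear[OF linf dlc U_H(2)])
      (simp add: lift_tn[OF bilinear_antipode(3,4)] mult prim x)
  have G: "lift scale ?g (dl c) \<in> U_H"
    by (rule tensor_span_linear[OF ling dlc U_H(2)])
      (simp add: lift_tn[OF bilinear_antipode(5,6)] mult prim)
  have "ad_left c x \<in> U_H"
    using normal prim[OF x] by (auto simp: normal_hopf_subalgebra_def)
  moreover have "ad_left c x = c * x + x * S c + lift scale ?f (dl c)"
    by (simp add: ad_left_def tensor_lift_emb[OF bilinear_antipode(3,4)] cm_def[symmetric] cm_eq pr_def
        f.add lift_tn[OF bilinear_antipode(3,4)] S_one)
  moreover have "scale (\<epsilon> c) 1 = c + S c + lift scale ?g (dl c)"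
    unfolding antipode_lift_right[symmetric]
    by (simp add: cm_eq pr_def g.add lift_tn[OF bilinear_antipode(5,6)] S_one)
  then have Sc: "S c = scale (\<epsilon> c) 1 - c - lift scale ?g (dl c)" by (simp add: algebra_simps)
  ultimately have "c * x - x * c + scale (\<epsilon> c) x - x * lift scale ?g (dl c) + lift scale ?f (dl c) \<in> U_H"
    by (simp add: Sc right_diff_distrib scale_mult_right algebra_simps)
  moreover have "scale (\<epsilon> c) x - x * lift scale ?g (dl c) + lift scale ?f (dl c) \<in> U_H"
    by (rule subspace_add[OF U_H(2) subspace_diff[OF U_H(2) subspace_scale[OF U_H(2) prim(1)[OF x]]
          mult[OF prim(1)[OF x] G]] F])
  ultimately have "(c * x - x * c + scale (\<epsilon> c) x - x * lift scale ?g (dl c) + lift scale ?f (dl c))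
     - (scale (\<epsilon> c) x - x * lift scale ?g (dl c) + lift scale ?f (dl c)) \<in> U_H"
    by (rule subspace_diff[OF U_H(2)])
  then show "c * x - x * c \<in> U_H" by simp
  show "c * x - x * c \<in> P2" by (rule P2_commutator_primitive[OF c x])
qed

lemma dl_invariant:
  assumes "c \<in> P2" "x \<in> primitives"
  shows "dl c * pr x - pr x * dl c = 0"
  using P2_primitive_commutator[OF assms] P2_commutator_primitive(2)[OF assms] by (simp add: primitives_iff)

end

section \<open>Trilinear maps and the commutator of two elements of \<open>P2\<close>\<close>

context k_algebra
begin

definition trilinear :: "('k \<Rightarrow> 'w \<Rightarrow> 'w) \<Rightarrow> ('h \<Rightarrow> 'h \<Rightarrow> 'h \<Rightarrow> 'w::ab_group_add) \<Rightarrow> bool" where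
  "trilinear s F \<longleftrightarrow> (\<forall>y z. Vector_Spaces.linear scale s (\<lambda>x. F x y z)) \<and>
     (\<forall>x z. Vector_Spaces.linear scale s (\<lambda>y. F x y z)) \<and> (\<forall>x y. Vector_Spaces.linear scale s (F x y))"

lemma trilinear_permute:
  "trilinear s F \<Longrightarrow> trilinear s (\<lambda>x y z. F y x z)" "trilinear s F \<Longrightarrow> trilinear s (\<lambda>x y z. F z y x)"
  by (simp_all add: trilinear_def)

lemma trilinear_tn:
  "trilinear endo_scale (\<lambda>x y z. tn x (y * z))" "trilinear endo_scale (\<lambda>x y z. tn (y * z) x)"
  by (simp_all add: trilinear_def Vector_Spaces.linear_iff vector_space_axioms endo.vector_space_axioms
      tnl.add tnl.scale tnr.add tnr.scale distrib_left distrib_right scale_mult_left scale_mult_right)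

end

context hopf_algebra
begin

lemma dl_triple:
  assumes "p \<in> primitives" "q \<in> primitives" "r \<in> primitives"
  shows "dl (p * q * r) = tn p (q * r) + tn q (p * r) + tn r (p * q) + tn (q * r) p + tn (p * r) q + tn (p * q) r"
  by (simp add: dl_def cm_mult cm_primitive assms pr_def distrib_left distrib_right tn_mult)

text \<open>Antisymmetry as an equality of two sums over the same index set, the shape that
  \<open>lift_sum_eq\<close> requires.\<close>

lemma P2_antisymmetric:
  assumes "c \<in> P2" "dl c = (\<Sum>i\<in>I. tn (a i) (b i))"
  shows "(\<Sum>i\<in>I. tn (a i) (b i)) = (\<Sum>i\<in>I. tn (- b i) (a i))"
proof -
  interpret t: Vector_Spaces.linear endo_scale endo_scale tw by (rule linear_tw)
  have "tw (dl c) = - dl c" using assms(1) by (simp add: P2_iff)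
  then have "dl c = - tw (dl c)" by simp
  also have "\<dots> = (\<Sum>i\<in>I. tn (- b i) (a i))"
    by (simp add: assms(2) t.sum tw_tn tnl.neg sum_negf)
  finally show ?thesis using assms(2) by simp
qed

end

context normal_hopf_algebra
begin

text \<open>Invariance says that bracketing the left and the right factors with \<open>x\<close>
  gives opposite sums; antisymmetry rewrites the second one with the bracket on \<open>a i\<close>
  again.\<close>

lemma bracket_symmetric:
  assumes c: "c \<in> P2" "dl c = (\<Sum>i\<in>I. tn (a i) (b i))" and x: "x \<in> primitives"
  shows "(\<Sum>i\<in>I. tn (a i * x - x * a i) (b i)) = (\<Sum>i\<in>I. tn (b i) (a i * x - x * a i))"
proof -
  have "0 = (\<Sum>i\<in>I. tn (a i) (b i) * pr x - pr x * tn (a i) (b i))"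
    using dl_invariant[OF c(1) x] by (simp add: c(2) sum_distrib_left sum_distrib_right sum_subtractf)
  also have "\<dots> = (\<Sum>i\<in>I. tn (a i * x - x * a i) (b i)) + (\<Sum>i\<in>I. tn (a i) (b i * x - x * b i))"
    by (simp add: tn_commutator_pr sum.distrib)
  also have "(\<Sum>i\<in>I. tn (a i) (b i * x - x * b i)) = (\<Sum>i\<in>I. tn (- b i) (a i * x - x * a i))"
  proof (rule lift_sum_eq[where s = endo_scale and f = "\<lambda>a b. tn a (b * x - x * b)"])
    show "(\<Sum>i\<in>I. tn (a i) (b i)) = (\<Sum>i\<in>I. tn (- b i) (a i))" by (rule P2_antisymmetric[OF c])
  qed (simp_all add: Vector_Spaces.linear_iff vector_space_axioms endo.vector_space_axioms
      tnl.add tnl.scale tnr.add tnr.scale tnr.diff distrib_left distrib_right scale_mult_left scale_mult_right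
      endo.scale_right_diff_distrib)
  finally show ?thesis by (simp add: tnl.neg sum_negf eq_neg_iff_add_eq_0)
qed

text \<open>The invariance of \<open>dl c\<close> and \<open>dl c'\<close> makes the tensor \<open>\<Sum> [a\<^sub>i, x\<^sub>j] \<otimes> b\<^sub>i \<otimes> y\<^sub>j\<close> totally symmetric,
  so that the commutator of \<open>dl c\<close> and \<open>dl c'\<close> is the coboundary of a third of its product.\<close>

lemma dl_commutator_P2:
  assumes c: "c \<in> P2" and c': "c' \<in> P2"
  shows "\<exists>u\<in>span {x * y * z |x y z. x \<in> primitives \<and> y \<in> primitives \<and> z \<in> primitives}.
    dl c * dl c' - dl c' * dl c = dl u"
proof -
  have ts: "dl c \<in> tensor_span primitives primitives" "dl c' \<in> tensor_span primitives primitives"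
    using c c' by (auto simp: P2_iff)
  from tensor_span_sum[OF subspace_primitives ts(1)] obtain n :: nat and a b where
    ab: "\<And>i. i < n \<Longrightarrow> a i \<in> primitives" "\<And>i. i < n \<Longrightarrow> b i \<in> primitives" "dl c = (\<Sum>i<n. tn (a i) (b i))"
    by metis
  from tensor_span_sum[OF subspace_primitives ts(2)] obtain m :: nat and x y where
    xy: "\<And>j. j < m \<Longrightarrow> x j \<in> primitives" "\<And>j. j < m \<Longrightarrow> y j \<in> primitives" "dl c' = (\<Sum>j<m. tn (x j) (y j))"
    by metis
  define p where "p i j = a i * x j - x j * a i" for i j
  have p: "p i j \<in> primitives" if "i < n" "j < m" for i j
    unfolding p_def using that ab xy by (intro primitives_commutator) auto
  have s1: "(\<Sum>i<n. tn (p i j) (b i)) = (\<Sum>i<n. tn (b i) (p i j))" if "j < m" for j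
    unfolding p_def using bracket_symmetric[OF c ab(3) xy(1)[OF that]] .
  \<comment> \<open>Here the bracket is \<open>[x j, a i] = - p i j\<close>; the sign occurs on both
    sides.\<close>
  have s2: "(\<Sum>j<m. tn (p i j) (y j)) = (\<Sum>j<m. tn (y j) (p i j))" if "i < n" for i
  proof -
    have "(\<Sum>j<m. tn (- p i j) (y j)) = (\<Sum>j<m. tn (y j) (- p i j))"
      using bracket_symmetric[OF c' xy(3) ab(1)[OF that]] by (simp add: p_def)
    then show ?thesis by (simp add: tnl.neg tnr.neg sum_negf)
  qed
  \<comment> \<open>\<open>s1\<close> with \<open>j\<close> fixed exchanges the first two factors,
    \<open>s2\<close> with \<open>i\<close> fixed the first and the third. These transpositions
    generate all permutations.\<close>
  have sw12: "(\<Sum>i<n. \<Sum>j<m. F (p i j) (b i) (y j)) = (\<Sum>i<n. \<Sum>j<m. F (b i) (p i j) (y j))"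
    if "trilinear endo_scale F" for F
  proof -
    have "(\<Sum>i<n. F (p i j) (b i) (y j)) = (\<Sum>i<n. F (b i) (p i j) (y j))" if "j < m" for j
      by (rule lift_sum_eq[where f = "\<lambda>u v. F u v (y j)" and s = endo_scale, OF _ _ s1[OF that]])
        (use \<open>trilinear endo_scale F\<close> in \<open>simp_all add: trilinear_def\<close>)
    then show ?thesis by (subst (1 2) sum.swap) simp
  qed
  have sw13: "(\<Sum>i<n. \<Sum>j<m. F (p i j) (b i) (y j)) = (\<Sum>i<n. \<Sum>j<m. F (y j) (b i) (p i j))"
    if "trilinear endo_scale F" for F
  proof (rule sum.cong)
    fix i assume "i \<in> {..<n}"
    then have "i < n" by simp
    show "(\<Sum>j<m. F (p i j) (b i) (y j)) = (\<Sum>j<m. F (y j) (b i) (p i j))"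
      by (rule lift_sum_eq[where f = "\<lambda>u v. F u (b i) v" and s = endo_scale, OF _ _ s2[OF \<open>i < n\<close>]])
        (use \<open>trilinear endo_scale F\<close> in \<open>simp_all add: trilinear_def\<close>)
  qed simp
  \<comment> \<open>The value of a trilinear \<open>F\<close> on the sum of all
    \<open>p i j \<otimes> b i \<otimes> y j\<close>; working with such values avoids threefold
    tensors.\<close>
  define Sm where "Sm F = (\<Sum>i<n. \<Sum>j<m. F (p i j) (b i) (y j))" for F :: "'h \<Rightarrow> 'h \<Rightarrow> 'h \<Rightarrow> ('h \<times> 'h, 'k) endo"
  have swap: "Sm (\<lambda>u v w. F v u w) = Sm F" "Sm (\<lambda>u v w. F w v u) = Sm F" if "trilinear endo_scale F" for F
    using sw12[OF that] sw13[OF that] by (simp_all add: Sm_def)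
  have perms: "Sm (\<lambda>u v w. F v u w) = Sm F" "Sm (\<lambda>u v w. F w u v) = Sm F" "Sm (\<lambda>u v w. F u w v) = Sm F"
    if F: "trilinear endo_scale F" for F
  proof -
    note F' = trilinear_permute[OF F]
    show "Sm (\<lambda>u v w. F v u w) = Sm F" by (rule swap(1)[OF F])
    show "Sm (\<lambda>u v w. F w u v) = Sm F" using swap(1)[OF F'(2)] swap(2)[OF F] by simp
    show "Sm (\<lambda>u v w. F u w v) = Sm F"
      using swap(2)[OF trilinear_permute(1)[OF F'(2)]] swap(1)[OF F'(2)] swap(2)[OF F] by simp
  qed
  note Sm_add = Sm_def sum.distrib
  let ?L = "\<lambda>u v w. tn u (v * w)" and ?R = "\<lambda>u v w. tn (v * w) u"
  define A where "A = Sm ?L + Sm ?R"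
  define U where "U = (\<Sum>i<n. \<Sum>j<m. p i j * b i * y j)"
  have "dl U = (\<Sum>i<n. \<Sum>j<m. dl (p i j * b i * y j))" by (simp add: U_def dl.sum)
  also have "\<dots> = Sm (\<lambda>u v w. ?L u v w + ?L v u w + ?L w u v + ?R u v w + ?R v u w + ?R w u v)"
    unfolding Sm_def using ab xy p by (intro sum.cong) (auto simp: dl_triple)
  also have "\<dots> = Sm ?L + Sm (\<lambda>u v w. ?L v u w) + Sm (\<lambda>u v w. ?L w u v)
    + Sm ?R + Sm (\<lambda>u v w. ?R v u w) + Sm (\<lambda>u v w. ?R w u v)"
    by (simp only: Sm_add)
  \<comment> \<open>By total symmetry the three terms of shape \<open>?L\<close> have equal sums,
    and so have those of shape \<open>?R\<close>; this is the origin of the third.\<close>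
  also have "\<dots> = A + A + A"
    unfolding perms(1,2)[OF trilinear_tn(1)] perms(1,2)[OF trilinear_tn(2)] by (simp add: A_def)
  finally have dlU: "dl U = A + A + A" .
  let ?K = "dl c * dl c' - dl c' * dl c"
  have K: "?K = (\<Sum>i<n. \<Sum>j<m. tn (a i * x j) (b i * y j) - tn (x j * a i) (y j * b i))"
  proof -
    have "dl c' * dl c = (\<Sum>i<n. \<Sum>j<m. tn (x j * a i) (y j * b i))"
      unfolding ab(3) xy(3) sum_product tn_mult by (rule sum.swap)
    then show ?thesis
      by (simp add: ab(3) xy(3) sum_product tn_mult sum_subtractf)
  qed
  \<comment> \<open>Termwise, \<open>2 (a x \<otimes> b y - x a \<otimes> y b) = [a, x] \<otimes> (b
    y + y b) + (a x + x a) \<otimes> [b, y]\<close>.\<close>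
  have "?K + ?K = (\<Sum>i<n. \<Sum>j<m. tn (p i j) (b i * y j + y j * b i))
    + (\<Sum>i<n. \<Sum>j<m. tn (a i * x j + x j * a i) (b i * y j - y j * b i))"
    unfolding K sum.distrib[symmetric]
    by (intro sum.cong refl) (simp add: p_def tnl.add tnl.diff tnr.add tnr.diff)
  \<comment> \<open>Antisymmetry of \<open>dl c\<close> and of \<open>dl c'\<close> exchanges
    \<open>a\<close> with \<open>b\<close> and \<open>x\<close> with \<open>y\<close>; the two signs
    cancel.\<close>
  also have "(\<Sum>i<n. \<Sum>j<m. tn (a i * x j + x j * a i) (b i * y j - y j * b i))
    = (\<Sum>i<n. \<Sum>j<m. tn (b i * y j + y j * b i) (p i j))"
  proof -
    note lin = Vector_Spaces.linear_iff vector_space_axioms endo.vector_space_axioms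
      tnl.add tnl.diff tnl.scale tnr.add tnr.scale tnr.diff distrib_left distrib_right scale_mult_left scale_mult_right
      endo.scale_right_diff_distrib endo.scale_right_distrib
    have 1: "(\<Sum>i<n. tn (a i * x j + x j * a i) (b i * y j - y j * b i))
      = (\<Sum>i<n. tn (- b i * x j + x j * - b i) (a i * y j - y j * a i))" for j
      by (rule lift_sum_eq[where f = "\<lambda>a b. tn (a * x j + x j * a) (b * y j - y j * b)" and s = endo_scale,
            OF _ _ P2_antisymmetric[OF c ab(3)]]) (simp_all add: lin)
    have 2: "(\<Sum>j<m. tn (B * x j + x j * B) (A * y j - y j * A))
      = (\<Sum>j<m. tn (B * - y j + - y j * B) (A * x j - x j * A))" for A B
      by (rule lift_sum_eq[where f = "\<lambda>x y. tn (B * x + x * B) (A * y - y * A)" and s = endo_scale,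
            OF _ _ P2_antisymmetric[OF c' xy(3)]]) (simp_all add: lin)
    have "(\<Sum>i<n. \<Sum>j<m. tn (a i * x j + x j * a i) (b i * y j - y j * b i))
      = (\<Sum>i<n. \<Sum>j<m. tn (- b i * x j + x j * - b i) (a i * y j - y j * a i))"
      by (subst (1 2) sum.swap) (simp only: 1)
    also have "\<dots> = (\<Sum>i<n. \<Sum>j<m. tn (- b i * - y j + - y j * - b i) (a i * x j - x j * a i))"
      by (simp only: 2)
    finally show ?thesis by (simp add: p_def)
  qed
  also have "(\<Sum>i<n. \<Sum>j<m. tn (p i j) (b i * y j + y j * b i)) = Sm ?L + Sm (\<lambda>u v w. ?L u w v)"
    by (simp add: Sm_def sum.distrib tnr.add)
  also have "(\<Sum>i<n. \<Sum>j<m. tn (b i * y j + y j * b i) (p i j)) = Sm ?R + Sm (\<lambda>u v w. ?R u w v)"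
    by (simp add: Sm_def sum.distrib tnl.add)
  finally have "?K + ?K = A + A"
    unfolding perms(3)[OF trilinear_tn(1)] perms(3)[OF trilinear_tn(2)] by (simp add: A_def algebra_simps)
  then have "(?K - A) + (?K - A) = 0" by (simp add: algebra_simps)
  from endo_double_eq_0[OF this] have KA: "?K = A" by simp
  have "dl (scale (1 / 3) U) = endo_scale (1 / 3) (endo_scale 3 A)"
  proof -
    have "endo_scale 3 A = endo_scale (1 + 1 + 1) A" by simp
    also have "\<dots> = A + A + A" by (simp only: endo.scale_left_distrib endo.scale_one)
    finally show ?thesis by (simp add: dl.scale dlU)
  qed
  then have "?K = dl (scale (1 / 3) U)" by (simp add: KA)
  moreover have "scale (1 / 3) U \<in> span {x * y * z |x y z. x \<in> primitives \<and> y \<in> primitives \<and> z \<in> primitives}"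
    unfolding U_def
  proof (intro span_scale span_sum span_base)
    fix i j assume "i \<in> {..<n}" "j \<in> {..<m}"
    then have "p i j \<in> primitives" "b i \<in> primitives" "y j \<in> primitives" using p ab xy by auto
    then show "p i j * b i * y j \<in> {x * y * z |x y z. x \<in> primitives \<and> y \<in> primitives \<and> z \<in> primitives}" by blast
  qed
  ultimately show ?thesis by blast
qed

text \<open>The cubic \<open>u\<close> removes the product part of \<open>dl_commutator\<close>.
  What is left are the actions of \<open>c'\<close> on \<open>dl c\<close> and of \<open>c\<close>
  on \<open>dl c'\<close>; they stay antisymmetric and among tensors of primitive elements, because
  commutators with \<open>P2\<close> preserve the primitive elements.\<close>

lemma P2_commutator:
  assumes c: "c \<in> P2" and c': "c' \<in> P2"
  shows "\<exists>u\<in>span {x * y * z |x y z. x \<in> primitives \<and> y \<in> primitives \<and> z \<in> primitives}.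
    c * c' - c' * c - u \<in> P2"
proof -
  from dl_commutator_P2[OF assms] obtain u where
    u: "u \<in> span {x * y * z |x y z. x \<in> primitives \<and> y \<in> primitives \<and> z \<in> primitives}"
    "dl c * dl c' - dl c' * dl c = dl u" by blast
  interpret t: Vector_Spaces.linear endo_scale endo_scale tw by (rule linear_tw)
  have stable: "a * d - d * a \<in> primitives" if "a \<in> primitives" "d \<in> P2" for a d
    using subspace_neg[OF subspace_primitives P2_primitive_commutator[OF that(2,1)]] by simp
  have in_P2: "dl d * pr e - pr e * dl d \<in> tensor_span primitives primitives"
    "tw (dl d * pr e - pr e * dl d) = - (dl d * pr e - pr e * dl d)" if "d \<in> P2" "e \<in> P2" for d e
    using that commutator_pr_tensor_span[of "dl d" primitives e] stable tw_commutator_pr[OF dl_P2, of d e]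
    by (auto simp: P2_iff)
  have "dl (c * c' - c' * c - u) = (dl c * pr c' - pr c' * dl c) - (dl c' * pr c - pr c * dl c')"
    using u(2) by (simp add: dl.diff[of _ u] dl_commutator)
  then have "c * c' - c' * c - u \<in> P2"
    unfolding P2_iff using in_P2[OF c c'] in_P2[OF c' c]
    by (auto simp: t.diff endo.subspace_diff)
  with u(1) show ?thesis by blast
qed

end

section \<open>The weight filtration of a Hopf algebra\<close>

context hopf_algebra
begin

lemma coradical_filtration_SucI:
  assumes "cm h = r + s" "r \<in> tensor_span UNIV (coradical_filtration n)" "s \<in> tensor_span coradical UNIV"
  shows "h \<in> coradical_filtration (Suc n)"
proof -
  from assms(2,3) obtain u v where u: "r = tens u" "Poly_Mapping.keys u \<subseteq> UNIV \<times> coradical_filtration n"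
    and v: "s = tens v" "Poly_Mapping.keys v \<subseteq> coradical \<times> UNIV"
    unfolding tensor_span_eq by blast
  have "\<Delta> h = tensor_add (tensor_class u) (tensor_class v)"
    using assms(1) u(1) v(1) by (subst emb_eq_iff[symmetric]) (simp_all add: comult_tensor emb_add emb_class cm_def)
  then show ?thesis using u(2) v(2) by (auto simp: tensor_sub_def)
qed

text \<open>This lets local finiteness bound the dimension of \<open>P2\<close>. The coradical
  contains 1 and takes up \<open>1 \<otimes> c\<close>; in the remaining terms the right factors are
  1 or primitive, hence in level 1.\<close>

lemma P2_coradical_filtration:
  assumes "connected" shows "P2 \<subseteq> coradical_filtration (Suc (Suc 0))"
proof -
  have "scale 1 1 \<in> range (\<lambda>c. scale c 1)" by blast
  then have one: "1 \<in> coradical" using assms unfolding connected_def by simp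
  have one1: "1 \<in> coradical_filtration (Suc 0)"
    by (rule coradical_filtration_SucI[of 1 "tn 1 1" 0])
      (simp_all add: cm_one tn_tensor_span one endo.subspace_0)
  have prim: "x \<in> coradical_filtration (Suc 0)" if "x \<in> primitives" for x
    by (rule coradical_filtration_SucI[of x "tn x 1" "tn 1 x"])
      (simp_all add: cm_primitive that pr_def tn_tensor_span one)
  show ?thesis
  proof
    fix c assume "c \<in> P2"
    then have "dl c \<in> tensor_span UNIV (coradical_filtration (Suc 0))"
      using tensor_span_mono[of "dl c" primitives primitives UNIV "coradical_filtration (Suc 0)"] prim
      by (auto simp: P2_iff)
    then have "tn c 1 + dl c \<in> tensor_span UNIV (coradical_filtration (Suc 0))"
      by (intro endo.subspace_add subspace_tensor_span tn_tensor_span one1) auto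
    moreover have "tn 1 c \<in> tensor_span coradical UNIV" by (simp add: tn_tensor_span one)
    ultimately show "c \<in> coradical_filtration (Suc (Suc 0))"
      by (rule coradical_filtration_SucI[rotated]) (simp add: cm_eq pr_def)
  qed
qed

lemma fin_dim_P2:
  assumes "connected" "locally_finite" obtains B where "finite B" "P2 \<subseteq> span B"
  using assms P2_coradical_filtration unfolding locally_finite_def fin_dim_def by metis

end

section \<open>Generators of weight 2 and 1, and the comultiplication on the filtration\<close>

locale P2_basis = normal_hopf_algebra scale \<Delta> \<epsilon> S
  for scale :: "'k::field_char_0 \<Rightarrow> 'h::ring_1 \<Rightarrow> 'h" and \<Delta> \<epsilon> S +
  fixes y :: "nat \<Rightarrow> 'h" and e m :: nat
  assumes e_le: "e \<le> m"
    and inj_y: "inj_on y {..<m}"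
    and independent_y: "independent (y ` {..<m})"
    and span_P2: "span (y ` {..<m}) = P2"
    and span_primitives: "span (y ` {e..<m}) = primitives"
    and generated_P2: "generated_subalgebra P2 = UNIV"
begin

definition wt :: "nat \<Rightarrow> nat" where
  "wt v = (if v < e then 2 else 1)"

sublocale weighted_generators scale m y wt
  by unfold_locales (simp add: wt_def)

lemma y_P2: "v < m \<Longrightarrow> y v \<in> P2"
  unfolding span_P2[symmetric] by (rule span_base) simp

lemma y_primitive: "e \<le> v \<Longrightarrow> v < m \<Longrightarrow> y v \<in> primitives"
  unfolding span_primitives[symmetric] by (rule span_base) simp

lemma primitives_filt: "x \<in> primitives \<Longrightarrow> 1 \<le> n \<Longrightarrow> x \<in> filt n"
proof -
  assume x: "x \<in> primitives" and n: "1 \<le> n"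
  have "y v \<in> filt 1" if "v \<in> {e..<m}" for v
    using filt_gen[of v] that by (simp add: wt_def)
  then have "span (y ` {e..<m}) \<subseteq> filt 1" by (intro span_minimal) auto
  with x have "x \<in> filt 1" unfolding span_primitives by blast
  then show "x \<in> filt n" using n by (rule filt_mono)
qed

lemma P2_filt: "x \<in> P2 \<Longrightarrow> 2 \<le> n \<Longrightarrow> x \<in> filt n"
proof -
  assume x: "x \<in> P2" and n: "2 \<le> n"
  have "y v \<in> filt 2" if "v < m" for v
    by (rule filt_mono[OF filt_gen[OF that]]) (simp add: wt_def)
  then have "span (y ` {..<m}) \<subseteq> filt 2" by (intro span_minimal) auto
  with x have "x \<in> filt 2" unfolding span_P2 by blast
  then show "x \<in> filt n" using n by (rule filt_mono)
qed

text \<open>Two generators of weight 2 commute up to \<open>P2\<close> and cubic terms, of weight at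
  most 3; a commutator with a primitive generator is primitive, of weight 1.\<close>

lemma y_commutator:
  assumes u: "u < m" and v: "v < m"
  shows "y u * y v - y v * y u \<in> filt (int (wt u) + int (wt v) - 1)"
proof (cases "u < e \<and> v < e")
  case True
  from P2_commutator[OF y_P2[OF u] y_P2[OF v]] obtain z where
    z: "z \<in> span {x * y * z |x y z. x \<in> primitives \<and> y \<in> primitives \<and> z \<in> primitives}"
      "y u * y v - y v * y u - z \<in> P2" by blast
  have "{x * y * z |x y z. x \<in> primitives \<and> y \<in> primitives \<and> z \<in> primitives} \<subseteq> filt 3"
  proof clarify
    fix a b c assume "a \<in> primitives" "b \<in> primitives" "c \<in> primitives"
    then have "a * b * c \<in> filt (1 + 1 + 1)" by (intro filt_mult primitives_filt) auto
    then show "a * b * c \<in> filt 3" by simp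
  qed
  with z(1) have "z \<in> filt 3" using span_minimal[OF _ subspace_filt] by blast
  with P2_filt[OF z(2), of 3] have "y u * y v - y v * y u - z + z \<in> filt 3" by (intro filt_closed(2)) auto
  with True show ?thesis by (simp add: wt_def)
next
  case False
  then consider "e \<le> u" | "e \<le> v" by linarith
  then have "y u * y v - y v * y u \<in> primitives"
  proof cases
    case 1
    from P2_primitive_commutator[OF y_P2[OF v] y_primitive[OF 1 u]]
    show ?thesis using subspace_neg[OF subspace_primitives] by force
  next
    case 2
    from P2_primitive_commutator[OF y_P2[OF u] y_primitive[OF 2 v]] show ?thesis .
  qed
  then show ?thesis by (rule primitives_filt) (simp add: wt_def)
qed

lemma generate_y: "generated_subalgebra (y ` {..<m}) = UNIV"
proof -
  note B = generated_subalgebra_closed[of "y ` {..<m}"]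
  have "P2 \<subseteq> generated_subalgebra (y ` {..<m})"
    unfolding span_P2[symmetric] using B by (intro span_minimal) (auto simp: subalgebra_def)
  from generated_subalgebra_least[OF B(1) this] show ?thesis unfolding generated_P2 by blast
qed

text \<open>Contraction of the left factor with a functional vanishing at 1 maps \<open>leading n\<close> to \<open>filt (n - 1)\<close>, and
  the terms with arbitrary left factor do not contribute modulo \<open>filt (n - 2)\<close>.\<close>

definition leading :: "int \<Rightarrow> ('h \<times> 'h, 'k) endo set" where
  "leading n = endo.span {tn a b |a b. b \<in> filt n \<and>
     (a = 1 \<or> a \<in> primitives \<and> b \<in> filt (n - 1) \<or> b \<in> filt (n - 2))}"

lemma leadingI:
  "b \<in> filt n \<Longrightarrow> tn 1 b \<in> leading n"
  "a \<in> primitives \<Longrightarrow> b \<in> filt (n - 1) \<Longrightarrow> tn a b \<in> leading n"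
  "b \<in> filt (n - 2) \<Longrightarrow> tn a b \<in> leading n"
proof -
  have "b \<in> filt n" if "b \<in> filt (n - 1) \<or> b \<in> filt (n - 2)"
    using that by (auto intro: filt_mono)
  then show "b \<in> filt n \<Longrightarrow> tn 1 b \<in> leading n"
    "a \<in> primitives \<Longrightarrow> b \<in> filt (n - 1) \<Longrightarrow> tn a b \<in> leading n"
    "b \<in> filt (n - 2) \<Longrightarrow> tn a b \<in> leading n"
    unfolding leading_def by (intro endo.span_base; blast)+
qed

lemma subspace_leading [simp]: "endo.subspace (leading n)"
  by (simp add: leading_def)

lemma leading_mono: "r \<in> leading p \<Longrightarrow> p \<le> q \<Longrightarrow> r \<in> leading q"
proof -
  assume r: "r \<in> leading p" and pq: "p \<le> q"
  have "leading p \<subseteq> leading q"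
    unfolding leading_def[of p]
  proof (rule endo.span_minimal, clarify)
    fix a b
    assume b: "b \<in> filt p" "a = 1 \<or> a \<in> primitives \<and> b \<in> filt (p - 1) \<or> b \<in> filt (p - 2)"
    have "b \<in> filt i \<Longrightarrow> i \<le> j \<Longrightarrow> b \<in> filt j" for i j by (rule filt_mono)
    from this[of p q] this[of "p - 1" "q - 1"] this[of "p - 2" "q - 2"] show "tn a b \<in> leading q"
      using b pq leadingI(1)[of b q] leadingI(2)[of a b q] leadingI(3)[of b q a] by auto
  qed simp
  with r show ?thesis by blast
qed

text \<open>A product of two primitive left factors need not be primitive, but then both right
  factors have lost a unit, and a loss of two admits any left factor.\<close>

lemma leading_mult:
  assumes "r \<in> leading p" "s \<in> leading q" shows "r * s \<in> leading (p + q)"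
proof (rule endo.span_mult[OF assms[unfolded leading_def]])
  fix r s
  assume "r \<in> {tn a b |a b. b \<in> filt p \<and> (a = 1 \<or> a \<in> primitives \<and> b \<in> filt (p - 1) \<or> b \<in> filt (p - 2))}"
    and "s \<in> {tn a b |a b. b \<in> filt q \<and> (a = 1 \<or> a \<in> primitives \<and> b \<in> filt (q - 1) \<or> b \<in> filt (q - 2))}"
  then obtain a b c d where r: "r = tn a b" "b \<in> filt p"
      "a = 1 \<or> a \<in> primitives \<and> b \<in> filt (p - 1) \<or> b \<in> filt (p - 2)"
    and s: "s = tn c d" "d \<in> filt q" "c = 1 \<or> c \<in> primitives \<and> d \<in> filt (q - 1) \<or> d \<in> filt (q - 2)"
    by blast
  note mult = filt_mult_le[where a = b and b = d]
  have "b * d \<in> filt (p + q)"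
    "b \<in> filt (p - 1) \<or> d \<in> filt (q - 1) \<Longrightarrow> b * d \<in> filt (p + q - 1)"
    "b \<in> filt (p - 2) \<or> d \<in> filt (q - 2) \<Longrightarrow> b * d \<in> filt (p + q - 2)"
    "b \<in> filt (p - 1) \<Longrightarrow> d \<in> filt (q - 1) \<Longrightarrow> b * d \<in> filt (p + q - 2)"
    using r(2) s(2) mult[of p q "p + q"] mult[of "p - 1" q "p + q - 1"] mult[of p "q - 1" "p + q - 1"]
      mult[of "p - 2" q "p + q - 2"] mult[of p "q - 2" "p + q - 2"] mult[of "p - 1" "q - 1" "p + q - 2"]
    by auto
  then have "tn (a * c) (b * d) \<in> leading (p + q)"
    using r(3) s(3) by (elim disjE conjE) (simp_all add: leadingI)
  then show "r * s \<in> leading (p + q)" by (simp add: r s tn_mult)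
qed simp

lemma cm_y_leading: "v < m \<Longrightarrow> cm (y v) \<in> leading (int (wt v))"
proof -
  assume v: "v < m"
  have one: "tn 1 (y v) \<in> leading (int (wt v))" by (intro leadingI(1) filt_gen v)
  show ?thesis
  proof (cases "v < e")
    case True
    have "dl (y v) \<in> leading 2"
      by (rule tensor_span_linear[where f = "\<lambda>r. r" and A = primitives and B = primitives and s = endo_scale])
        (use y_P2[OF v] in \<open>auto simp: P2_iff Vector_Spaces.linear_iff endo.vector_space_axioms
          intro!: leadingI(2) primitives_filt\<close>)
    moreover have "tn (y v) 1 \<in> leading 2" by (intro leadingI(3) filt_one) simp
    ultimately show ?thesis
      using one True by (auto simp: cm_eq pr_def wt_def intro!: endo.subspace_add)
  next
    case False
    then have "tn (y v) 1 \<in> leading 1" using v by (intro leadingI(2) y_primitive filt_one) auto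
    with one show ?thesis
      using False v by (auto simp: cm_primitive y_primitive pr_def wt_def intro!: endo.subspace_add)
  qed
qed

lemma cm_leading:
  assumes "a \<in> filt n" shows "cm a \<in> leading n"
proof -
  have word: "cm (prod_list (map y us)) \<in> leading (int (sum_list (map wt us)))" if "set us \<subseteq> {..<m}" for us
    using that
  proof (induction us)
    case Nil
    show ?case by (simp add: cm_one leadingI filt_one)
  next
    case (Cons u us)
    then have "cm (y u) * cm (prod_list (map y us)) \<in> leading (int (wt u) + int (sum_list (map wt us)))"
      by (intro leading_mult cm_y_leading) auto
    then show ?case by (simp add: cm_mult)
  qed
  show ?thesis
    by (rule linear_span_in_subspace[OF linear_cm assms[unfolded filt_def] subspace_leading])
      (use leading_mono[OF word] in blast)
qed

section \<open>Contractions as derivations\<close>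

definition contract :: "('h \<Rightarrow> 'k) \<Rightarrow> ('h \<times> 'h, 'k) endo \<Rightarrow> 'h" where
  "contract \<phi> = lift scale (\<lambda>a b. scale (\<phi> a) b)"

lemma linear_contract: "Vector_Spaces.linear endo_scale scale (contract \<phi>)"
  unfolding contract_def by (rule linear_lift) (rule vector_space_axioms)

lemma contract_tn: "Vector_Spaces.linear scale (*) \<phi> \<Longrightarrow> contract \<phi> (tn a b) = scale (\<phi> a) b"
  unfolding contract_def by (rule lift_functional_tn)

lemma contract_counit: "contract \<epsilon> (cm h) = h"
  unfolding contract_def by (rule counit_lift)

text \<open>For left factors \<open>a\<close> and \<open>c\<close> the defect of the product rule is
  the scalar \<open>\<phi> (a * c) - \<phi> a * \<epsilon> c - \<epsilon> a * \<phi> c\<close>. It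
  is 0 if one of them is 1; otherwise each right factor has lost a unit. Contraction with
  \<open>\<epsilon>\<close> restores the undifferentiated factor.\<close>

lemma graded_derivation_contract:
  assumes \<phi>: "Vector_Spaces.linear scale (*) \<phi>" "\<phi> 1 = 0"
  shows "graded_derivation 1 (\<lambda>h. contract \<phi> (cm h))"
proof -
  interpret L: Vector_Spaces.linear endo_scale scale "contract \<phi>" by (rule linear_contract)
  interpret C: Vector_Spaces.linear endo_scale scale "contract \<epsilon>" by (rule linear_contract)
  have low: "contract \<phi> r \<in> filt (n - 1)" if "r \<in> leading n" for r n
    by (rule linear_span_in_subspace[OF linear_contract that[unfolded leading_def] subspace_filt])
      (auto simp: contract_tn \<phi> filt_closed intro!: filt_closed(4) intro: filt_mono)
  have prod: "contract \<phi> (r * s) - (contract \<phi> r * contract \<epsilon> s + contract \<epsilon> r * contract \<phi> s) \<in> filt (p + q - 1 - 1)"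
    if "r \<in> leading p" "s \<in> leading q" for r s p q
  proof (rule bilinear_in_subspace[OF that[unfolded leading_def], where ?s3.0 = scale and
        f = "\<lambda>r s. contract \<phi> (r * s) - (contract \<phi> r * contract \<epsilon> s + contract \<epsilon> r * contract \<phi> s)"])
    show "Vector_Spaces.linear endo_scale scale
        (\<lambda>r. contract \<phi> (r * s) - (contract \<phi> r * contract \<epsilon> s + contract \<epsilon> r * contract \<phi> s))" for s
      by (simp add: Vector_Spaces.linear_iff vector_space_axioms endo.vector_space_axioms L.add L.scale C.add C.scale
          distrib_right endo.scale_mult_left scale_mult_left scale_right_diff_distrib scale_right_distrib)
    show "Vector_Spaces.linear endo_scale scale
        (\<lambda>s. contract \<phi> (r * s) - (contract \<phi> r * contract \<epsilon> s + contract \<epsilon> r * contract \<phi> s))" for r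
      by (simp add: Vector_Spaces.linear_iff vector_space_axioms endo.vector_space_axioms L.add L.scale C.add C.scale
          distrib_left endo.scale_mult_right scale_mult_right scale_right_diff_distrib scale_right_distrib)
    fix r s
    assume "r \<in> {tn a b |a b. b \<in> filt p \<and> (a = 1 \<or> a \<in> primitives \<and> b \<in> filt (p - 1) \<or> b \<in> filt (p - 2))}"
      and "s \<in> {tn a b |a b. b \<in> filt q \<and> (a = 1 \<or> a \<in> primitives \<and> b \<in> filt (q - 1) \<or> b \<in> filt (q - 2))}"
    then obtain a b c d where r: "r = tn a b" "b \<in> filt p"
        "a = 1 \<or> a \<in> primitives \<and> b \<in> filt (p - 1) \<or> b \<in> filt (p - 2)"
      and s: "s = tn c d" "d \<in> filt q" "c = 1 \<or> c \<in> primitives \<and> d \<in> filt (q - 1) \<or> d \<in> filt (q - 2)"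
      by blast
    let ?k = "\<phi> (a * c) - (\<phi> a * \<epsilon> c + \<epsilon> a * \<phi> c)"
    have eq: "contract \<phi> (r * s) - (contract \<phi> r * contract \<epsilon> s + contract \<epsilon> r * contract \<phi> s) = scale ?k (b * d)"
      by (simp add: r s tn_mult contract_tn \<phi> counit_linear scale_mult_left scale_mult_right
          scale_left_distrib scale_left_diff_distrib mult.commute)
    show "contract \<phi> (r * s) - (contract \<phi> r * contract \<epsilon> s + contract \<epsilon> r * contract \<phi> s) \<in> filt (p + q - 1 - 1)"
    proof (cases "a = 1 \<or> c = 1")
      case True
      then have "?k = 0" using \<phi>(2) counit_one by auto
      then show ?thesis unfolding eq by (simp add: filt_closed)
    next
      case False
      have bd: "b * d \<in> filt n" if "b \<in> filt i" "d \<in> filt j" "i + j \<le> n" for i j n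
        using that by (rule filt_mult_le)
      have "b * d \<in> filt (p + q - 1 - 1)"
        using r s False by (auto intro: bd[of "p - 1" "q - 1"] bd[of "p - 2" q] bd[of p "q - 2"])
      then show ?thesis unfolding eq by (rule filt_closed)
    qed
  qed simp
  have "Vector_Spaces.linear scale scale (\<lambda>h. contract \<phi> (cm h))"
    by (simp add: Vector_Spaces.linear_iff vector_space_axioms cm.add cm.scale L.add L.scale)
  moreover have "contract \<phi> (cm (a * b)) - (contract \<phi> (cm a) * b + a * contract \<phi> (cm b)) \<in> filt (p + q - 1 - 1)"
    if "a \<in> filt p" "b \<in> filt q" for a b p q
    using prod[OF cm_leading[OF that(1)] cm_leading[OF that(2)]] by (simp add: cm_mult contract_counit)
  ultimately show ?thesis
    using low cm_leading by (auto simp: graded_derivation_def)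
qed

section \<open>Operators dual to the generators\<close>

lemma contract_cm_primitive:
  assumes "Vector_Spaces.linear scale (*) \<phi>" "\<phi> 1 = 0" "x \<in> primitives"
  shows "contract \<phi> (cm x) = scale (\<phi> x) 1"
proof -
  interpret L: Vector_Spaces.linear endo_scale scale "contract \<phi>" by (rule linear_contract)
  show ?thesis using assms by (simp add: cm_primitive pr_def L.add contract_tn)
qed

lemma contract_cm_P2:
  assumes "Vector_Spaces.linear scale (*) \<phi>" "\<phi> 1 = 0" "c \<in> P2"
  shows "contract \<phi> (cm c) = scale (\<phi> c) 1 + contract \<phi> (dl c)" "contract \<phi> (dl c) \<in> primitives"
proof -
  interpret L: Vector_Spaces.linear endo_scale scale "contract \<phi>" by (rule linear_contract)
  show "contract \<phi> (cm c) = scale (\<phi> c) 1 + contract \<phi> (dl c)"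
    using assms by (simp add: cm_eq pr_def L.add contract_tn)
  show "contract \<phi> (dl c) \<in> primitives"
    by (rule tensor_span_linear[OF linear_contract _ subspace_primitives])
      (use assms in \<open>auto simp: P2_iff contract_tn intro: subspace_scale subspace_primitives\<close>)
qed

text \<open>The values are compatible because 1 is not a combination of primitive elements: the
  counit vanishes on these but not at 1. The values at generators of weight 2 remain open.\<close>

lemma coordinate_functional:
  assumes "i \<in> {e..<m}"
  shows "\<exists>\<phi>. Vector_Spaces.linear scale (*) \<phi> \<and> \<phi> 1 = 0 \<and> (\<forall>j\<in>{e..<m}. \<phi> (y j) = (if j = i then 1 else 0))"
proof -
  interpret p: vector_space_pair scale "(*) :: 'k \<Rightarrow> 'k \<Rightarrow> 'k" by unfold_locales
  have "1 \<notin> primitives" using counit_primitive[of 1] counit_one by auto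
  then have 1: "1 \<notin> span (y ` {e..<m})" by (simp add: span_primitives)
  have sub: "{e..<m} \<subseteq> {..<m}" by auto
  have ind: "independent (insert 1 (y ` {e..<m}))"
    by (rule independent_insertI[OF 1]) (rule independent_mono[OF independent_y image_mono[OF sub]])
  from p.linear_independent_extend[OF ind, of "\<lambda>x. if x = y i then 1 else 0"] obtain \<phi> where
    \<phi>: "Vector_Spaces.linear scale (*) \<phi>" "\<forall>x\<in>insert 1 (y ` {e..<m}). \<phi> x = (if x = y i then 1 else 0)"
    by blast
  have "y i \<noteq> 1" using span_base[of "y i" "y ` {e..<m}"] assms 1 by auto
  moreover have "y j = y i \<longleftrightarrow> j = i" if "j \<in> {e..<m}" for j
    using inj_onD[OF inj_y, of j i] that assms by auto
  ultimately show ?thesis using \<phi> by (intro exI[of _ \<phi>]) auto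
qed

definition coord :: "nat \<Rightarrow> 'h \<Rightarrow> 'k" where
  "coord i = (SOME \<phi>. Vector_Spaces.linear scale (*) \<phi> \<and> \<phi> 1 = 0 \<and>
     (\<forall>j\<in>{e..<m}. \<phi> (y j) = (if j = i then 1 else 0)))"

lemma coord:
  assumes "i \<in> {e..<m}"
  shows "Vector_Spaces.linear scale (*) (coord i)" "coord i 1 = 0"
    "\<And>j. j \<in> {e..<m} \<Longrightarrow> coord i (y j) = (if j = i then 1 else 0)"
  using someI_ex[OF coordinate_functional[OF assms]] unfolding coord_def by blast+

lemma coord_expansion:
  assumes "x \<in> primitives" shows "x = (\<Sum>i\<in>{e..<m}. scale (coord i x) (y i))"
proof -
  have lin: "Vector_Spaces.linear scale scale (\<lambda>x. x - (\<Sum>i\<in>{e..<m}. scale (coord i x) (y i)))"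
    using coord(1) by (simp add: Vector_Spaces.linear_iff vector_space_axioms scale_left_distrib sum.distrib
        scale_sum_right scale_right_diff_distrib)
  have "x - (\<Sum>i\<in>{e..<m}. scale (coord i x) (y i)) \<in> {0}"
  proof (rule linear_span_in_subspace[OF lin assms[folded span_primitives]])
    fix a assume "a \<in> y ` {e..<m}"
    then obtain j where j: "a = y j" "j \<in> {e..<m}" by blast
    have "(\<Sum>i\<in>{e..<m}. scale (coord i (y j)) (y i)) = (\<Sum>i\<in>{e..<m}. if i = j then y i else 0)"
      using j(2) coord(3) by (intro sum.cong) auto
    then show "a - (\<Sum>i\<in>{e..<m}. scale (coord i a) (y i)) \<in> {0}" using j by simp
  qed simp
  then show ?thesis by simp
qed

text \<open>The kernel of \<open>dl\<close> consists of the primitive elements, which meet the span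
  of the weight 2 generators only in 0; so \<open>dl\<close> maps these generators to independent
  tensors.\<close>

lemma dual_functional:
  assumes "v < e"
  shows "\<exists>\<theta>. Vector_Spaces.linear endo_scale (*) \<theta> \<and> (\<forall>u<e. \<theta> (dl (y u)) = (if u = v then 1 else 0))"
proof -
  interpret p: vector_space_pair endo_scale "(*) :: 'k \<Rightarrow> 'k \<Rightarrow> 'k" by unfold_locales
  interpret q: vector_space_pair scale scale by unfold_locales
  have sub: "{..<e} \<subseteq> {..<m}" using e_le by auto
  have ind: "independent (y ` {..<e})" by (rule independent_mono[OF independent_y image_mono[OF sub]])
  \<comment> \<open>On \<open>P2\<close>, \<open>P\<close> is the projection to the span of the
    weight 2 generators along the primitive elements; it shows that the two meet only in 0.\<close>
  from q.linear_independent_extend[OF independent_y, of "\<lambda>x. if x \<in> y ` {..<e} then x else 0"] obtain P where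
    P: "Vector_Spaces.linear scale scale P" "\<forall>x\<in>y ` {..<m}. P x = (if x \<in> y ` {..<e} then x else 0)" by blast
  interpret P: Vector_Spaces.linear scale scale P by fact
  have low: "P x = x" if "x \<in> span (y ` {..<e})" for x
    by (rule q.linear_eq_on[OF P(1) module_hom_ident that]) (use P(2) sub in auto)
  have "y j \<notin> y ` {..<e}" if "j \<in> {e..<m}" for j
    using inj_onD[OF inj_y] that by fastforce
  then have "P x = 0" if "x \<in> y ` {e..<m}" for x using P(2) that by auto
  then have high: "P x = 0" if "x \<in> primitives" for x
    using P.eq_0_on_span[of "y ` {e..<m}" x] that unfolding span_primitives by blast
  have zero: "x = 0" if "x \<in> span (y ` {..<e})" "dl x = 0" for x
    using low[OF that(1)] high that(2) by (simp add: primitives_iff)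
  have inj: "inj_on dl (span (y ` {..<e}))"
    using zero dl.inj_on_iff_eq_0[of "span (y ` {..<e})"] by auto
  have ind': "endo.independent (dl ` y ` {..<e})" by (rule dl.independent_injective_image[OF ind inj])
  from p.linear_independent_extend[OF ind', of "\<lambda>x. if x = dl (y v) then 1 else 0"] obtain \<theta> where
    \<theta>: "Vector_Spaces.linear endo_scale (*) \<theta>" "\<forall>x\<in>dl ` y ` {..<e}. \<theta> x = (if x = dl (y v) then 1 else 0)" by blast
  have "dl (y u) = dl (y v) \<longleftrightarrow> u = v" if "u < e" for u
    using inj_onD[OF inj, of "y u" "y v"] inj_onD[OF inj_y, of u v] that assms sub by (auto simp: span_base)
  then show ?thesis using \<theta> by (intro exI[of _ \<theta>]) auto
qed

definition dual :: "nat \<Rightarrow> ('h \<times> 'h, 'k) endo \<Rightarrow> 'k" where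
  "dual v = (SOME \<theta>. Vector_Spaces.linear endo_scale (*) \<theta> \<and> (\<forall>u<e. \<theta> (dl (y u)) = (if u = v then 1 else 0)))"

lemma dual:
  assumes "v < e"
  shows "Vector_Spaces.linear endo_scale (*) (dual v)" "\<And>u. u < e \<Longrightarrow> dual v (dl (y u)) = (if u = v then 1 else 0)"
  using someI_ex[OF dual_functional[OF assms]] unfolding dual_def by blast+

definition D :: "nat \<Rightarrow> 'h \<Rightarrow> 'h" where
  "D i h = contract (coord i) (cm h)"

text \<open>For \<open>v < e\<close> the commutators of the \<open>D i\<close> are combined so that \<open>c \<in> P2\<close> is sent to the value of the
  \<open>v\<close>-th dual functional at \<open>dl c\<close>; the factor 2 comes from the antisymmetry of \<open>dl c\<close>.\<close>

definition E :: "nat \<Rightarrow> 'h \<Rightarrow> 'h" where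
  "E v = (if v < e then \<lambda>h. \<Sum>(i, j)\<in>{e..<m} \<times> {e..<m}.
       scale (dual v (tn (y i) (y j)) / 2) (D j (D i h) - D i (D j h)) else D v)"

lemma graded_derivation_D: "i \<in> {e..<m} \<Longrightarrow> graded_derivation 1 (D i)"
  unfolding D_def by (rule graded_derivation_contract) (rule coord, assumption)+

lemma graded_derivation_E: "v < m \<Longrightarrow> graded_derivation (int (wt v)) (E v)"
proof (cases "v < e")
  case True
  have "graded_derivation 2 (\<lambda>h. \<Sum>p\<in>{e..<m} \<times> {e..<m}. scale (dual v (tn (y (fst p)) (y (snd p))) / 2)
      (D (snd p) (D (fst p) h) - D (fst p) (D (snd p) h)))"
    using graded_derivation_commutator[OF graded_derivation_D graded_derivation_D]
    by (intro graded_derivation_sum) auto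
  with True show ?thesis by (simp add: E_def wt_def case_prod_unfold)
next
  case False
  assume "v < m"
  with False show ?thesis using graded_derivation_D[of v] by (simp add: E_def wt_def)
qed

lemma D_primitive: "i \<in> {e..<m} \<Longrightarrow> x \<in> primitives \<Longrightarrow> D i x = scale (coord i x) 1"
  unfolding D_def by (intro contract_cm_primitive coord)

lemma linear_D: "Vector_Spaces.linear scale scale (D i)"
proof -
  interpret L: Vector_Spaces.linear endo_scale scale "contract (coord i)" by (rule linear_contract)
  show ?thesis by (simp add: Vector_Spaces.linear_iff vector_space_axioms D_def cm.add cm.scale L.add L.scale)
qed

lemma D_one: "i \<in> {e..<m} \<Longrightarrow> D i 1 = 0"
  by (simp add: D_def cm_one contract_tn coord)

text \<open>\<open>D i c\<close> is a scalar plus a primitive element; \<open>D j\<close> kills the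
  former and reads a coordinate of the latter.\<close>

lemma D_D_P2:
  assumes i: "i \<in> {e..<m}" and j: "j \<in> {e..<m}" and c: "c \<in> P2"
  shows "D j (D i c) = scale (coord j (contract (coord i) (dl c))) 1"
proof -
  interpret D: Vector_Spaces.linear scale scale "D j" by (rule linear_D)
  note c' = contract_cm_P2[OF coord(1,2)[OF i] c]
  show ?thesis
    using c'(2) by (simp add: D_def[of i] c'(1) D.add D.scale D_one[OF j] D_primitive[OF j])
qed

text \<open>On \<open>c\<close> the commutator of \<open>D j\<close> and \<open>D i\<close> is twice
  the coordinate of \<open>dl c\<close> at \<open>y i \<otimes> y j\<close>, and the coefficients in
  \<open>E v\<close> are the values of \<open>dual v\<close> at these tensors.\<close>

lemma E_P2:
  assumes v: "v < e" and c: "c \<in> P2"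
  shows "E v c = scale (dual v (dl c)) 1"
proof -
  let ?I = "{e..<m} \<times> {e..<m}"
  \<comment> \<open>The functional \<open>coord i \<otimes> coord j\<close> on tensors.\<close>
  define B where "B i j r = coord j (contract (coord i) r)" for i j r
  have linB: "Vector_Spaces.linear endo_scale (*) (B i j)" if "j \<in> {e..<m}" for i j
    using linear_contract[of "coord i"] coord(1)[OF that]
    by (auto simp: Vector_Spaces.linear_iff B_def)
  have B_tn: "B i j (tn a b) = coord i a * coord j b" if "i \<in> {e..<m}" "j \<in> {e..<m}" for i j a b
    using coord(1)[OF that(2)] by (simp add: B_def contract_tn[OF coord(1)[OF that(1)]] Vector_Spaces.linear_iff)
  have lin_tw: "Vector_Spaces.linear endo_scale endo_scale tw" by (rule linear_tw)
  have ts: "dl c \<in> tensor_span primitives primitives" "tw (dl c) = - dl c" using c by (auto simp: P2_iff)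
  have anti: "B j i (dl c) = - B i j (dl c)" if ij: "i \<in> {e..<m}" "j \<in> {e..<m}" for i j
  proof -
    interpret b: Vector_Spaces.linear endo_scale "(*)" "B i j" by (rule linB[OF ij(2)])
    have lin: "Vector_Spaces.linear endo_scale (*) (\<lambda>r. B j i r - B i j (tw r))"
      using linB[OF ij(1), of j] linB[OF ij(2), of i] lin_tw by (simp add: Vector_Spaces.linear_iff algebra_simps)
    have "B j i (dl c) - B i j (tw (dl c)) \<in> {0}"
      by (rule tensor_span_linear[OF lin ts(1)]) (simp_all add: B_tn[OF ij] B_tn[OF ij(2,1)] tw_tn counit.vs2.subspace_single_0)
    then show ?thesis by (simp add: ts(2) b.neg eq_neg_iff_add_eq_0)
  qed
  have exp: "dual v (dl c) = (\<Sum>(i, j)\<in>?I. dual v (tn (y i) (y j)) * B i j (dl c))"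
  proof -
    interpret d: Vector_Spaces.linear endo_scale "(*)" "dual v" by (rule dual(1)[OF v])
    let ?Q = "\<lambda>r. \<Sum>p\<in>?I. dual v (tn (y (fst p)) (y (snd p))) * B (fst p) (snd p) r"
    have B: "B (fst p) (snd p) (r + s) = B (fst p) (snd p) r + B (fst p) (snd p) s"
      "B (fst p) (snd p) (endo_scale k r) = k * B (fst p) (snd p) r" if "p \<in> ?I" for p r s k
      using linB[of "snd p" "fst p"] that by (auto simp: Vector_Spaces.linear_iff)
    have "?Q (r + s) = ?Q r + ?Q s" for r s
      unfolding sum.distrib[symmetric] by (intro sum.cong refl) (simp only: B distrib_left)
    moreover have "?Q (endo_scale k r) = k * ?Q r" for k r
      unfolding sum_distrib_left by (intro sum.cong refl) (simp only: B mult.left_commute)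
    ultimately have lin: "Vector_Spaces.linear endo_scale (*) (\<lambda>r. dual v r - ?Q r)"
      by (simp only: Vector_Spaces.linear_iff endo.vector_space_axioms counit.vs2.vector_space_axioms
          d.add d.scale right_diff_distrib add_diff_add simp_thms)
    have "dual v (dl c) - (\<Sum>p\<in>?I. dual v (tn (y (fst p)) (y (snd p))) * B (fst p) (snd p) (dl c)) \<in> {0}"
    proof (rule tensor_span_linear[OF lin ts(1)])
      fix a b assume ab: "a \<in> primitives" "b \<in> primitives"
      have "tn a b = tn (\<Sum>i\<in>{e..<m}. scale (coord i a) (y i)) (\<Sum>j\<in>{e..<m}. scale (coord j b) (y j))"
        using coord_expansion[OF ab(1)] coord_expansion[OF ab(2)] by simp
      also have "\<dots> = (\<Sum>j\<in>{e..<m}. \<Sum>i\<in>{e..<m}. endo_scale (coord j b * coord i a) (tn (y i) (y j)))"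
        unfolding tnl.sum tnr.sum tnl.scale tnr.scale endo.scale_sum_right endo.scale_scale by (rule refl)
      also have "\<dots> = (\<Sum>i\<in>{e..<m}. \<Sum>j\<in>{e..<m}. endo_scale (coord j b * coord i a) (tn (y i) (y j)))"
        by (rule sum.swap)
      finally have tn_ab: "tn a b = \<dots>" .
      have "dual v (tn a b) = (\<Sum>i\<in>{e..<m}. \<Sum>j\<in>{e..<m}. coord j b * coord i a * dual v (tn (y i) (y j)))"
        by (simp only: tn_ab d.sum d.scale)
      also have "\<dots> = (\<Sum>i\<in>{e..<m}. \<Sum>j\<in>{e..<m}. dual v (tn (y i) (y j)) * B i j (tn a b))"
        by (intro sum.cong refl) (simp add: B_tn)
      finally have "dual v (tn a b) = (\<Sum>i\<in>{e..<m}. \<Sum>j\<in>{e..<m}. dual v (tn (y i) (y j)) * B i j (tn a b))" .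
      then show "dual v (tn a b) - (\<Sum>p\<in>?I. dual v (tn (y (fst p)) (y (snd p))) * B (fst p) (snd p) (tn a b)) \<in> {0}"
        by (simp add: sum.cartesian_product case_prod_unfold)
    qed (simp add: counit.vs2.subspace_single_0)
    then show ?thesis by (simp add: case_prod_unfold)
  qed
  have "E v c = (\<Sum>(i, j)\<in>?I. scale (dual v (tn (y i) (y j)) * B i j (dl c)) 1)"
    unfolding E_def if_P[OF v]
  proof (rule sum.cong, simp, clarify)
    fix i j assume ij: "i \<in> {e..<m}" "j \<in> {e..<m}"
    have "D j (D i c) - D i (D j c) = scale (B i j (dl c) - B j i (dl c)) 1"
      by (simp only: D_D_P2[OF ij c] D_D_P2[OF ij(2,1) c] B_def scale_left_diff_distrib)
    also have "\<dots> = scale (2 * B i j (dl c)) 1" by (simp add: anti[OF ij])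
    finally show "scale (dual v (tn (y i) (y j)) / 2) (D j (D i c) - D i (D j c))
        = scale (dual v (tn (y i) (y j)) * B i j (dl c)) 1" by simp
  qed
  also have "\<dots> = scale (dual v (dl c)) 1"
    unfolding exp by (simp add: scale_sum_left case_prod_unfold)
  finally show ?thesis .
qed

sublocale triangular_generators scale m y wt E
proof unfold_locales
  fix v assume v: "v < m"
  show "E v (y v) = 1"
  proof (cases "v < e")
    case True
    then show ?thesis using E_P2[OF _ y_P2[OF v]] by (simp add: dual)
  next
    case False
    then show ?thesis using D_primitive[of v "y v"] v y_primitive[of v] coord(3)[of v v] by (simp add: E_def)
  qed
next
  fix v u assume u: "v < u" "u < m"
  then have v: "v < m" by simp
  show "E v (y u) = 0"
  proof (cases "v < e")
    case True
    then have E: "E v (y u) = scale (dual v (dl (y u))) 1" by (rule E_P2[OF _ y_P2[OF u(2)]])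
    interpret d: Vector_Spaces.linear endo_scale "(*)" "dual v" by (rule dual(1)[OF True])
    show ?thesis
    proof (cases "u < e")
      case True
      then show ?thesis using E dual(2)[OF \<open>v < e\<close> True] u by simp
    next
      case False
      then have "dl (y u) = 0" using y_primitive[of u] u by (simp add: primitives_iff)
      then show ?thesis using E by simp
    qed
  next
    \<comment> \<open>Generators after a primitive one are primitive; the uncontrolled values of
      \<open>D v\<close> at weight 2 generators belong to smaller indices.\<close>
    case False
    then show ?thesis using D_primitive[of v "y u"] v u y_primitive[of u] coord(3)[of v u] by (simp add: E_def)
  qed
qed (use y_commutator generate_y graded_derivation_E in auto)

lemma dim_P2: "dim P2 = m" "fin_dim P2"
  using dim_span_eq_card_independent[OF independent_y] card_image[OF inj_y] span_P2
  by (auto simp: fin_dim_def)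

end

theorem theorem1p1:
  fixes scale :: "'k::{alg_closed_field, field_char_0} \<Rightarrow> 'h::ring_1 \<Rightarrow> 'h"
    and \<Delta> :: "'h \<Rightarrow> ('k, 'h) tensor2"
    and \<epsilon> :: "'h \<Rightarrow> 'k"
    and S :: "'h \<Rightarrow> 'h"
    and \<gg> :: "'h set"
    and br :: "'h \<Rightarrow> 'h \<Rightarrow> 'h"
  assumes "lie_algebra scale \<gg> br"
    and "k_vector_space.fin_dim scale \<gg>"
    and "hopf_algebra scale \<Delta> \<epsilon> S"
    and "hopf_algebra.connected scale \<Delta>"
    and "hopf_algebra.locally_finite scale \<Delta>"
    and "hopf_algebra.primitives scale \<Delta> = \<gg>"
    and "\<forall>x\<in>\<gg>. \<forall>y\<in>\<gg>. br x y = x * y - y * x"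
    and "k_algebra.generated_subalgebra scale (hopf_algebra.P2 scale \<Delta>) = UNIV"
    and "hopf_algebra.U_H scale \<Delta> S \<noteq> UNIV"
    and "hopf_algebra.normal_hopf_subalgebra scale \<Delta> S (hopf_algebra.U_H scale \<Delta> S)"
  shows "k_algebra.GK_dim scale = k_vector_space.vdim scale (hopf_algebra.P2 scale \<Delta>)"
proof -
  interpret hopf_algebra scale \<Delta> \<epsilon> S by fact
  interpret normal_hopf_algebra scale \<Delta> \<epsilon> S by unfold_locales fact
  obtain F where F: "finite F" "P2 \<subseteq> span F" using fin_dim_P2 assms(4,5) by blast
  obtain X where X: "X \<subseteq> primitives" "independent X" "primitives \<subseteq> span X"
    using maximal_independent_subset by blast
  obtain B where B: "X \<subseteq> B" "B \<subseteq> P2" "independent B" "P2 \<subseteq> span B"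
    using maximal_independent_subset_extend[OF order_trans[OF X(1) primitives_P2] X(2)] by blast
  have "finite B" using independent_span_bound[OF F(1) B(3)] B(2) F(2) by blast
  define C where "C = B - X"
  have fin: "finite X" "finite C" using \<open>finite B\<close> B(1) finite_subset by (auto simp: C_def)
  obtain f where f: "bij_betw f {0..<card C} C" using ex_bij_betw_nat_finite[OF fin(2)] by blast
  obtain g where g: "bij_betw g {0..<card X} X" using ex_bij_betw_nat_finite[OF fin(1)] by blast
  define e where "e = card C"
  define m where "m = card C + card X"
  \<comment> \<open>The complement is enumerated first, the order that \<open>E_above\<close>
    demands.\<close>
  define y where "y v = (if v < e then f v else g (v - e))" for v
  have "y ` {..<e} = f ` {0..<card C}" by (auto simp: y_def e_def)
  then have yC: "y ` {..<e} = C" using f by (simp add: bij_betw_def)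
  have "y ` {e..<m} = g ` ((\<lambda>v. v - e) ` {e..<m})" unfolding image_image by (rule image_cong) (auto simp: y_def)
  also have "(\<lambda>v. v - e) ` {e..<m} = {0..<card X}"
  proof (intro equalityI subsetI)
    fix k assume "k \<in> {0..<card X}"
    then show "k \<in> (\<lambda>v. v - e) ` {e..<m}" by (intro image_eqI[of _ _ "k + e"]) (auto simp: e_def m_def)
  qed (auto simp: e_def m_def)
  finally have yX: "y ` {e..<m} = X" using g by (simp add: bij_betw_def)
  have "{..<m} = {..<e} \<union> {e..<m}" by (auto simp: e_def m_def)
  then have yB: "y ` {..<m} = B" using yC yX B(1) by (auto simp: image_Un C_def)
  have "card B = m" using B(1) fin by (simp add: m_def C_def card_Diff_subset card_mono \<open>finite B\<close>)
  then have inj: "inj_on y {..<m}" using yB by (intro eq_card_imp_inj_on) auto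
  interpret P2_basis scale \<Delta> \<epsilon> S y e m
  proof unfold_locales
    show "span (y ` {..<m}) = P2" "span (y ` {e..<m}) = primitives"
      unfolding yB yX using span_subspace B X subspace_P2 subspace_primitives by blast+
  qed (use inj yB B(3) assms(8) in \<open>auto simp: e_def m_def\<close>)
  show ?thesis using GK_dim_eq dim_P2 by (simp add: vdim_def)
qed

end
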